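(* Let $\Gamma$ be a countable group which is measure equivalent to a non-elementary hyperbolic group or, more generally, to a non-elementary subgroup of a hyperbolic group. Then $\Gamma$ is in the class $\mathcal{C}_{\mathrm{reg}}$.
   Context: Hyperbolic group means Gromov-hyperbolic group. A subgroup of a hyperbolic group is elementary if it is virtually cyclic (finite groups included). Two countable groups $\Gamma$ and $\Lambda$ are measure equivalent (ME) if there is a (non-zero) $\sigma$-finite measure space $(\Sigma,m)$ with commuting measure preserving $\Gamma$- and $\Lambda$-actions, such that each one of the actions admits a finite measure fundamental domain. $\mathcal{C}_{\mathrm{reg}}$ is the class of countable groups $\Gamma$ for which the bounded cohomology $\mathrm{H}_{\mathrm b}^2(\Gamma,\ell^2(\Gamma))$ is non-trivial, where $\mathrm{H}_{\mathrm b}^n(\Gamma,V)$ is the cohomology of the complex of $\Gamma$-equivariant bounded functions $\Gamma^{n+1}\to V$ with the homogeneous coboundary and $\ell^2(\Gamma)$ carries the left regular representation. *)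

theory Defs
  imports
    "HOL-Analysis.Analysis"
    "HOL-Algebra.Algebra"
    "HOL-Library.Function_Algebras"
begin

section \<open>Hyperbolic and elementary groups\<close>

definition word_length :: "('g, 'a) monoid_scheme \<Rightarrow> 'g set \<Rightarrow> 'g \<Rightarrow> nat" where
  "word_length G S g =
     (LEAST n. \<exists>ws. length ws = n \<and> set ws \<subseteq> S \<union> m_inv G ` S
                   \<and> foldr (mult G) ws \<one>\<^bsub>G\<^esub> = g)"

definition word_dist :: "('g, 'a) monoid_scheme \<Rightarrow> 'g set \<Rightarrow> 'g \<Rightarrow> 'g \<Rightarrow> real" where
  "word_dist G S x y = real (word_length G S (inv\<^bsub>G\<^esub> x \<otimes>\<^bsub>G\<^esub> y))"

definition gromov_product :: "('x \<Rightarrow> 'x \<Rightarrow> real) \<Rightarrow> 'x \<Rightarrow> 'x \<Rightarrow> 'x \<Rightarrow> real" where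
  "gromov_product d w x y = (d x w + d y w - d x y) / 2"

definition gromov_hyperbolic :: "'x set \<Rightarrow> ('x \<Rightarrow> 'x \<Rightarrow> real) \<Rightarrow> bool" where
  "gromov_hyperbolic P d \<longleftrightarrow>
     (\<exists>\<delta>\<ge>0. \<forall>w\<in>P. \<forall>x\<in>P. \<forall>y\<in>P. \<forall>z\<in>P.
        gromov_product d w x z \<ge> min (gromov_product d w x y) (gromov_product d w y z) - \<delta>)"

text \<open>Hyperbolicity does not depend on the finite generating set, so asking for one suffices.\<close>

definition hyperbolic_group :: "('g, 'a) monoid_scheme \<Rightarrow> bool" where
  "hyperbolic_group G \<longleftrightarrow>
     group G \<and>
     (\<exists>S. finite S \<and> S \<subseteq> carrier G \<and> generate G S = carrier G \<and>
          gromov_hyperbolic (carrier G) (word_dist G S))"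

text \<open>Finite groups are included: the trivial subgroup is cyclic.\<close>

definition virtually_cyclic :: "('g, 'a) monoid_scheme \<Rightarrow> bool" where
  "virtually_cyclic G \<longleftrightarrow>
     group G \<and>
     (\<exists>C. subgroup C G \<and> cyclic_group (G\<lparr>carrier := C\<rparr>) \<and> finite (rcosets\<^bsub>G\<^esub> C))"

definition nonelementary_subgroup :: "'g set \<Rightarrow> ('g, 'a) monoid_scheme \<Rightarrow> bool" where
  "nonelementary_subgroup L G \<longleftrightarrow>
     subgroup L G \<and> \<not> virtually_cyclic (G\<lparr>carrier := L\<rparr>)"


section \<open>Measure equivalence\<close>

definition measure_preserving_action ::
    "('g, 'a) monoid_scheme \<Rightarrow> 's measure \<Rightarrow> ('g \<Rightarrow> 's \<Rightarrow> 's) \<Rightarrow> bool" where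
  "measure_preserving_action G M a \<longleftrightarrow>
     group_action G (space M) a \<and>
     (\<forall>g\<in>carrier G. a g \<in> M \<rightarrow>\<^sub>M M \<and> distr M M (a g) = M)"

text \<open>The translates of a fundamental domain tile the space up to a null set; in particular
  a group action with a fundamental domain is essentially free.\<close>

definition fundamental_domain ::
    "('g, 'a) monoid_scheme \<Rightarrow> 's measure \<Rightarrow> ('g \<Rightarrow> 's \<Rightarrow> 's) \<Rightarrow> 's set \<Rightarrow> bool" where
  "fundamental_domain G M a Y \<longleftrightarrow>
     Y \<in> sets M \<and> (AE x in M. \<exists>!g. g \<in> carrier G \<and> x \<in> a g ` Y)"

definition measure_equivalence_coupling ::
    "('g, 'a) monoid_scheme \<Rightarrow> ('h, 'b) monoid_scheme \<Rightarrow> 's measure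
       \<Rightarrow> ('g \<Rightarrow> 's \<Rightarrow> 's) \<Rightarrow> ('h \<Rightarrow> 's \<Rightarrow> 's) \<Rightarrow> bool" where
  "measure_equivalence_coupling G H M a b \<longleftrightarrow>
     sigma_finite_measure M \<and> emeasure M (space M) \<noteq> 0 \<and>
     measure_preserving_action G M a \<and> measure_preserving_action H M b \<and>
     (\<forall>g\<in>carrier G. \<forall>h\<in>carrier H. \<forall>x\<in>space M. a g (b h x) = b h (a g x)) \<and>
     (\<exists>Y. fundamental_domain G M a Y \<and> emeasure M Y < \<infinity>) \<and>
     (\<exists>Z. fundamental_domain H M b Z \<and> emeasure M Z < \<infinity>)"

text \<open>HOL cannot quantify existentially over types, so the type \<open>'s\<close> of points of the coupling
  is a parameter. A theorem with the hypothesis \<open>measure_equivalent TYPE('s) G H\<close> for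
  a type variable \<open>'s\<close> covers measure spaces on all types.\<close>

definition measure_equivalent ::
    "'s itself \<Rightarrow> ('g, 'a) monoid_scheme \<Rightarrow> ('h, 'b) monoid_scheme \<Rightarrow> bool" where
  "measure_equivalent _ G H \<longleftrightarrow>
     group G \<and> countable (carrier G) \<and> group H \<and> countable (carrier H) \<and>
     (\<exists>(M :: 's measure) a b. measure_equivalence_coupling G H M a b)"


section \<open>Bounded cohomology\<close>

text \<open>Points of the \<open>(n + 1)\<close>-fold product of \<open>G\<close> are lists of length \<open>n + 1\<close>.
  A coefficient module is given by a set \<open>V\<close> in an additive group, a norm \<open>N\<close>
  and an action \<open>\<pi>\<close> of \<open>G\<close>. Cochains vanish outside the product,
  so that distinct cochains differ on it.\<close>

definition tuples :: "('g, 'a) monoid_scheme \<Rightarrow> nat \<Rightarrow> 'g list set" where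
  "tuples G n = {xs. length xs = Suc n \<and> set xs \<subseteq> carrier G}"

definition bounded_cochains ::
    "('g, 'a) monoid_scheme \<Rightarrow> 'v::ab_group_add set \<Rightarrow> ('v \<Rightarrow> real) \<Rightarrow> ('g \<Rightarrow> 'v \<Rightarrow> 'v) \<Rightarrow> nat
       \<Rightarrow> ('g list \<Rightarrow> 'v) set" where
  "bounded_cochains G V N \<pi> n =
     {f. (\<forall>xs\<in>tuples G n. f xs \<in> V) \<and> (\<forall>xs. xs \<notin> tuples G n \<longrightarrow> f xs = 0) \<and>
         (\<forall>g\<in>carrier G. \<forall>xs\<in>tuples G n. f (map (mult G g) xs) = \<pi> g (f xs)) \<and>
         (\<exists>C. \<forall>xs\<in>tuples G n. N (f xs) \<le> C)}"

definition coboundary ::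
    "('g, 'a) monoid_scheme \<Rightarrow> nat \<Rightarrow> ('g list \<Rightarrow> 'v::ab_group_add) \<Rightarrow> 'g list \<Rightarrow> 'v" where
  "coboundary G n f xs =
     (if xs \<in> tuples G (Suc n)
      then \<Sum>i\<le>Suc n. let y = f (take i xs @ drop (Suc i) xs) in if even i then y else - y
      else 0)"

definition bounded_cocycles ::
    "('g, 'a) monoid_scheme \<Rightarrow> 'v::ab_group_add set \<Rightarrow> ('v \<Rightarrow> real) \<Rightarrow> ('g \<Rightarrow> 'v \<Rightarrow> 'v) \<Rightarrow> nat
       \<Rightarrow> ('g list \<Rightarrow> 'v) set" where
  "bounded_cocycles G V N \<pi> n = {f \<in> bounded_cochains G V N \<pi> n. \<forall>xs. coboundary G n f xs = 0}"

definition bounded_coboundaries ::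
    "('g, 'a) monoid_scheme \<Rightarrow> 'v::ab_group_add set \<Rightarrow> ('v \<Rightarrow> real) \<Rightarrow> ('g \<Rightarrow> 'v \<Rightarrow> 'v) \<Rightarrow> nat
       \<Rightarrow> ('g list \<Rightarrow> 'v) set" where
  "bounded_coboundaries G V N \<pi> n =
     (case n of 0 \<Rightarrow> {\<lambda>_. 0} | Suc m \<Rightarrow> coboundary G m ` bounded_cochains G V N \<pi> m)"

definition bounded_cohomology ::
    "('g, 'a) monoid_scheme \<Rightarrow> 'v::ab_group_add set \<Rightarrow> ('v \<Rightarrow> real) \<Rightarrow> ('g \<Rightarrow> 'v \<Rightarrow> 'v) \<Rightarrow> nat
       \<Rightarrow> ('g list \<Rightarrow> 'v) set monoid" where
  "bounded_cohomology G V N \<pi> n =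
     \<lparr>carrier = bounded_cocycles G V N \<pi> n, monoid.mult = (\<lambda>f h xs. f xs + h xs), one = (\<lambda>_. 0)\<rparr>
       Mod bounded_coboundaries G V N \<pi> n"


section \<open>The left regular representation and the class\<close>

text \<open>Elements of \<open>\<ell>\<^sup>2(G)\<close> vanish outside the carrier.
  Addition on the ambient function type is pointwise.\<close>

definition ell2 :: "('g, 'a) monoid_scheme \<Rightarrow> ('g \<Rightarrow> complex) set" where
  "ell2 G = {u. (\<forall>x. x \<notin> carrier G \<longrightarrow> u x = 0) \<and> (\<lambda>x. (cmod (u x))\<^sup>2) summable_on carrier G}"

definition ell2_norm :: "('g, 'a) monoid_scheme \<Rightarrow> ('g \<Rightarrow> complex) \<Rightarrow> real" where
  "ell2_norm G u = sqrt (\<Sum>\<^sub>\<infinity>x\<in>carrier G. (cmod (u x))\<^sup>2)"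

definition left_regular ::
    "('g, 'a) monoid_scheme \<Rightarrow> 'g \<Rightarrow> ('g \<Rightarrow> complex) \<Rightarrow> 'g \<Rightarrow> complex" where
  "left_regular G g u x = (if x \<in> carrier G then u (inv\<^bsub>G\<^esub> g \<otimes>\<^bsub>G\<^esub> x) else 0)"

definition class_C_reg :: "('g, 'a) monoid_scheme \<Rightarrow> bool" where
  "class_C_reg G \<longleftrightarrow>
     group G \<and> countable (carrier G) \<and>
     (let Hb2 = bounded_cohomology G (ell2 G) (ell2_norm G) (left_regular G) 2
      in carrier Hb2 \<noteq> {\<one>\<^bsub>Hb2\<^esub>})"

end

theory Submission
  imports Defs "HOL-Complex_Analysis.Great_Picard"
begin

text \<open>
  Let \<open>\<Lambda>\<close> be the non-elementary subgroup. Its coefficients are read at the identity: a bounded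
  \<open>\<ell>\<^sup>2\<close>-valued cocycle is a scalar function that is square summable along diagonal orbits. A visual
  metric at the identity of the hyperbolic group provides Lipschitz bumps \<open>u\<close>, \<open>v\<close> around two
  separated points; the cyclic sum of \<open>u(x)v(y) - u(y)v(x)\<close> is such a cocycle, because away from the
  centre of a geodesic triangle it decays exponentially along the three legs. It equals 1 on triples
  close to three prescribed separated points.

  Integrating it over pieces of a fundamental domain of \<open>\<Gamma>\<close> in the coupling yields scalar cocycles
  of \<open>\<Gamma>\<close>. If \<open>\<Gamma>\<close> were not in the class, they would be coboundaries of functions that are square
  summable along diagonal orbits, and such functions have mean almost 0 over independent samples of
  a random walk stopped at a random time, since a word of known total length can hardly be cut at a
  prescribed point. On the other hand any long element \<open>\<lambda>\<close> maps the complement of a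
  neighbourhood of \<open>\<lambda>\<^sup>-\<^sup>1\<close> close to \<open>\<lambda>\<close>. Among 51 elements with separated attracting and repelling
  neighbourhoods, three have repelling neighbourhoods that the samples mostly avoid, and the mean of
  the cocycle for these three is bounded below.
\<close>

section \<open>Spreading random walks\<close>

text \<open>The walk lives on \<Gamma>, about whose geometry nothing is known, so nothing controls
  where its samples land in \<Lambda>. Disjointness makes up for this: the probabilities of disjoint
  repelling neighbourhoods add up to at most 1, so fewer than 48 of the 51 exceed 1/48. Which three
  remain is known only after the walk has been chosen, whereas the walk has to be chosen against the
  constants of the cocycle in use. Hence a cocycle is prepared for every triple, and the walk is
  chosen against the sum of all constants. Multiplication by \<lambda> in \<Lambda> corresponds in
  \<Gamma> to multiplication by an element that depends on the point of the coupling. After a small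
  part of the fundamental domain is discarded, only finitely many such elements occur, and the
  pieces of integration are the sets on which they are constant. The law of a sample before
  multiplication by \<lambda> does not depend on \<lambda>, because \<Lambda> preserves the measure
  on the space of \<Gamma>-orbits.\<close>

definition cyclic_sum :: "('a \<Rightarrow> 'a \<Rightarrow> real) \<Rightarrow> 'a \<Rightarrow> 'a \<Rightarrow> 'a \<Rightarrow> real" where
  "cyclic_sum F x y z = F x y + F y z + F z x"

text \<open>For antisymmetric \<open>F\<close>, \<open>cyclic_sum F\<close> is the homogeneous
  coboundary of \<open>F\<close>, hence a cocycle, with values in [-3, 3]. Summability is asked of
  the coboundary only; \<open>F\<close> itself is merely bounded, which leaves room for a nontrivial
  class. Finite partial sums stand for the squared norm, and \<open>C\<close> is uniform in the
  triple because cochains have to be bounded.\<close>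

definition l2_kernel :: "('a, 'b) monoid_scheme \<Rightarrow> ('a \<Rightarrow> 'a \<Rightarrow> real) \<Rightarrow> real \<Rightarrow> bool" where
  "l2_kernel G F C \<longleftrightarrow> (\<forall>x y. F x y = - F y x) \<and> (\<forall>x y. \<bar>F x y\<bar> \<le> 1) \<and>
     (\<forall>x\<in>carrier G. \<forall>y\<in>carrier G. \<forall>z\<in>carrier G. \<forall>W. finite W \<and> W \<subseteq> carrier G \<longrightarrow>
       (\<Sum>g\<in>W. (cyclic_sum F (g \<otimes>\<^bsub>G\<^esub> x) (g \<otimes>\<^bsub>G\<^esub> y) (g \<otimes>\<^bsub>G\<^esub> z))\<^sup>2) \<le> C)"

text \<open>Each pair is an element together with its repelling set. Left multiplication by the
  element carries the complement of that set close to an attracting point, and the cocycle is 1 near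
  the three attracting points.\<close>

definition separates ::
    "('a, 'b) monoid_scheme \<Rightarrow> ('a \<Rightarrow> 'a \<Rightarrow> real) \<Rightarrow> 'a \<times> 'a set \<Rightarrow> 'a \<times> 'a set \<Rightarrow> 'a \<times> 'a set \<Rightarrow> bool" where
  "separates G F p q r \<longleftrightarrow> (\<forall>x\<in>carrier G - snd p. \<forall>y\<in>carrier G - snd q. \<forall>z\<in>carrier G - snd r.
     cyclic_sum F (fst p \<otimes>\<^bsub>G\<^esub> x) (fst q \<otimes>\<^bsub>G\<^esub> y) (fst r \<otimes>\<^bsub>G\<^esub> z) = 1)"

section \<open>Paths of a random walk and their probabilities\<close>

definition words :: "'a set \<Rightarrow> nat \<Rightarrow> 'a list set" where
  "words T n = {w. set w \<subseteq> T \<and> length w = n}"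

definition weight :: "('a \<Rightarrow> real) \<Rightarrow> 'a list \<Rightarrow> real" where
  "weight p w = prod_list (map p w)"

lemma words_0 [simp]: "words T 0 = {[]}"
  by (auto simp: words_def)

lemma finite_words [simp]: "finite T \<Longrightarrow> finite (words T n)"
  unfolding words_def by (rule finite_lists_length_eq)

lemma weight_Nil [simp]: "weight p [] = 1"
  and weight_Cons [simp]: "weight p (t # w) = p t * weight p w"
  and weight_append: "weight p (u @ v) = weight p u * weight p v"
  by (simp_all add: weight_def)

lemma sum_words_add:
  "(\<Sum>W\<in>words T (m + n). \<phi> W) = (\<Sum>u\<in>words T m. \<Sum>v\<in>words T n. \<phi> (u @ v))"
proof -
  have "(\<Sum>W\<in>words T (m + n). \<phi> W) = (\<Sum>(u, v)\<in>words T m \<times> words T n. \<phi> (u @ v))"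
    by (rule sum.reindex_bij_witness[of _ "\<lambda>(u, v). u @ v" "\<lambda>W. (take m W, drop m W)"])
       (auto simp: words_def dest: in_set_takeD in_set_dropD)
  then show ?thesis by (simp add: sum.cartesian_product)
qed

lemma sum_words_Suc:
  "(\<Sum>W\<in>words T (Suc n). \<phi> W) = (\<Sum>t\<in>T. \<Sum>w\<in>words T n. \<phi> (t # w))"
proof -
  have "(\<Sum>W\<in>words T (Suc n). \<phi> W) = (\<Sum>(t, w)\<in>T \<times> words T n. \<phi> (t # w))"
    by (rule sum.reindex_bij_witness[of _ "\<lambda>(t, w). t # w" "\<lambda>W. (hd W, tl W)"])
       (auto simp: words_def length_Suc_conv)
  then show ?thesis by (simp add: sum.cartesian_product)
qed

lemma weight_nonneg: "(\<And>t. t \<in> T \<Longrightarrow> p t \<ge> 0) \<Longrightarrow> w \<in> words T n \<Longrightarrow> weight p w \<ge> 0"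
  unfolding weight_def words_def by (intro prod_list_nonneg) auto

lemma sum_weight: "sum p T = 1 \<Longrightarrow> (\<Sum>w\<in>words T n. weight p w) = 1"
  by (induction n) (simp_all add: sum_words_Suc flip: sum_distrib_left)

text \<open>A value of \<open>v\<close> may be taken several times, while the square bound counts it
  once. Weighting by the multiplicity \<open>m\<close> repairs this: AM-GM gives \<kappa> \<le>
  (\<theta> \<kappa>^2 / m + m / \<theta>) / 2, where the first terms add up to one contribution per
  value and the second ones count coinciding pairs. The parameter \<theta> balances the two.\<close>

lemma sum_le_with_multiplicity:
  fixes v :: "'i \<Rightarrow> 'b" and \<kappa> :: "'b \<Rightarrow> real"
  assumes J: "finite J" and \<theta>: "\<theta> > 0" and C: "(\<Sum>g\<in>v ` J. (\<kappa> g)\<^sup>2) \<le> C"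
  shows "(\<Sum>j\<in>J. \<kappa> (v j)) \<le> (\<theta> * C + (\<Sum>j\<in>J. \<Sum>j'\<in>J. of_bool (v j = v j')) / \<theta>) / 2"
proof -
  define m :: "'b \<Rightarrow> real" where "m g = (\<Sum>j'\<in>J. of_bool (g = v j'))" for g
  have m: "m (v j) > 0" if "j \<in> J" for j
    unfolding m_def using that J by (intro sum_pos2[where i=j]) auto
  have amgm: "\<kappa> (v j) \<le> (\<theta> * ((\<kappa> (v j))\<^sup>2 / m (v j)) + m (v j) / \<theta>) / 2" if "j \<in> J" for j
  proof -
    have "0 \<le> (\<theta> * \<kappa> (v j) - m (v j))\<^sup>2 / (\<theta> * m (v j))"
      using m[OF that] \<theta> by simp
    also have "\<dots> = \<theta> * ((\<kappa> (v j))\<^sup>2 / m (v j)) + m (v j) / \<theta> - 2 * \<kappa> (v j)"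
      using m[OF that] \<theta> by (simp add: power2_eq_square field_simps)
    finally show ?thesis by simp
  qed
  have "(\<Sum>j\<in>J. (\<kappa> (v j))\<^sup>2 / m (v j)) = (\<Sum>g\<in>v ` J. \<Sum>j\<in>{j \<in> J. v j = g}. (\<kappa> (v j))\<^sup>2 / m (v j))"
    by (rule sum.image_gen[OF J])
  also have "\<dots> = (\<Sum>g\<in>v ` J. (\<kappa> g)\<^sup>2)"
  proof (rule sum.cong[OF refl])
    fix g assume g: "g \<in> v ` J"
    then have m0: "m g \<noteq> 0" using m by force
    have "(\<Sum>j\<in>{j \<in> J. v j = g}. (\<kappa> (v j))\<^sup>2 / m (v j)) = real (card {j \<in> J. v j = g}) * ((\<kappa> g)\<^sup>2 / m g)"
      by simp
    also have "real (card {j \<in> J. v j = g}) = m g"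
      using J by (simp add: m_def of_bool_def sum.If_cases Int_def eq_commute)
    finally show "(\<Sum>j\<in>{j \<in> J. v j = g}. (\<kappa> (v j))\<^sup>2 / m (v j)) = (\<kappa> g)\<^sup>2"
      using m0 by simp
  qed
  finally have e: "(\<Sum>j\<in>J. (\<kappa> (v j))\<^sup>2 / m (v j)) \<le> C" using C by simp
  have "(\<Sum>j\<in>J. \<kappa> (v j)) \<le> (\<Sum>j\<in>J. (\<theta> * ((\<kappa> (v j))\<^sup>2 / m (v j)) + m (v j) / \<theta>) / 2)"
    by (intro sum_mono amgm)
  also have "\<dots> = (\<theta> * (\<Sum>j\<in>J. (\<kappa> (v j))\<^sup>2 / m (v j)) + (\<Sum>j\<in>J. m (v j)) / \<theta>) / 2"
    by (simp add: sum.distrib sum_distrib_left sum_divide_distrib add_divide_distrib)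
  also have "\<dots> \<le> (\<theta> * C + (\<Sum>j\<in>J. m (v j)) / \<theta>) / 2"
    using e \<theta> by (simp add: mult_left_mono)
  finally show ?thesis by (simp add: m_def)
qed

lemma sum_half_power_dist: "(\<Sum>j<N. (1/2::real) ^ (if i \<le> j then j - i else i - j)) \<le> 4"
proof -
  have g: "(\<Sum>j<n. (1/2::real) ^ j) \<le> 2" for n by (simp add: geometric_sum)
  have "(\<Sum>j<N. (1/2::real) ^ (if i \<le> j then j - i else i - j))
      = (\<Sum>j\<in>{j. j < N \<and> i \<le> j}. (1/2) ^ (j - i)) + (\<Sum>j\<in>{j. j < N \<and> \<not> i \<le> j}. (1/2) ^ (i - j))"
  proof -
    have "{..<N} = {j. j < N \<and> i \<le> j} \<union> {j. j < N \<and> \<not> i \<le> j}" by auto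
    then have "(\<Sum>j<N. (1/2::real) ^ (if i \<le> j then j - i else i - j))
        = (\<Sum>j\<in>{j. j < N \<and> i \<le> j}. (1/2) ^ (if i \<le> j then j - i else i - j))
        + (\<Sum>j\<in>{j. j < N \<and> \<not> i \<le> j}. (1/2) ^ (if i \<le> j then j - i else i - j))"
      by (metis (no_types, lifting) sum.union_disjoint Collect_conj_eq Collect_neg_eq disjoint_iff
          finite_Un finite_lessThan mem_Collect_eq)
    then show ?thesis by simp
  qed
  also have "(\<Sum>j\<in>{j. j < N \<and> i \<le> j}. (1/2::real) ^ (j - i)) = (\<Sum>d\<in>(\<lambda>j. j - i) ` {j. j < N \<and> i \<le> j}. (1/2) ^ d)"
    by (subst sum.reindex) (auto simp: inj_on_def)
  also have "\<dots> \<le> (\<Sum>d<N. (1/2) ^ d)" by (intro sum_mono2) auto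
  also have "(\<Sum>j\<in>{j. j < N \<and> \<not> i \<le> j}. (1/2::real) ^ (i - j)) = (\<Sum>d\<in>(\<lambda>j. i - j) ` {j. j < N \<and> \<not> i \<le> j}. (1/2) ^ d)"
    by (subst sum.reindex) (auto simp: inj_on_def)
  also have "\<dots> \<le> (\<Sum>d<Suc i. (1/2) ^ d)" by (intro sum_mono2) auto
  finally show ?thesis using g[of N] g[of "Suc i"] by linarith
qed

section \<open>Products of words and mixed random walks in a group\<close>

context group
begin

abbreviation wprod :: "'a list \<Rightarrow> 'a" where
  "wprod w \<equiv> foldr (\<otimes>) w \<one>"

lemma wprod_closed [simp, intro]: "set w \<subseteq> carrier G \<Longrightarrow> wprod w \<in> carrier G"
  by (induction w) auto

lemma wprod_append:
  "set u \<subseteq> carrier G \<Longrightarrow> set v \<subseteq> carrier G \<Longrightarrow> wprod (u @ v) = wprod u \<otimes> wprod v"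
  by (induction u) (auto simp: m_assoc)

lemma wprod_rev_inv:
  "set w \<subseteq> carrier G \<Longrightarrow> wprod (rev (map (m_inv G) w)) = inv (wprod w)"
proof (induction w)
  case (Cons t w)
  have "set (rev (map (m_inv G) w)) \<subseteq> carrier G" using Cons.prems by auto
  then have "wprod (rev (map (m_inv G) w) @ [inv t]) = wprod (rev (map (m_inv G) w)) \<otimes> inv t"
    using Cons.prems by (subst wprod_append) auto
  then show ?case using Cons by (auto simp: inv_mult_group)
qed auto

lemma words_carrier: "T \<subseteq> carrier G \<Longrightarrow> w \<in> words T n \<Longrightarrow> set w \<subseteq> carrier G"
  by (auto simp: words_def)

text \<open>Reversing a word and inverting its letters is an involution that preserves weights when
  the step law is symmetric, so the endpoint and its inverse have the same distribution.\<close>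

lemma sum_words_inverse:
  assumes "T \<subseteq> carrier G" "\<And>t. t \<in> T \<Longrightarrow> inv t \<in> T \<and> p (inv t) = p t"
  shows "(\<Sum>u\<in>words T n. weight p u * \<phi> (wprod u)) = (\<Sum>u\<in>words T n. weight p u * \<phi> (inv (wprod u)))"
proof (rule sum.reindex_bij_witness[of _ "\<lambda>u. rev (map (m_inv G) u)" "\<lambda>u. rev (map (m_inv G) u)"])
  fix u assume u: "u \<in> words T n"
  then have c: "set u \<subseteq> carrier G" using assms(1) by (auto simp: words_def)
  then show "rev (map (m_inv G) (rev (map (m_inv G) u))) = u"
    by (auto simp: rev_map intro!: map_idI)
  then show "rev (map (m_inv G) (rev (map (m_inv G) u))) = u" .
  show "rev (map (m_inv G) u) \<in> words T n" using u assms by (auto simp: words_def)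
  then show "rev (map (m_inv G) u) \<in> words T n" .
  have "weight p (rev (map (m_inv G) u)) = weight p u"
  proof -
    have "map p (map (m_inv G) u) = map p u"
      using u assms(2) by (auto simp: words_def)
    then show ?thesis by (metis rev_map prod_list.rev weight_def)
  qed
  then show "weight p (rev (map (m_inv G) u)) * \<phi> (inv (wprod (rev (map (m_inv G) u)))) = weight p u * \<phi> (wprod u)"
    using c by (simp add: wprod_rev_inv)
qed

end

text \<open>The two halves of the step law have opposite purposes: \<open>p1\<close> will give
  prescribed letters a probability that stays fixed, and \<open>p2\<close> is so diffuse that the
  walk rarely returns.\<close>

locale mixed_walk = group G for G (structure) +
  fixes T and p p1 p2 :: "'a \<Rightarrow> real" and \<epsilon> :: real
  assumes T: "finite T" "T \<subseteq> carrier G"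
    and p1: "\<And>t. t \<in> T \<Longrightarrow> p1 t \<ge> 0" "sum p1 T = 1"
    and p2: "\<And>t. t \<in> T \<Longrightarrow> p2 t \<ge> 0" "sum p2 T = 1" "\<And>t. t \<in> T \<Longrightarrow> p2 t \<le> \<epsilon>"
    and p: "\<And>t. p t = (p1 t + p2 t) / 2"
    and sym: "\<And>t. t \<in> T \<Longrightarrow> inv t \<in> T \<and> p (inv t) = p t"
begin

lemma p_nonneg: "t \<in> T \<Longrightarrow> p t \<ge> 0" using p1(1)[of t] p2(1)[of t] by (simp add: p)

lemma sum_p: "sum p T = 1"
  using p1(2) p2(2) by (simp add: p[abs_def] sum.distrib flip: sum_divide_distrib)

lemma weight_p_nonneg: "w \<in> words T n \<Longrightarrow> weight p w \<ge> 0"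
  using weight_nonneg p_nonneg .

text \<open>Condition on the half from which the first letter is drawn. For \<open>p1\<close> the
  remaining word has to hit some other point, and the induction hypothesis applies; for
  \<open>p2\<close> the remaining word determines the letter, which has probability at most
  \<epsilon>. The average of (1/2)^n + \<epsilon> and \<epsilon> is (1/2)^(n + 1) + \<epsilon>, so
  the error \<epsilon> does not accumulate.\<close>

lemma return_bound:
  assumes "z \<in> carrier G"
  shows "(\<Sum>w\<in>words T n. weight p w * of_bool (wprod w = z)) \<le> (1/2) ^ n + \<epsilon>"
  using assms
proof (induction n arbitrary: z)
  case 0
  obtain t where "t \<in> T" using p1(2) by fastforce
  then have "\<epsilon> \<ge> 0" using p2 by fastforce
  then show ?case by auto
next
  case (Suc n)
  define R where "R t = (\<Sum>w\<in>words T n. weight p w * of_bool (wprod w = inv t \<otimes> z))" for t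
  have "(\<Sum>w\<in>words T (Suc n). weight p w * of_bool (wprod w = z)) = (\<Sum>t\<in>T. p t * R t)"
    unfolding sum_words_Suc R_def sum_distrib_left
  proof (intro sum.cong refl)
    fix t w assume "t \<in> T" "w \<in> words T n"
    then have "wprod (t # w) = z \<longleftrightarrow> wprod w = inv t \<otimes> z"
      using T Suc.prems words_carrier[of T w n] by (auto simp: inv_solve_left subsetD)
    then show "weight p (t # w) * of_bool (wprod (t # w) = z) = p t * (weight p w * of_bool (wprod w = inv t \<otimes> z))"
      by simp
  qed
  also have "\<dots> = ((\<Sum>t\<in>T. p1 t * R t) + (\<Sum>t\<in>T. p2 t * R t)) / 2"
    by (simp add: p add_divide_distrib distrib_right sum.distrib sum_divide_distrib)
  also have "\<dots> \<le> (((1/2) ^ n + \<epsilon>) + \<epsilon>) / 2"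
  proof -
    have "(\<Sum>t\<in>T. p1 t * R t) \<le> (\<Sum>t\<in>T. p1 t * ((1/2) ^ n + \<epsilon>))"
      unfolding R_def using T Suc.prems by (intro sum_mono mult_left_mono Suc.IH p1(1)) auto
    also have "\<dots> = (1/2) ^ n + \<epsilon>" using p1(2) by (simp flip: sum_distrib_right)
    finally have 1: "(\<Sum>t\<in>T. p1 t * R t) \<le> (1/2) ^ n + \<epsilon>" .
    have R0: "R t \<ge> 0" for t
      unfolding R_def by (intro sum_nonneg mult_nonneg_nonneg weight_p_nonneg) auto
    have "(\<Sum>t\<in>T. p2 t * R t) \<le> (\<Sum>t\<in>T. \<epsilon> * R t)"
      using R0 by (intro sum_mono mult_right_mono p2(3))
    also have "\<dots> = \<epsilon> * (\<Sum>w\<in>words T n. weight p w * (\<Sum>t\<in>T. of_bool (wprod w = inv t \<otimes> z)))"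
      unfolding R_def sum_distrib_left[symmetric] by (subst sum.swap) (simp add: sum_distrib_left)
    also have "\<dots> \<le> \<epsilon> * (\<Sum>w\<in>words T n. weight p w * 1)"
    proof (intro mult_left_mono sum_mono weight_p_nonneg)
      obtain t where "t \<in> T" using p1(2) by fastforce
      then show "\<epsilon> \<ge> 0" using p2 by fastforce
      fix w assume w: "w \<in> words T n"
      have "(\<Sum>t\<in>T. of_bool (wprod w = inv t \<otimes> z)) \<le> (\<Sum>t\<in>T. of_bool (t = z \<otimes> inv (wprod w)) :: real)"
      proof (intro sum_mono)
        fix t assume t: "t \<in> T"
        have "t = z \<otimes> inv (wprod w)" if "wprod w = inv t \<otimes> z"
          using that t T Suc.prems by (auto simp: inv_mult_group subsetD m_assoc[symmetric])
        then show "of_bool (wprod w = inv t \<otimes> z) \<le> (of_bool (t = z \<otimes> inv (wprod w)) :: real)" by auto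
      qed
      also have "\<dots> \<le> 1" using T by (simp add: of_bool_def)
      finally show "(\<Sum>t\<in>T. of_bool (wprod w = inv t \<otimes> z)) \<le> (1::real)" .
    qed
    also have "\<dots> = \<epsilon>" using sum_weight[OF sum_p] by simp
    finally show ?thesis using 1 by simp
  qed
  finally show ?case by simp
qed

text \<open>Two prefixes have the same product exactly when the segment between them has product
  \<one>; the letters before and after that segment integrate out.\<close>

lemma coincidence_bound_le:
  assumes "j \<le> j'" "j' \<le> S"
  shows "(\<Sum>W\<in>words T S. weight p W * of_bool (wprod (take j W) = wprod (take j' W))) \<le> (1/2) ^ (j' - j) + \<epsilon>"
proof -
  define d e where "d = j' - j" and "e = S - j'"
  then have S: "S = j + (d + e)" and j': "j' = j + d" using assms by auto
  let ?s = "\<lambda>n. words T n" 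
  have "(\<Sum>W\<in>?s S. weight p W * of_bool (wprod (take j W) = wprod (take j' W)))
      = (\<Sum>u\<in>?s j. \<Sum>v\<in>?s d. \<Sum>w\<in>?s e. weight p u * (weight p v * of_bool (wprod v = \<one>)) * weight p w)"
    unfolding S sum_words_add
  proof (intro sum.cong refl)
    fix u v w assume uvw: "u \<in> ?s j" "v \<in> ?s d" "w \<in> ?s e"
    have l: "length u = j" "length v = d" using uvw by (auto simp: words_def)
    have c: "set u \<subseteq> carrier G" "set v \<subseteq> carrier G" using uvw words_carrier[OF T(2)] by blast+
    have "take j (u @ v @ w) = u" "take j' (u @ v @ w) = u @ v" using l by (auto simp: j')
    moreover have "wprod u = wprod (u @ v) \<longleftrightarrow> wprod v = \<one>"
      using c by (simp only: wprod_append) (metis l_cancel_one wprod_closed)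
    ultimately show "weight p (u @ v @ w) * of_bool (wprod (take j (u @ v @ w)) = wprod (take j' (u @ v @ w)))
       = weight p u * (weight p v * of_bool (wprod v = \<one>)) * weight p w"
      by (simp add: weight_append)
  qed
  also have "\<dots> = (\<Sum>v\<in>?s d. weight p v * of_bool (wprod v = \<one>))"
    by (simp add: sum_weight[OF sum_p] flip: sum_distrib_left sum_distrib_right)
  also have "\<dots> \<le> (1/2) ^ d + \<epsilon>" by (rule return_bound) simp
  finally show ?thesis by (simp add: d_def)
qed

lemma coincidence_bound:
  assumes "i \<le> S" "j \<le> S"
  shows "(\<Sum>W\<in>words T S. weight p W * of_bool (wprod (take i W) = wprod (take j W)))
          \<le> (1/2) ^ (if i \<le> j then j - i else i - j) + \<epsilon>"
  using coincidence_bound_le[of i j S] coincidence_bound_le[of j i S] assms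
  by (auto simp: eq_commute)

lemma \<epsilon>_nonneg: "\<epsilon> \<ge> 0"
proof -
  obtain t where "t \<in> T" using p1(2) by fastforce
  then show ?thesis using p2 by fastforce
qed

text \<open>The expected number of pairs of cut positions at which the path is at the same point. Up
  to the term in \<epsilon> it is linear in \<open>N\<close>, although there may be N^2 pairs; this
  gap is what makes the endpoint spread.\<close>

lemma sum_coincidences:
  assumes "J \<subseteq> {..<N}" "\<And>j. j \<in> J \<Longrightarrow> j \<le> S"
  shows "(\<Sum>W\<in>words T S. weight p W * (\<Sum>i\<in>J. \<Sum>j\<in>J. of_bool (wprod (take i W) = wprod (take j W))))
          \<le> 4 * real N + (real N)\<^sup>2 * \<epsilon>"
proof -
  have J: "finite J" using assms(1) finite_subset by blast
  have "(\<Sum>W\<in>words T S. weight p W * (\<Sum>i\<in>J. \<Sum>j\<in>J. of_bool (wprod (take i W) = wprod (take j W))))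
      = (\<Sum>i\<in>J. \<Sum>j\<in>J. \<Sum>W\<in>words T S. weight p W * of_bool (wprod (take i W) = wprod (take j W)))"
    unfolding sum_distrib_left by (subst sum.swap, intro sum.cong refl, subst sum.swap) simp
  also have "\<dots> \<le> (\<Sum>i\<in>J. \<Sum>j\<in>J. (1/2) ^ (if i \<le> j then j - i else i - j) + \<epsilon>)"
    using assms by (intro sum_mono coincidence_bound) auto
  also have "\<dots> \<le> (\<Sum>i<N. \<Sum>j<N. (1/2) ^ (if i \<le> j then j - i else i - j) + \<epsilon>)"
    using assms(1) \<epsilon>_nonneg
    by (intro order_trans[OF sum_mono[OF sum_mono2] sum_mono2]) (auto intro!: sum_nonneg)
  also have "\<dots> \<le> (\<Sum>i<N. 4 + N * \<epsilon>)"
    by (intro sum_mono) (simp add: sum.distrib sum_half_power_dist)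
  also have "\<dots> = 4 * real N + (real N)\<^sup>2 * \<epsilon>" by (simp add: power2_eq_square algebra_simps)
  finally show ?thesis .
qed

text \<open>Fix the whole word \<open>W\<close> with product x. Cutting it anywhere gives a pair (g,
  g x), where g is the inverse of the prefix product: all cuts of \<open>W\<close> lie in one
  diagonal orbit, along which \<open>k\<close> is square summable. Repeated prefixes are handled by
  the multiplicity bound, and averaging over \<open>W\<close> turns multiplicities into coincidence
  probabilities.\<close>

lemma sum_over_cuts:
  fixes k :: "'a \<Rightarrow> 'a \<Rightarrow> real"
  assumes k: "\<And>x W. x \<in> carrier G \<Longrightarrow> finite W \<Longrightarrow> W \<subseteq> carrier G \<Longrightarrow> (\<Sum>g\<in>W. (k g (g \<otimes> x))\<^sup>2) \<le> C"
    and J: "J \<subseteq> {..<N}" "\<And>j. j \<in> J \<Longrightarrow> j \<le> S" and \<theta>: "\<theta> > 0"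
  shows "(\<Sum>W\<in>words T S. weight p W * (\<Sum>j\<in>J. k (inv (wprod (take j W))) (wprod (drop j W))))
     \<le> (\<theta> * C + (4 * real N + (real N)\<^sup>2 * \<epsilon>) / \<theta>) / 2"
proof -
  have fJ: "finite J" using J(1) finite_subset by blast
  define co where "co W = (\<Sum>i\<in>J. \<Sum>j\<in>J. of_bool (wprod (take i W) = wprod (take j W)) :: real)" for W
  have "(\<Sum>j\<in>J. k (inv (wprod (take j W))) (wprod (drop j W))) \<le> (\<theta> * C + co W / \<theta>) / 2" if W: "W \<in> words T S" for W
  proof -
    define \<kappa> where "\<kappa> g = k (inv g) (inv g \<otimes> wprod W)" for g
    have c: "set W \<subseteq> carrier G" using words_carrier[OF T(2) W] .
    then have ct: "set (take j W) \<subseteq> carrier G" "set (drop j W) \<subseteq> carrier G" for j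
      by (auto dest: in_set_takeD in_set_dropD)
    have "wprod (drop j W) = inv (wprod (take j W)) \<otimes> wprod W" for j
      using wprod_append[OF ct(1)[of j] ct(2)[of j]] wprod_closed[OF ct(1)[of j]] wprod_closed[OF ct(2)[of j]]
        wprod_closed[OF c]
      by (subst inv_solve_left) simp_all
    then have "(\<Sum>j\<in>J. k (inv (wprod (take j W))) (wprod (drop j W))) = (\<Sum>j\<in>J. \<kappa> (wprod (take j W)))"
      by (simp add: \<kappa>_def)
    also have "\<dots> \<le> (\<theta> * C + co W / \<theta>) / 2"
      unfolding co_def
    proof (rule sum_le_with_multiplicity[OF fJ \<theta>])
      let ?V = "(\<lambda>j. wprod (take j W)) ` J"
      have V: "?V \<subseteq> carrier G" "finite ?V" using ct fJ wprod_closed by blast+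
      have "(\<Sum>g\<in>?V. (\<kappa> g)\<^sup>2) = (\<Sum>g\<in>m_inv G ` ?V. (k g (g \<otimes> wprod W))\<^sup>2)"
        unfolding \<kappa>_def by (subst sum.reindex[OF inj_on_subset[OF inv_inj V(1)]]) simp
      also have "\<dots> \<le> C" using V c by (intro k wprod_closed) auto
      finally show "(\<Sum>g\<in>?V. (\<kappa> g)\<^sup>2) \<le> C" .
    qed
    finally show ?thesis .
  qed
  then have "(\<Sum>W\<in>words T S. weight p W * (\<Sum>j\<in>J. k (inv (wprod (take j W))) (wprod (drop j W))))
    \<le> (\<Sum>W\<in>words T S. weight p W * ((\<theta> * C + co W / \<theta>) / 2))"
    by (intro sum_mono mult_left_mono weight_p_nonneg)
  also have "\<dots> = (\<Sum>W\<in>words T S. weight p W) * (\<theta> * C / 2) + (\<Sum>W\<in>words T S. weight p W * co W) / (2 * \<theta>)"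
    unfolding sum_distrib_right sum_divide_distrib sum.distrib[symmetric]
    using \<theta> by (intro sum.cong refl) (simp add: field_simps)
  also have "\<dots> \<le> \<theta> * C / 2 + (4 * real N + (real N)\<^sup>2 * \<epsilon>) / (2 * \<theta>)"
    using sum_coincidences[OF J, folded co_def] \<theta> sum_weight[OF sum_p] by (auto intro!: divide_right_mono)
  also have "\<dots> = (\<theta> * C + (4 * real N + (real N)\<^sup>2 * \<epsilon>) / \<theta>) / 2" using \<theta> by (simp add: field_simps)
  finally show ?thesis .
qed

text \<open>By symmetry of the step law the first walk may be run backwards. Then \<open>u\<close>,
  the letter \<open>c\<close> and \<open>w\<close> form one word of length n + m + 1 that has
  \<open>c\<close> at a given place, at the price of the factor \<open>p c\<close>. A pair of
  lengths thus becomes a total length with a cut position, and all cuts of one total length share a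
  single square-summability bound.\<close>

lemma sum_pairs_of_words:
  fixes k :: "'a \<Rightarrow> 'a \<Rightarrow> real"
  assumes k0: "\<And>x y. k x y \<ge> 0"
    and k: "\<And>x W. x \<in> carrier G \<Longrightarrow> finite W \<Longrightarrow> W \<subseteq> carrier G \<Longrightarrow> (\<Sum>g\<in>W. (k g (g \<otimes> x))\<^sup>2) \<le> C"
    and c: "c \<in> T" and \<theta>: "\<theta> > 0"
  shows "p c * (\<Sum>n<N. \<Sum>m<N. \<Sum>u\<in>words T n. \<Sum>w\<in>words T m. weight p u * weight p w * k (wprod u) (c \<otimes> wprod w))
     \<le> N * (\<theta> * C + (4 * real N + (real N)\<^sup>2 * \<epsilon>) / \<theta>)"
proof -
  define \<Psi> where "\<Psi> S n = (\<Sum>W\<in>words T S. weight p W * k (inv (wprod (take n W))) (wprod (drop n W)))" for S n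
  have \<Psi>0: "\<Psi> S n \<ge> 0" for S n unfolding \<Psi>_def
    by (intro sum_nonneg mult_nonneg_nonneg weight_p_nonneg k0)
  have step: "p c * (\<Sum>u\<in>words T n. \<Sum>w\<in>words T m. weight p u * weight p w * k (wprod u) (c \<otimes> wprod w))
       \<le> \<Psi> (n + Suc m) n" for n m
  proof -
    define D where "D t = (\<Sum>u\<in>words T n. \<Sum>w\<in>words T m. weight p u * weight p w * k (inv (wprod u)) (t \<otimes> wprod w))" for t
    have D0: "D t \<ge> 0" for t
      unfolding D_def by (intro sum_nonneg mult_nonneg_nonneg weight_p_nonneg k0)
    have "(\<Sum>u\<in>words T n. \<Sum>w\<in>words T m. weight p u * weight p w * k (wprod u) (c \<otimes> wprod w))
        = (\<Sum>u\<in>words T n. weight p u * (\<Sum>w\<in>words T m. weight p w * k (wprod u) (c \<otimes> wprod w)))"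
      by (simp add: sum_distrib_left mult.assoc)
    also have "\<dots> = D c"
      by (subst sum_words_inverse[OF T(2) sym]) (simp_all add: D_def sum_distrib_left mult.assoc)
    finally have "p c * (\<Sum>u\<in>words T n. \<Sum>w\<in>words T m. weight p u * weight p w * k (wprod u) (c \<otimes> wprod w))
        = p c * D c" by simp
    also have "\<dots> \<le> (\<Sum>t\<in>T. p t * D t)"
      using c T(1) by (intro member_le_sum) (auto intro!: mult_nonneg_nonneg D0 p_nonneg)
    also have "\<dots> = \<Psi> (n + Suc m) n"
    proof -
      have "\<Psi> (n + Suc m) n = (\<Sum>u\<in>words T n. \<Sum>t\<in>T. \<Sum>w\<in>words T m. p t * (weight p u * weight p w * k (inv (wprod u)) (t \<otimes> wprod w)))"
        unfolding \<Psi>_def sum_words_add sum_words_Suc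
        by (intro sum.cong refl) (auto simp: words_def weight_append)
      also have "\<dots> = (\<Sum>t\<in>T. p t * D t)"
        unfolding D_def by (subst sum.swap) (simp add: sum_distrib_left)
      finally show ?thesis by simp
    qed
    finally show ?thesis .
  qed
  have "p c * (\<Sum>n<N. \<Sum>m<N. \<Sum>u\<in>words T n. \<Sum>w\<in>words T m. weight p u * weight p w * k (wprod u) (c \<otimes> wprod w))
     \<le> (\<Sum>n<N. \<Sum>m<N. \<Psi> (n + Suc m) n)"
    unfolding sum_distrib_left[of "p c" _ "{..<N}"] by (intro sum_mono step)
  \<comment> \<open>Regrouping by the total length \<open>S\<close> = n + m + 1, which is at most 2N
    - 1.\<close>
  also have "\<dots> \<le> (\<Sum>n<N. \<Sum>S<2 * N. if n \<le> S then \<Psi> S n else 0)"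
  proof (intro sum_mono)
    fix n assume n: "n \<in> {..<N}"
    have "(\<Sum>m<N. \<Psi> (n + Suc m) n) = (\<Sum>S\<in>(\<lambda>m. n + Suc m) ` {..<N}. if n \<le> S then \<Psi> S n else 0)"
      by (subst sum.reindex) (auto simp: inj_on_def)
    also have "\<dots> \<le> (\<Sum>S<2 * N. if n \<le> S then \<Psi> S n else 0)"
      using n \<Psi>0 by (intro sum_mono2) auto
    finally show "(\<Sum>m<N. \<Psi> (n + Suc m) n) \<le> (\<Sum>S<2 * N. if n \<le> S then \<Psi> S n else 0)" .
  qed
  also have "\<dots> = (\<Sum>S<2 * N. \<Sum>n\<in>{n \<in> {..<N}. n \<le> S}. \<Psi> S n)"
    by (subst sum.swap) (intro sum.cong refl sum.inter_filter[symmetric] finite_lessThan)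
  also have "\<dots> \<le> (\<Sum>S<2 * N. (\<theta> * C + (4 * real N + (real N)\<^sup>2 * \<epsilon>) / \<theta>) / 2)"
  proof (intro sum_mono)
    fix S
    have "(\<Sum>n\<in>{n \<in> {..<N}. n \<le> S}. \<Psi> S n) = (\<Sum>W\<in>words T S. weight p W *
        (\<Sum>j\<in>{n \<in> {..<N}. n \<le> S}. k (inv (wprod (take j W))) (wprod (drop j W))))"
      unfolding \<Psi>_def by (subst sum.swap) (simp add: sum_distrib_left)
    also have "\<dots> \<le> (\<theta> * C + (4 * real N + (real N)\<^sup>2 * \<epsilon>) / \<theta>) / 2"
      by (rule sum_over_cuts[of k C, OF k _ _ \<theta>]) auto
    finally show "(\<Sum>n\<in>{n \<in> {..<N}. n \<le> S}. \<Psi> S n) \<le> (\<theta> * C + (4 * real N + (real N)\<^sup>2 * \<epsilon>) / \<theta>) / 2" .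
  qed
  also have "\<dots> = N * (\<theta> * C + (4 * real N + (real N)\<^sup>2 * \<epsilon>) / \<theta>)" by simp
  finally show ?thesis .
qed

end


text \<open>The law of \<open>z i\<close>, where \<open>i \<in> I\<close> has probability \<open>q i\<close>, is so spread out that
  square summability along diagonal orbits forces a small mean over two independent samples.\<close>

definition (in group) spreads ::
    "'a set \<Rightarrow> real \<Rightarrow> 'i set \<Rightarrow> ('i \<Rightarrow> real) \<Rightarrow> ('i \<Rightarrow> 'a) \<Rightarrow> bool" where
  "spreads F \<eta> I q z \<longleftrightarrow> finite I \<and> (\<forall>i\<in>I. q i \<ge> 0) \<and> sum q I = 1 \<and> (\<forall>i\<in>I. z i \<in> carrier G) \<and>
     (\<forall>k C. (\<forall>x y. k x y \<ge> (0::real)) \<longrightarrow>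
       (\<forall>x\<in>carrier G. \<forall>y\<in>carrier G. \<forall>W. finite W \<and> W \<subseteq> carrier G \<longrightarrow>
          (\<Sum>g\<in>W. (k (g \<otimes> x) (g \<otimes> y))\<^sup>2) \<le> C) \<longrightarrow>
       (\<forall>a\<in>F. \<forall>b\<in>F. (\<Sum>i\<in>I. \<Sum>j\<in>I. q i * q j * k (a \<otimes> z i) (b \<otimes> z j)) \<le> \<eta> * (C + 1)))"

text \<open>The sample is the endpoint of a walk stopped at a uniform time below \<open>N\<close>.
  The concentrated half of the step law is uniform on the quotients of elements of \<open>F\<close>,
  so that the offset between \<open>a\<close> and \<open>b\<close> can be inserted as one letter.
  The diffuse half is uniform on a large symmetric set, available because the group is
  infinite.\<close>

lemma (in group) ex_spreads:
  assumes inf: "infinite (carrier G)" and F: "finite F" "F \<noteq> {}" "F \<subseteq> carrier G" and \<eta>: "\<eta> > 0"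
  shows "\<exists>(I :: (nat \<times> 'a list) set) q z. spreads F \<eta> I q z"
proof -
  define A where "A = (\<lambda>(a, b). inv a \<otimes> b) ` (F \<times> F)"
  have A: "finite A" "A \<noteq> {}" "A \<subseteq> carrier G" using F by (auto simp: A_def)
  have A_inv: "inv t \<in> A" if "t \<in> A" for t
    using that F(3) by (force simp: A_def inv_mult_group subset_iff image_iff)
  \<comment> \<open>A lower bound for the probability of each letter in \<open>A\<close>; the factor
    2 is that of the mixture.\<close>
  define \<alpha> where "\<alpha> = 1 / (2 * real (card A))"
  have \<alpha>: "\<alpha> > 0" using A by (simp add: \<alpha>_def card_gt_0_iff)
  \<comment> \<open>With \<theta> = \<eta> \<alpha> N the final bound is \<eta> C + (4 / N + 1 /
    card B) / (\<eta> \<alpha>^2). The second term is at most \<eta> once the bracket is at most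
    \<open>s\<close>; \<open>N\<close> and \<open>m\<close> each take care of half of it.\<close>
  define s where "s = \<eta>\<^sup>2 * \<alpha>\<^sup>2"
  have s: "s > 0" using \<eta> \<alpha> by (simp add: s_def)
  obtain N :: nat where N: "real N > 8 / s" using reals_Archimedean2 by blast
  have N0: "N > 0" using N s by (metis divide_pos_pos gr0I less_asym of_nat_0 zero_less_numeral)
  obtain m :: nat where m: "real m > 2 / s" using reals_Archimedean2 by blast
  obtain U where U: "U \<subseteq> carrier G" "finite U" "card U = m"
    using infinite_arbitrarily_large[OF inf] by blast
  define B where "B = U \<union> m_inv G ` U"
  have B: "finite B" "B \<subseteq> carrier G" using U by (auto simp: B_def)
  have B_inv: "inv t \<in> B" if "t \<in> B" for t using that U by (auto simp: B_def subset_iff)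
  have m0: "m > 0" using m s by (metis divide_pos_pos gr0I less_asym of_nat_0 zero_less_numeral)
  have "m \<le> card B" using U B by (metis B_def card_mono sup_ge1)
  define T where "T = A \<union> B"
  define p1 p2 where "p1 t = of_bool (t \<in> A) / real (card A)" and "p2 t = of_bool (t \<in> B) / real (card B)" for t
  define p where "p t = (p1 t + p2 t) / 2" for t
  have B0: "card B > 0" using m0 \<open>m \<le> card B\<close> by simp
  have sums: "sum p1 T = 1" "sum p2 T = 1"
  proof -
    have "(\<Sum>t\<in>T. of_bool (t \<in> A)) = real (card A)" "(\<Sum>t\<in>T. of_bool (t \<in> B)) = real (card B)"
      using A B by (auto simp: T_def of_bool_def sum.If_cases intro!: arg_cong[where f=card])
    then show "sum p1 T = 1" "sum p2 T = 1"
      using A B0 by (auto simp: p1_def p2_def sum_divide_distrib[symmetric] card_gt_0_iff)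
  qed
  interpret w: mixed_walk G T p p1 p2 "1 / card B"
  proof
    fix t assume t: "t \<in> T"
    have "inv t \<in> A \<longleftrightarrow> t \<in> A" "inv t \<in> B \<longleftrightarrow> t \<in> B"
      using A_inv[of "inv t"] A_inv[of t] B_inv[of "inv t"] B_inv[of t] t A B by (auto simp: T_def subset_iff)
    then show "inv t \<in> T \<and> p (inv t) = p t" using t by (auto simp: T_def p_def p1_def p2_def)
  qed (use A B sums in \<open>auto simp: T_def p_def p1_def p2_def\<close>)
  define I where "I = (SIGMA n:{..<N}. words T n)"
  define q where "q i = weight p (snd i) / N" for i :: "nat \<times> 'a list"
  have nested: "(\<Sum>i\<in>I. \<phi> i) = (\<Sum>n<N. \<Sum>w\<in>words T n. \<phi> (n, w))" for \<phi> :: "nat \<times> 'a list \<Rightarrow> real"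
    unfolding I_def using w.T(1) by (subst sum.Sigma) auto
  have "spreads F \<eta> I q (\<lambda>i. wprod (snd i))"
    unfolding spreads_def
  proof (intro conjI allI ballI impI)
    show "finite I" using w.T(1) by (auto simp: I_def)
    show "q i \<ge> 0" if "i \<in> I" for i using that w.weight_p_nonneg by (auto simp: I_def q_def)
    show "sum q I = 1"
      unfolding nested using N0 sum_weight[OF w.sum_p] by (simp add: q_def flip: sum_divide_distrib)
    show "wprod (snd i) \<in> carrier G" if "i \<in> I" for i
      using that words_carrier[OF w.T(2)] by (auto simp: I_def)
    fix k :: "'a \<Rightarrow> 'a \<Rightarrow> real" and C a b
    assume k0': "\<forall>x y. k x y \<ge> 0" and ab: "a \<in> F" "b \<in> F"
      and k': "\<forall>x\<in>carrier G. \<forall>y\<in>carrier G. \<forall>W. finite W \<and> W \<subseteq> carrier G \<longrightarrow>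
          (\<Sum>g\<in>W. (k (g \<otimes> x) (g \<otimes> y))\<^sup>2) \<le> C"
    have k0: "k x y \<ge> 0" for x y using k0' by simp
    have k: "(\<Sum>g\<in>W. (k (g \<otimes> x) (g \<otimes> y))\<^sup>2) \<le> C"
      if "x \<in> carrier G" "y \<in> carrier G" "finite W" "W \<subseteq> carrier G" for x y W
      using k' that by simp
    have C0: "C \<ge> 0" using k[of \<one> \<one> "{}"] by simp
    have abc: "a \<in> carrier G" "b \<in> carrier G" using ab F by auto
    define c where "c = inv a \<otimes> b"
    have c: "c \<in> A" using ab by (auto simp: c_def A_def)
    define k' where "k' x y = k (a \<otimes> x) (a \<otimes> y)" for x y
    have k'_bd: "(\<Sum>g\<in>W. (k' g (g \<otimes> x))\<^sup>2) \<le> C" if "x \<in> carrier G" "finite W" "W \<subseteq> carrier G" for x W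
    proof -
      have "inj_on ((\<otimes>) a) W" using that abc by (intro inj_onI) (metis l_cancel subsetD)
      then have "(\<Sum>g\<in>W. (k' g (g \<otimes> x))\<^sup>2) = (\<Sum>g\<in>(\<otimes>) a ` W. (k (g \<otimes> \<one>) (g \<otimes> x))\<^sup>2)"
        using that abc by (subst sum.reindex) (auto simp: k'_def m_assoc subset_iff intro!: sum.cong)
      also have "\<dots> \<le> C" using that abc by (intro k) auto
      finally show ?thesis .
    qed
    define \<theta> where "\<theta> = \<eta> * \<alpha> * N"
    have \<theta>: "\<theta> > 0" using \<eta> \<alpha> N0 by (simp add: \<theta>_def)
    define S where "S = (\<Sum>n<N. \<Sum>m<N. \<Sum>u\<in>words T n. \<Sum>w\<in>words T m. weight p u * weight p w * k' (wprod u) (c \<otimes> wprod w))"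
    have S0: "S \<ge> 0" unfolding S_def k'_def
      by (intro sum_nonneg mult_nonneg_nonneg k0 w.weight_p_nonneg)
    have "(\<Sum>i\<in>I. \<Sum>j\<in>I. q i * q j * k (a \<otimes> wprod (snd i)) (b \<otimes> wprod (snd j)))
        = (\<Sum>n<N. \<Sum>u\<in>words T n. \<Sum>m<N. \<Sum>w\<in>words T m. weight p u * weight p w * k' (wprod u) (c \<otimes> wprod w) / (real N)\<^sup>2)"
      unfolding nested
    proof (intro sum.cong refl)
      fix n u m w assume "u \<in> words T n" "w \<in> words T m"
      then have "wprod w \<in> carrier G" using words_carrier[OF w.T(2)] by blast
      then have "a \<otimes> (c \<otimes> wprod w) = b \<otimes> wprod w"
        using abc by (simp add: c_def m_assoc[symmetric])
      then show "q (n, u) * q (m, w) * k (a \<otimes> wprod (snd (n, u))) (b \<otimes> wprod (snd (m, w)))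
         = weight p u * weight p w * k' (wprod u) (c \<otimes> wprod w) / (real N)\<^sup>2"
        by (simp add: q_def k'_def power2_eq_square)
    qed
    also have "\<dots> = S / (real N)\<^sup>2"
      unfolding S_def sum_divide_distrib by (intro sum.cong refl, subst sum.swap) simp
    also have "\<dots> \<le> (p c * S / \<alpha>) / (real N)\<^sup>2"
    proof (intro divide_right_mono)
      have "\<alpha> \<le> p c" using c by (auto simp: \<alpha>_def p_def p1_def p2_def)
      then show "S \<le> p c * S / \<alpha>" using \<alpha> mult_left_mono[of \<alpha> "p c" S] S0 by (simp add: field_simps)
    qed simp
    also have "\<dots> \<le> (N * (\<theta> * C + (4 * real N + (real N)\<^sup>2 * (1 / card B)) / \<theta>) / \<alpha>) / (real N)\<^sup>2"
      unfolding S_def using \<alpha> c \<theta>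
      by (intro divide_right_mono w.sum_pairs_of_words k'_bd) (auto simp: k'_def k0 T_def)
    also have "\<dots> = \<eta> * C + (4 / N + 1 / card B) * (\<eta> / s)"
      using N0 \<alpha> \<eta> B0 by (simp add: \<theta>_def s_def power2_eq_square field_simps)
    also have "\<dots> \<le> \<eta> * C + s * (\<eta> / s)"
    proof -
      have "4 / N \<le> s / 2" using N N0 s by (simp add: field_simps)
      moreover have "1 / card B \<le> s / 2"
      proof -
        have "real m \<le> card B" using \<open>m \<le> card B\<close> by simp
        then have "2 / s < card B" using m by linarith
        then show ?thesis using s B0 by (simp add: field_simps)
      qed
      ultimately have "4 / N + 1 / card B \<le> s" by linarith
      then show ?thesis using \<eta> s by (intro add_left_mono mult_right_mono) auto
    qed
    also have "\<dots> = \<eta> * (C + 1)" using s by (simp add: algebra_simps)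
    finally show "(\<Sum>i\<in>I. \<Sum>j\<in>I. q i * q j * k (a \<otimes> wprod (snd i)) (b \<otimes> wprod (snd j))) \<le> \<eta> * (C + 1)" .
  qed
  then show ?thesis by blast
qed

section \<open>Scalar cocycles\<close>

abbreviation "ell2_cochains G \<equiv> bounded_cochains G (ell2 G) (ell2_norm G) (left_regular G)"
abbreviation "ell2_cocycles G \<equiv> bounded_cocycles G (ell2 G) (ell2_norm G) (left_regular G)"
abbreviation "ell2_coboundaries G \<equiv> bounded_coboundaries G (ell2 G) (ell2_norm G) (left_regular G)"

lemma zero_in_coboundaries:
  assumes "group G"
  shows "(\<lambda>_. 0) \<in> ell2_coboundaries G 2"
proof -
  have z: "(\<lambda>_. 0) \<in> ell2_cochains G 1"
    by (auto simp: bounded_cochains_def ell2_def left_regular_def zero_fun_def ell2_norm_def intro!: exI[of _ 0])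
  have "coboundary G 1 (\<lambda>_. 0) = (\<lambda>_. (0 :: 'a \<Rightarrow> complex))"
    by (auto simp: coboundary_def fun_eq_iff Let_def)
  then show ?thesis
    unfolding bounded_coboundaries_def numeral_2_eq_2
    using z by (auto intro!: image_eqI[where x="\<lambda>_. 0"])
qed

text \<open>If the quotient has a single element, every coset of the coboundaries is the set of
  coboundaries itself; and \<open>c\<close> lies in its own coset because 0 is a coboundary.\<close>

lemma cocycle_is_coboundary_if_not_C_reg:
  assumes "group G" "countable (carrier G)" "\<not> class_C_reg G"
    and "c \<in> ell2_cocycles G 2"
  shows "c \<in> ell2_coboundaries G 2"
proof -
  let ?B = "ell2_coboundaries G 2"
  let ?Z = "\<lparr>carrier = ell2_cocycles G 2,
               monoid.mult = (\<lambda>f h xs. f xs + h xs), one = (\<lambda>_. 0)\<rparr>"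
  have "rcosets\<^bsub>?Z\<^esub> ?B = {?B}"
    using assms(1-3) by (simp add: class_C_reg_def bounded_cohomology_def FactGroup_def Let_def)
  moreover have "?B #>\<^bsub>?Z\<^esub> c \<in> rcosets\<^bsub>?Z\<^esub> ?B"
    using assms(4) by (auto simp: RCOSETS_def)
  ultimately have "?B #>\<^bsub>?Z\<^esub> c = ?B" by auto
  moreover have "c \<in> ?B #>\<^bsub>?Z\<^esub> c"
    using zero_in_coboundaries[OF assms(1)] by (auto simp: r_coset_def intro!: bexI[where x="\<lambda>_. 0"])
  ultimately show ?thesis by simp
qed

lemma tuples_2E:
  assumes "xs \<in> tuples G 2"
  obtains x y z where "xs = [x, y, z]" "x \<in> carrier G" "y \<in> carrier G" "z \<in> carrier G"
  using assms by (auto simp: tuples_def numeral_3_eq_3 length_Suc_conv)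

text \<open>An equivariant cochain is determined by its coefficients at \<one>. So \<open>f\<close>
  extends to a cochain whose coefficient at g is the value of \<open>f\<close> on the triple
  translated by \<open>inv g\<close>; its squared norm is a sum along a diagonal orbit, at most
  \<open>C\<close>. A primitive of this cochain is read at \<one> again, which commutes with the
  coboundary.\<close>

lemma scalar_primitive_if_not_C_reg:
  fixes G (structure) and f :: "'g \<Rightarrow> 'g \<Rightarrow> 'g \<Rightarrow> real"
  assumes G: "group G" "countable (carrier G)" "\<not> class_C_reg G"
    and coc: "\<And>x y z w. x \<in> carrier G \<Longrightarrow> y \<in> carrier G \<Longrightarrow> z \<in> carrier G \<Longrightarrow> w \<in> carrier G \<Longrightarrow>
                f y z w - f x z w + f x y w - f x y z = 0"
    and bd: "\<And>x y z W. x \<in> carrier G \<Longrightarrow> y \<in> carrier G \<Longrightarrow> z \<in> carrier G \<Longrightarrow>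
                finite W \<Longrightarrow> W \<subseteq> carrier G \<Longrightarrow>
                (\<Sum>g\<in>W. (f (g \<otimes>\<^bsub>G\<^esub> x) (g \<otimes>\<^bsub>G\<^esub> y) (g \<otimes>\<^bsub>G\<^esub> z))\<^sup>2) \<le> C"
  obtains h :: "'g \<Rightarrow> 'g \<Rightarrow> complex" and C' where
    "\<And>x y z. x \<in> carrier G \<Longrightarrow> y \<in> carrier G \<Longrightarrow> z \<in> carrier G \<Longrightarrow>
        complex_of_real (f x y z) = h y z - h x z + h x y"
    "\<And>x y W. x \<in> carrier G \<Longrightarrow> y \<in> carrier G \<Longrightarrow> finite W \<Longrightarrow> W \<subseteq> carrier G \<Longrightarrow>
        (\<Sum>g\<in>W. (cmod (h (g \<otimes>\<^bsub>G\<^esub> x) (g \<otimes>\<^bsub>G\<^esub> y)))\<^sup>2) \<le> C'"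
proof -
  interpret group G by (rule G(1))
  define c :: "'g list \<Rightarrow> 'g \<Rightarrow> complex" where
    "c xs g = (if xs \<in> tuples G 2 \<and> g \<in> carrier G
               then of_real (f (inv g \<otimes> xs ! 0) (inv g \<otimes> xs ! 1) (inv g \<otimes> xs ! 2)) else 0)" for xs g
  have C0: "C \<ge> 0" using bd[of \<one> \<one> \<one> "{}"] by simp
  have bdc: "(\<Sum>g\<in>W. (cmod (c xs g))\<^sup>2) \<le> C" if "xs \<in> tuples G 2" "finite W" "W \<subseteq> carrier G" for xs W
  proof -
    obtain x y z where xs: "xs = [x, y, z]" "x \<in> carrier G" "y \<in> carrier G" "z \<in> carrier G"
      using tuples_2E[OF \<open>xs \<in> _\<close>] .
    have inj: "inj_on (m_inv G) W"
      using that(3) by (rule inj_on_subset[OF inv_inj])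
    have "(\<Sum>g\<in>W. (cmod (c xs g))\<^sup>2) = (\<Sum>g\<in>W. (f (inv g \<otimes> x) (inv g \<otimes> y) (inv g \<otimes> z))\<^sup>2)"
      using that by (intro sum.cong) (auto simp: c_def xs(1))
    also have "\<dots> = (\<Sum>g\<in>m_inv G ` W. (f (g \<otimes> x) (g \<otimes> y) (g \<otimes> z))\<^sup>2)"
      using inj by (simp add: sum.reindex)
    also have "\<dots> \<le> C" using that xs by (intro bd) auto
    finally show ?thesis .
  qed
  have ce: "c xs \<in> ell2 G" if "xs \<in> tuples G 2" for xs
    unfolding ell2_def using bdc[OF that]
    by (auto simp: c_def intro!: nonneg_bdd_above_summable_on bdd_aboveI[where M=C])
  have cn: "ell2_norm G (c xs) \<le> sqrt C" if "xs \<in> tuples G 2" for xs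
    unfolding ell2_norm_def using bdc[OF that] ce[OF that]
    by (auto intro!: infsum_le_finite_sums real_sqrt_le_mono simp: ell2_def)
  have mapt: "map (mult G g) xs \<in> tuples G n" if "xs \<in> tuples G n" "g \<in> carrier G" for g xs n
    using that by (auto simp: tuples_def)
  have ceq: "c (map (mult G g) xs) = left_regular G g (c xs)" if "xs \<in> tuples G 2" "g \<in> carrier G" for g xs
  proof
    fix u
    obtain x y z where xs: "xs = [x, y, z]" "x \<in> carrier G" "y \<in> carrier G" "z \<in> carrier G"
      using tuples_2E[OF \<open>xs \<in> _\<close>] .
    show "c (map (mult G g) xs) u = left_regular G g (c xs) u"
      using mapt[OF that] that xs
      by (auto simp: c_def left_regular_def inv_mult_group m_assoc[symmetric] xs(1))
  qed
  have "c \<in> ell2_cochains G 2"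
    unfolding bounded_cochains_def
    using ce cn ceq by (auto simp: c_def[abs_def] zero_fun_def)
  moreover have "coboundary G 2 c xs = 0" for xs
  proof (cases "xs \<in> tuples G 3")
    case True
    then obtain x y z w where xs: "xs = [x, y, z, w]" "x \<in> carrier G" "y \<in> carrier G" "z \<in> carrier G" "w \<in> carrier G"
      by (auto simp: tuples_def eval_nat_numeral length_Suc_conv)
    have "coboundary G 2 c xs u = 0" for u
    proof (cases "u \<in> carrier G")
      case u: True
      let ?f = "\<lambda>x y z. complex_of_real (f (inv u \<otimes> x) (inv u \<otimes> y) (inv u \<otimes> z))"
      have cu: "c [p, q, r] u = ?f p q r" if "p \<in> carrier G" "q \<in> carrier G" "r \<in> carrier G" for p q r
        using that u by (simp add: c_def tuples_def)
      have odd3: "\<not> Suc (Suc 0) dvd Suc (Suc (Suc 0))" by presburger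
      have "coboundary G 2 c xs u = ?f y z w - ?f x z w + ?f x y w - ?f x y z"
        using True xs u by (simp add: coboundary_def Let_def numeral_2_eq_2 numeral_3_eq_3 cu odd3)
      also have "\<dots> = 0"
        using coc[of "inv u \<otimes> x" "inv u \<otimes> y" "inv u \<otimes> z" "inv u \<otimes> w"] xs u
        unfolding of_real_diff[symmetric] of_real_add[symmetric] by simp
      finally show ?thesis .
    next
      case False
      then show ?thesis by (simp add: coboundary_def c_def Let_def numeral_2_eq_2)
    qed
    then show ?thesis by (auto simp: fun_eq_iff)
  next
    case False
    then show ?thesis by (simp add: coboundary_def numeral_2_eq_2 numeral_3_eq_3)
  qed
  ultimately have "c \<in> ell2_cocycles G 2"
    by (simp add: bounded_cocycles_def)
  from cocycle_is_coboundary_if_not_C_reg[OF G this]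
  obtain \<psi> where \<psi>: "\<psi> \<in> ell2_cochains G 1" "c = coboundary G 1 \<psi>"
    by (auto simp: bounded_coboundaries_def numeral_2_eq_2)
  then obtain B where B: "\<And>xs. xs \<in> tuples G 1 \<Longrightarrow> ell2_norm G (\<psi> xs) \<le> B"
    unfolding bounded_cochains_def by blast
  define h where "h x y = \<psi> [x, y] \<one>" for x y
  show thesis
  proof (rule that[of h "B\<^sup>2"])
    fix x y z assume xyz: "x \<in> carrier G" "y \<in> carrier G" "z \<in> carrier G"
    then have t: "[x, y, z] \<in> tuples G (Suc 1)" "[x, y, z] \<in> tuples G 2" by (auto simp: tuples_def)
    have "c [x, y, z] \<one> = complex_of_real (f x y z)"
      using t xyz by (simp add: c_def)
    moreover have "coboundary G 1 \<psi> [x, y, z] \<one> = h y z - h x z + h x y"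
      using t(1) by (simp add: coboundary_def Let_def h_def)
    ultimately show "complex_of_real (f x y z) = h y z - h x z + h x y" using \<psi>(2) by simp
  next
    fix x y W assume xy: "x \<in> carrier G" "y \<in> carrier G" and W: "finite W" "W \<subseteq> carrier G"
    have t: "[x, y] \<in> tuples G 1" using xy by (auto simp: tuples_def)
    have e: "\<psi> [x, y] \<in> ell2 G" using \<psi>(1) t by (auto simp: bounded_cochains_def)
    \<comment> \<open>Equivariance moves the translation of the pair into the argument of the
      vector, so a sum of squares of \<open>h\<close> along a diagonal orbit is a partial sum of the
      squared norm of one vector.\<close>
    have hg: "h (g \<otimes> x) (g \<otimes> y) = \<psi> [x, y] (inv g)" if "g \<in> carrier G" for g
    proof -
      have "\<psi> (map (mult G g) [x, y]) = left_regular G g (\<psi> [x, y])"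
        using \<psi>(1) t that unfolding bounded_cochains_def by blast
      then show ?thesis using that by (simp add: h_def left_regular_def)
    qed
    have inj: "inj_on (m_inv G) W"
      using W(2) by (rule inj_on_subset[OF inv_inj])
    have "(\<Sum>g\<in>W. (cmod (h (g \<otimes> x) (g \<otimes> y)))\<^sup>2) = (\<Sum>g\<in>m_inv G ` W. (cmod (\<psi> [x, y] g))\<^sup>2)"
      using W hg inj by (auto simp: sum.reindex subset_iff intro!: sum.cong)
    also have "\<dots> \<le> (\<Sum>\<^sub>\<infinity>g\<in>carrier G. (cmod (\<psi> [x, y] g))\<^sup>2)"
      using e W by (intro finite_sum_le_infsum) (auto simp: ell2_def)
    also have "\<dots> = (ell2_norm G (\<psi> [x, y]))\<^sup>2"
      by (simp add: ell2_norm_def infsum_nonneg)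
    also have "\<dots> \<le> B\<^sup>2"
      using B[OF t] by (intro power_mono) (auto simp: ell2_norm_def infsum_nonneg)
    finally show "(\<Sum>g\<in>W. (cmod (h (g \<otimes> x) (g \<otimes> y)))\<^sup>2) \<le> B\<^sup>2" .
  qed
qed

section \<open>Word metrics of hyperbolic groups\<close>

lemma (in group) cancel_left_inv [simp]:
  assumes "x \<in> carrier G" "y \<in> carrier G"
  shows "x \<otimes> (inv x \<otimes> y) = y" "inv x \<otimes> (x \<otimes> y) = y"
  using assms by (simp_all add: m_assoc[symmetric])

lemma (in group) generate_word:
  assumes "S \<subseteq> carrier G" "g \<in> generate G S"
  shows "\<exists>ws. set ws \<subseteq> S \<union> m_inv G ` S \<and> wprod ws = g"
  using assms(2)
proof induction
  case one
  show ?case by (rule exI[of _ "[]"]) simp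
next
  case (incl h)
  then show ?case using assms(1) by (intro exI[of _ "[h]"]) auto
next
  case (inv h)
  then show ?case using assms(1) by (intro exI[of _ "[inv h]"]) auto
next
  case (eng h1 h2)
  then obtain u v where uv: "set u \<subseteq> S \<union> m_inv G ` S" "wprod u = h1" "set v \<subseteq> S \<union> m_inv G ` S" "wprod v = h2"
    by blast
  moreover have "S \<union> m_inv G ` S \<subseteq> carrier G" using assms(1) by auto
  ultimately have "wprod (u @ v) = h1 \<otimes> h2" by (subst wprod_append) auto
  then show ?case using uv by (intro exI[of _ "u @ v"]) auto
qed

locale hyp_group = group H for H (structure) +
  fixes S :: "'a set" and \<delta> :: real
  assumes S: "finite S" "S \<subseteq> carrier H" "generate H S = carrier H"
    and \<delta>: "\<delta> \<ge> 0"
    and four_point: "\<And>w x y z. w \<in> carrier H \<Longrightarrow> x \<in> carrier H \<Longrightarrow> y \<in> carrier H \<Longrightarrow> z \<in> carrier H \<Longrightarrow>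
       gromov_product (word_dist H S) w x z
         \<ge> min (gromov_product (word_dist H S) w x y) (gromov_product (word_dist H S) w y z) - \<delta>"
begin

abbreviation letters :: "'a set" where "letters \<equiv> S \<union> m_inv H ` S"

definition len :: "'a \<Rightarrow> real" where "len g = real (word_length H S g)"

abbreviation d :: "'a \<Rightarrow> 'a \<Rightarrow> real" where "d \<equiv> word_dist H S"

abbreviation gp :: "'a \<Rightarrow> 'a \<Rightarrow> real" where "gp \<equiv> gromov_product d \<one>"

lemma letters: "letters \<subseteq> carrier H" "finite letters"
  using S by auto

lemma word_length_le: "set ws \<subseteq> letters \<Longrightarrow> word_length H S (wprod ws) \<le> length ws"
  unfolding word_length_def by (rule Least_le) auto

lemma obtain_word:
  assumes "g \<in> carrier H"
  obtains ws where "set ws \<subseteq> letters" "wprod ws = g" "length ws = word_length H S g"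
proof -
  obtain ws0 where "set ws0 \<subseteq> letters" "wprod ws0 = g"
    using generate_word[OF S(2)] assms S(3) by metis
  then have "\<exists>ws. length ws = length ws0 \<and> set ws \<subseteq> letters \<and> wprod ws = g" by metis
  then have "\<exists>ws. length ws = word_length H S g \<and> set ws \<subseteq> letters \<and> wprod ws = g"
    unfolding word_length_def by (rule LeastI)
  then show ?thesis using that by blast
qed

lemma len_nonneg [simp]: "len g \<ge> 0" by (simp add: len_def)

lemma len_one [simp]: "len \<one> = 0"
  using word_length_le[of "[]"] by (simp add: len_def)

lemma len_mult:
  assumes "g \<in> carrier H" "h \<in> carrier H"
  shows "len (g \<otimes> h) \<le> len g + len h"
proof -
  obtain u where u: "set u \<subseteq> letters" "wprod u = g" "length u = word_length H S g"
    using obtain_word[OF assms(1)] .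
  obtain v where v: "set v \<subseteq> letters" "wprod v = h" "length v = word_length H S h"
    using obtain_word[OF assms(2)] .
  have "wprod (u @ v) = g \<otimes> h" using u v letters by (subst wprod_append) auto
  then show ?thesis using word_length_le[of "u @ v"] u v by (simp add: len_def)
qed

lemma len_inv [simp]:
  assumes "g \<in> carrier H"
  shows "len (inv g) = len g"
proof -
  have le: "len (inv g) \<le> len g" if "g \<in> carrier H" for g
  proof -
    obtain u where u: "set u \<subseteq> letters" "wprod u = g" "length u = word_length H S g"
      using obtain_word[OF \<open>g \<in> _\<close>] .
    have "set (rev (map (m_inv H) u)) \<subseteq> letters" using u S(2) by (auto simp: subset_iff)
    moreover have "wprod (rev (map (m_inv H) u)) = inv g" using u letters by (subst wprod_rev_inv) auto
    ultimately show ?thesis using word_length_le[of "rev (map (m_inv H) u)"] u by (simp add: len_def)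
  qed
  show ?thesis using le[of g] le[of "inv g"] assms by simp
qed

lemma finite_ball: "finite {g \<in> carrier H. len g \<le> r}"
proof (rule finite_subset)
  show "{g \<in> carrier H. len g \<le> r} \<subseteq> (\<lambda>ws. wprod ws) ` {ws. set ws \<subseteq> letters \<and> length ws \<le> nat \<lfloor>r\<rfloor>}"
  proof
    fix g assume g: "g \<in> {g \<in> carrier H. len g \<le> r}"
    then obtain u where u: "set u \<subseteq> letters" "wprod u = g" "length u = word_length H S g"
      using obtain_word by blast
    have "length u \<le> nat \<lfloor>r\<rfloor>" using g u by (simp add: len_def le_nat_floor)
    then show "g \<in> (\<lambda>ws. wprod ws) ` {ws. set ws \<subseteq> letters \<and> length ws \<le> nat \<lfloor>r\<rfloor>}" using u by auto
  qed
  show "finite ((\<lambda>ws. wprod ws) ` {ws. set ws \<subseteq> letters \<and> length ws \<le> nat \<lfloor>r\<rfloor>})"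
    using letters by (intro finite_imageI finite_lists_length_le)
qed

lemma countable_carrier: "countable (carrier H)"
proof -
  have "carrier H = (\<Union>n. {g \<in> carrier H. len g \<le> real n})"
  proof (intro equalityI subsetI)
    fix x assume "x \<in> carrier H"
    moreover obtain n :: nat where "len x \<le> real n" using real_nat_ceiling_ge by metis
    ultimately show "x \<in> (\<Union>n. {g \<in> carrier H. len g \<le> real n})" by blast
  qed blast
  also have "countable \<dots>" by (rule countable_UN) (auto intro: countable_finite finite_ball)
  finally show ?thesis .
qed

lemma d_eq: "d x y = len (inv x \<otimes> y)"
  by (simp add: word_dist_def len_def)

lemma d_nonneg [simp]: "d x y \<ge> 0" by (simp add: d_eq)

lemma d_self [simp]: "x \<in> carrier H \<Longrightarrow> d x x = 0" by (simp add: d_eq)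

lemma d_sym: "x \<in> carrier H \<Longrightarrow> y \<in> carrier H \<Longrightarrow> d x y = d y x"
  using len_inv[of "inv x \<otimes> y"] by (simp add: d_eq inv_mult_group)

lemma d_triangle:
  assumes "x \<in> carrier H" "y \<in> carrier H" "z \<in> carrier H"
  shows "d x z \<le> d x y + d y z"
proof -
  have "(inv x \<otimes> y) \<otimes> (inv y \<otimes> z) = inv x \<otimes> z"
    using assms by (simp add: m_assoc)
  then show ?thesis using len_mult[of "inv x \<otimes> y" "inv y \<otimes> z"] assms by (simp add: d_eq)
qed

lemma d_mult: "g \<in> carrier H \<Longrightarrow> x \<in> carrier H \<Longrightarrow> y \<in> carrier H \<Longrightarrow> d (g \<otimes> x) (g \<otimes> y) = d x y"
  by (simp add: d_eq inv_mult_group m_assoc)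

lemma d_one [simp]: "x \<in> carrier H \<Longrightarrow> d \<one> x = len x" "x \<in> carrier H \<Longrightarrow> d x \<one> = len x"
  by (simp_all add: d_eq)

lemma gromov_product_eq: "2 * gromov_product d p x y = d x p + d y p - d x y"
  by (simp add: gromov_product_def)

lemma gp_eq: "x \<in> carrier H \<Longrightarrow> y \<in> carrier H \<Longrightarrow> 2 * gp x y = len x + len y - d x y"
  by (simp add: gromov_product_def)

lemma gromov_product_mult:
  "g \<in> carrier H \<Longrightarrow> p \<in> carrier H \<Longrightarrow> x \<in> carrier H \<Longrightarrow> y \<in> carrier H \<Longrightarrow>
     gromov_product d (g \<otimes> p) (g \<otimes> x) (g \<otimes> y) = gromov_product d p x y"
  by (simp add: gromov_product_def d_mult)

lemma gp_mult:
  assumes "g \<in> carrier H" "x \<in> carrier H" "y \<in> carrier H"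
  shows "gp (g \<otimes> x) (g \<otimes> y) = gromov_product d (inv g) x y"
  using gromov_product_mult[of g "inv g" x y] assms by simp

lemma gromov_product_sym:
  "x \<in> carrier H \<Longrightarrow> y \<in> carrier H \<Longrightarrow> gromov_product d p x y = gromov_product d p y x"
  by (simp add: gromov_product_def d_sym)

lemma gromov_product_nonneg:
  "p \<in> carrier H \<Longrightarrow> x \<in> carrier H \<Longrightarrow> y \<in> carrier H \<Longrightarrow> gromov_product d p x y \<ge> 0"
  using d_triangle[of x p y] by (simp add: gromov_product_def d_sym)

lemma gp_le_len:
  "x \<in> carrier H \<Longrightarrow> y \<in> carrier H \<Longrightarrow> gp x y \<le> len x"
  using d_triangle[of \<one> x y] gp_eq[of x y] by simp

lemma gp_translate:
  assumes "g \<in> carrier H" "x \<in> carrier H" "y \<in> carrier H"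
  shows "gp (g \<otimes> x) (g \<otimes> y) \<le> gp x y + len g" "gp (g \<otimes> x) (g \<otimes> y) \<ge> gp x y - len g"
proof -
  have "len (g \<otimes> z) \<le> len g + len z" "len z \<le> len g + len (g \<otimes> z)" if "z \<in> carrier H" for z
    using len_mult[of g z] len_mult[of "inv g" "g \<otimes> z"] that assms by (auto simp: m_assoc[symmetric])
  from this[OF assms(2)] this[OF assms(3)]
  show "gp (g \<otimes> x) (g \<otimes> y) \<le> gp x y + len g" "gp (g \<otimes> x) (g \<otimes> y) \<ge> gp x y - len g"
    using assms gp_eq[of x y] gp_eq[of "g \<otimes> x" "g \<otimes> y"] by (simp_all add: d_mult)
qed

lemma gp_mult_right:
  assumes "x \<in> carrier H" "b \<in> carrier H" "y \<in> carrier H"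
  shows "gp (x \<otimes> b) y \<le> gp x y + len b"
proof -
  have "d x (x \<otimes> b) = len b" using assms by (simp add: d_eq m_assoc[symmetric])
  then show ?thesis
    using len_mult[of x b] d_triangle[of x "x \<otimes> b" y] gp_eq[of x y] gp_eq[of "x \<otimes> b" y] assms
    by simp
qed

text \<open>Both parts of a shortest word are shortest, so its prefixes are the points of a geodesic
  from \<one> to \<open>g\<close>.\<close>

lemma obtain_prefix:
  assumes "g \<in> carrier H" "real k \<le> len g"
  obtains p where "p \<in> carrier H" "len p = k" "d p g = len g - k"
proof -
  obtain u where u: "set u \<subseteq> letters" "wprod u = g" "length u = word_length H S g"
    using obtain_word[OF assms(1)] .
  define p r where "p = wprod (take k u)" and "r = wprod (drop k u)"
  have s: "set (take k u) \<subseteq> letters" "set (drop k u) \<subseteq> letters"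
    using u by (auto dest: in_set_takeD in_set_dropD)
  have c: "p \<in> carrier H" "r \<in> carrier H" using s letters(1) unfolding p_def r_def by (intro wprod_closed; blast)+
  have "wprod (take k u @ drop k u) = p \<otimes> r"
    unfolding p_def r_def using s letters(1) by (intro wprod_append) blast+
  then have g: "g = p \<otimes> r" using u by simp
  have "len p \<le> k" "len r \<le> len g - k"
    using word_length_le[OF s(1)] word_length_le[OF s(2)] u assms(2) by (auto simp: len_def p_def r_def)
  moreover have "len g \<le> len p + len r" using len_mult c g by simp
  moreover have "d p g = len r" using c g by (simp add: d_eq m_assoc[symmetric])
  ultimately show thesis using that[of p] c by auto
qed

text \<open>The source of the dynamics: unless \<open>x\<close> lies in the direction of
  \<open>inv l\<close>, a long \<open>l\<close> moves \<open>x\<close> into the direction of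
  \<open>l\<close>. Left invariance of the metric makes this an exact identity, without an error in
  \<delta>.\<close>

lemma attracting:
  assumes "l \<in> carrier H" "x \<in> carrier H"
  shows "gp l (l \<otimes> x) = len l - gp (inv l) x"
proof -
  have "d l (l \<otimes> x) = len x" using assms by (simp add: d_eq m_assoc[symmetric])
  moreover have "d (inv l) x = len (l \<otimes> x)" using assms by (simp add: d_eq)
  ultimately show ?thesis using assms gp_eq[of l "l \<otimes> x"] gp_eq[of "inv l" x] len_inv[of l]
    by simp
qed

end

section \<open>Visual metrics\<close>

text \<open>Frink's metrization argument. Let \<open>k\<close> be the last position before which at
  most half of the total length \<open>R\<close> is used; then at most half is left after
  \<open>Suc k\<close>. By induction both outer parts are bounded by \<open>R\<close>, as is the
  middle step, and joining the three takes two quasi-triangle inequalities, which cost K^2 \<le>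
  2.\<close>

lemma chain_bound:
  fixes \<rho> :: "'x \<Rightarrow> 'x \<Rightarrow> real"
  assumes K: "1 \<le> K" "K\<^sup>2 \<le> 2"
    and quasi: "\<And>x y z. x \<in> P \<Longrightarrow> y \<in> P \<Longrightarrow> z \<in> P \<Longrightarrow> \<rho> x z \<le> K * max (\<rho> x y) (\<rho> y z)"
    and nonneg: "\<And>x y. \<rho> x y \<ge> 0"
    and c: "\<And>l. c l \<in> P"
  shows "i < j \<Longrightarrow> \<rho> (c i) (c j) \<le> 2 * (\<Sum>l=i..<j. \<rho> (c l) (c (Suc l)))"
proof (induction "j - i" arbitrary: i j rule: less_induct)
  case less
  define R where "R = (\<Sum>l=i..<j. \<rho> (c l) (c (Suc l)))"
  have R0: "R \<ge> 0" unfolding R_def by (intro sum_nonneg nonneg)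
  define A where "A = {k. i \<le> k \<and> k < j \<and> (\<Sum>l=i..<k. \<rho> (c l) (c (Suc l))) \<le> R / 2}"
  define k where "k = Max A"
  have A: "finite A" "i \<in> A" using less.prems R0 by (auto simp: A_def)
  then have "k \<in> A" unfolding k_def by (intro Max_in) auto
  then have k: "i \<le> k" "k < j" "(\<Sum>l=i..<k. \<rho> (c l) (c (Suc l))) \<le> R / 2" by (auto simp: A_def)
  have step: "\<rho> (c k) (c (Suc k)) \<le> R"
    unfolding R_def using k by (intro member_le_sum) (auto intro: nonneg)
  have KR: "R \<le> K * R" using K R0 by (simp add: mult_le_cancel_right1)
  have left: "\<rho> (c i) (c (Suc k)) \<le> K * R"
  proof (cases "i = k")
    case True
    then show ?thesis using step KR by simp
  next
    case False
    then have "i < k" using k by simp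
    then have "\<rho> (c i) (c k) \<le> 2 * (\<Sum>l = i..<k. \<rho> (c l) (c (Suc l)))"
      using k by (intro less.hyps) simp_all
    then have "\<rho> (c i) (c k) \<le> R" using k(3) by simp
    then have "K * max (\<rho> (c i) (c k)) (\<rho> (c k) (c (Suc k))) \<le> K * R"
      using step K by (intro mult_left_mono) auto
    then show ?thesis using quasi[OF c c c, of i "Suc k" k] by simp
  qed
  show ?case
  proof (cases "Suc k = j")
    case True
    have "K * 1 \<le> K * K" using K(1) by (intro mult_left_mono) auto
    then have "K \<le> 2" using K(2) unfolding power2_eq_square by linarith
    then have "K * R \<le> 2 * R" using R0 by (rule mult_right_mono)
    then show ?thesis using left True by (simp add: R_def)
  next
    case False
    then have "Suc k < j" using k by simp
    moreover have "Suc k \<notin> A"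
    proof
      assume "Suc k \<in> A"
      from Max_ge[OF A(1) this] show False by (simp add: k_def)
    qed
    ultimately have "(\<Sum>l=i..<Suc k. \<rho> (c l) (c (Suc l))) > R / 2" using k by (auto simp: A_def)
    moreover have "R = (\<Sum>l=i..<Suc k. \<rho> (c l) (c (Suc l))) + (\<Sum>l=Suc k..<j. \<rho> (c l) (c (Suc l)))"
      unfolding R_def using k \<open>Suc k < j\<close> by (intro sum.atLeastLessThan_concat[symmetric]) auto
    ultimately have "(\<Sum>l=Suc k..<j. \<rho> (c l) (c (Suc l))) \<le> R / 2" by simp
    moreover have "\<rho> (c (Suc k)) (c j) \<le> 2 * (\<Sum>l=Suc k..<j. \<rho> (c l) (c (Suc l)))"
      using \<open>Suc k < j\<close> k by (intro less.hyps) simp_all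
    ultimately have "\<rho> (c (Suc k)) (c j) \<le> R" by simp
    then have "K * max (\<rho> (c i) (c (Suc k))) (\<rho> (c (Suc k)) (c j)) \<le> K * (K * R)"
      using left KR K by (intro mult_left_mono) auto
    also have "\<dots> \<le> 2 * R" using K R0 by (simp add: power2_eq_square mult.assoc[symmetric] mult_right_mono)
    finally show ?thesis using quasi[OF c c c, of i j "Suc k"] by (simp add: R_def)
  qed
qed

text \<open>\<open>D\<close> is the distance from \<open>a\<close> measured along chains. In
  contrast to \<open>\<rho> a\<close>, which obeys only a quasi-triangle inequality, it is
  1-Lipschitz with respect to \<rho>, since a chain to \<open>y\<close> extends to one to
  \<open>x\<close>. The chain bound says that at most a factor 2 is lost.\<close>

lemma chain_distance:
  fixes \<rho> :: "'x \<Rightarrow> 'x \<Rightarrow> real"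
  assumes K: "1 \<le> K" "K\<^sup>2 \<le> 2"
    and quasi: "\<And>x y z. x \<in> P \<Longrightarrow> y \<in> P \<Longrightarrow> z \<in> P \<Longrightarrow> \<rho> x z \<le> K * max (\<rho> x y) (\<rho> y z)"
    and nonneg: "\<And>x y. \<rho> x y \<ge> 0"
    and a: "a \<in> P"
  obtains D where "\<And>x. x \<in> P \<Longrightarrow> D x \<le> \<rho> a x" "\<And>x. x \<in> P \<Longrightarrow> \<rho> a x \<le> 2 * D x"
    "\<And>x y. x \<in> P \<Longrightarrow> y \<in> P \<Longrightarrow> D x \<le> D y + \<rho> y x"
proof -
  \<comment> \<open>Chains have at least one step: \<open>\<rho> a a\<close> may be positive, and
    the empty chain would make \<open>D a\<close> vanish.\<close>
  define cs where "cs x = {\<Sum>l<n. \<rho> (c l) (c (Suc l)) | n c. n > 0 \<and> c 0 = a \<and> c n = x \<and> (\<forall>l. c l \<in> P)}" for x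
  define D where "D x = Inf (cs x)" for x
  have bdd: "bdd_below (cs x)" for x
    unfolding cs_def by (intro bdd_belowI[of _ 0]) (auto intro: sum_nonneg nonneg)
  have one: "\<rho> a x \<in> cs x" if "x \<in> P" for x
    unfolding cs_def using that a
    by (intro CollectI exI[of _ 1] exI[of _ "\<lambda>l. if l = 0 then a else x"]) auto
  show thesis
  proof (rule that[of D])
    fix x assume x: "x \<in> P"
    show "D x \<le> \<rho> a x" unfolding D_def by (intro cInf_lower one x bdd)
    have "\<rho> a x / 2 \<le> D x"
      unfolding D_def
    proof (rule cInf_greatest)
      show "cs x \<noteq> {}" using one[OF x] by auto
      fix s assume "s \<in> cs x"
      then obtain n c where c: "s = (\<Sum>l<n. \<rho> (c l) (c (Suc l)))" "n > 0" "c 0 = a" "c n = x" "\<And>l. c l \<in> P"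
        by (auto simp: cs_def)
      show "\<rho> a x / 2 \<le> s"
        using chain_bound[of K P \<rho> c 0 n, OF K quasi nonneg c(5) c(2)] c by (simp add: atLeast0LessThan)
    qed
    then show "\<rho> a x \<le> 2 * D x" by simp
  next
    fix x y assume xy: "x \<in> P" "y \<in> P"
    have "D x - \<rho> y x \<le> D y"
      unfolding D_def[of y]
    proof (rule cInf_greatest)
      show "cs y \<noteq> {}" using one[OF xy(2)] by auto
      fix s assume "s \<in> cs y"
      then obtain n c where c: "s = (\<Sum>l<n. \<rho> (c l) (c (Suc l)))" "n > 0" "c 0 = a" "c n = y" "\<And>l. c l \<in> P"
        by (auto simp: cs_def)
      let ?c = "c(Suc n := x)"
      have "s + \<rho> y x = (\<Sum>l<Suc n. \<rho> (?c l) (?c (Suc l)))" using c by simp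
      also have "\<dots> \<in> cs x"
        unfolding cs_def using c xy by (intro CollectI exI[of _ "Suc n"] exI[of _ ?c]) auto
      finally show "D x - \<rho> y x \<le> s" unfolding D_def using cInf_lower[OF _ bdd] by fastforce
    qed
    then show "D x \<le> D y + \<rho> y x" by simp
  qed
qed

section \<open>The visual quasi-metric at the identity, Lipschitz bumps and the cocycle made of
  them\<close>

context hyp_group
begin

text \<open>Small enough for the square of exp (\<epsilon> \<delta>) to be at most 2, which is what
  the chain argument tolerates; \<delta> + 1 in place of \<delta> keeps it finite when \<delta> =
  0.\<close>

definition \<epsilon> :: real where "\<epsilon> = ln 2 / (2 * (\<delta> + 1))"

text \<open>Gromov's visual quasi-metric, on group elements instead of boundary points. The distance
  of a point to itself is not 0 but decays exponentially with the length of the point.\<close>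

definition vis :: "'a \<Rightarrow> 'a \<Rightarrow> real" where "vis x y = exp (- \<epsilon> * gp x y)"

lemma \<epsilon>: "\<epsilon> > 0" using \<delta> by (simp add: \<epsilon>_def)

lemma vis_pos: "vis x y > 0" by (simp add: vis_def)

lemma vis_sym: "x \<in> carrier H \<Longrightarrow> y \<in> carrier H \<Longrightarrow> vis x y = vis y x"
  by (simp add: vis_def gromov_product_sym)

lemma exp_\<epsilon>: "1 \<le> exp (\<epsilon> * \<delta>)" "(exp (\<epsilon> * \<delta>))\<^sup>2 \<le> 2"
proof -
  show "1 \<le> exp (\<epsilon> * \<delta>)" using \<epsilon> \<delta> by simp
  have "2 * (\<epsilon> * \<delta>) = ln 2 * (\<delta> / (\<delta> + 1))" using \<delta> by (simp add: \<epsilon>_def field_simps)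
  also have "\<dots> \<le> ln 2 * 1" using \<delta> by (intro mult_left_mono) (auto simp: field_simps)
  finally have "exp (2 * (\<epsilon> * \<delta>)) \<le> exp (ln 2)" unfolding exp_le_cancel_iff by simp
  then show "(exp (\<epsilon> * \<delta>))\<^sup>2 \<le> 2" by (simp flip: exp_double)
qed

lemma vis_quasi:
  assumes "x \<in> carrier H" "y \<in> carrier H" "z \<in> carrier H"
  shows "vis x z \<le> exp (\<epsilon> * \<delta>) * max (vis x y) (vis y z)"
proof -
  have shift: "vis x z \<le> exp (\<epsilon> * \<delta>) * vis u v" if "gp x z \<ge> gp u v - \<delta>" for u v
  proof -
    have "vis x z \<le> exp (\<epsilon> * \<delta> + - \<epsilon> * gp u v)"
      using mult_left_mono[OF that, of \<epsilon>] \<epsilon> by (simp add: vis_def algebra_simps)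
    then show ?thesis unfolding exp_add vis_def .
  qed
  have "gp x z \<ge> min (gp x y) (gp y z) - \<delta>" using four_point assms by simp
  then have "vis x z \<le> exp (\<epsilon> * \<delta>) * vis x y \<or> vis x z \<le> exp (\<epsilon> * \<delta>) * vis y z"
    using shift by (meson min_le_iff_disj diff_le_eq)
  moreover have "exp (\<epsilon> * \<delta>) * vis x y \<le> exp (\<epsilon> * \<delta>) * max (vis x y) (vis y z)"
    "exp (\<epsilon> * \<delta>) * vis y z \<le> exp (\<epsilon> * \<delta>) * max (vis x y) (vis y z)" by simp_all
  ultimately show ?thesis by linarith
qed

lemma vis_quasi2:
  assumes "x \<in> carrier H" "y \<in> carrier H" "z \<in> carrier H" "vis x y < r" "vis y z < r"
  shows "vis x z < 2 * r"
proof -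
  have "exp (\<epsilon> * \<delta>) * 1 \<le> exp (\<epsilon> * \<delta>) * exp (\<epsilon> * \<delta>)" using exp_\<epsilon>(1) by (intro mult_left_mono) auto
  then have "exp (\<epsilon> * \<delta>) \<le> 2" using exp_\<epsilon>(2) unfolding power2_eq_square by linarith
  have "vis x z \<le> exp (\<epsilon> * \<delta>) * max (vis x y) (vis y z)" using vis_quasi assms by blast
  also have "\<dots> < exp (\<epsilon> * \<delta>) * r" using assms by (intro mult_strict_left_mono) auto
  also have "\<dots> \<le> 2 * r"
    using \<open>exp (\<epsilon> * \<delta>) \<le> 2\<close> vis_pos[of x y] assms by (intro mult_right_mono) auto
  finally show ?thesis .
qed

text \<open>Two quasi-triangle inequalities cost the square of exp (\<epsilon> \<delta>), so a path
  of three steps still loses only a factor 2.\<close>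

lemma vis_quasi3:
  assumes "x \<in> carrier H" "y \<in> carrier H" "z \<in> carrier H" "w \<in> carrier H"
    "vis x y < r" "vis y z < r" "vis z w < r"
  shows "vis x w < 2 * r"
proof -
  have r: "r > 0" using vis_pos[of x y] assms(5) by linarith
  have "vis x z \<le> exp (\<epsilon> * \<delta>) * max (vis x y) (vis y z)" using vis_quasi assms by blast
  also have "\<dots> < exp (\<epsilon> * \<delta>) * r" using assms by (intro mult_strict_left_mono) auto
  finally have 1: "vis x z < exp (\<epsilon> * \<delta>) * r" .
  have "1 * r \<le> exp (\<epsilon> * \<delta>) * r" using exp_\<epsilon>(1) r by (intro mult_right_mono) auto
  then have 2: "vis z w < exp (\<epsilon> * \<delta>) * r" using assms(7) by simp
  have "vis x w \<le> exp (\<epsilon> * \<delta>) * max (vis x z) (vis z w)" using vis_quasi assms by blast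
  also have "\<dots> < exp (\<epsilon> * \<delta>) * (exp (\<epsilon> * \<delta>) * r)" using 1 2 by (intro mult_strict_left_mono) auto
  also have "\<dots> = (exp (\<epsilon> * \<delta>))\<^sup>2 * r" by (simp add: power2_eq_square)
  also have "\<dots> \<le> 2 * r" using exp_\<epsilon>(2) r by (intro mult_right_mono) auto
  finally show ?thesis .
qed

text \<open>The bump falls linearly from 1 to 0 while the chain distance \<open>D\<close> from
  \<open>a\<close> grows from \<open>r\<close> to 2r, and it is Lipschitz because \<open>D\<close>
  is. The radius 4r of the support comes from \<open>vis\<close> being at most twice
  \<open>D\<close>, and the 8r from one more quasi-triangle through a point of the support.\<close>

lemma obtain_bump:
  assumes a: "a \<in> carrier H" and r: "r > 0"
  obtains u where "\<And>x. 0 \<le> u x \<and> u x \<le> 1"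
    "\<And>x y. x \<in> carrier H \<Longrightarrow> y \<in> carrier H \<Longrightarrow> \<bar>u x - u y\<bar> \<le> vis x y / r"
    "\<And>x. x \<in> carrier H \<Longrightarrow> u x \<noteq> 0 \<Longrightarrow> vis a x < 4 * r"
    "\<And>x. x \<in> carrier H \<Longrightarrow> vis a x \<le> r \<Longrightarrow> u x = 1"
    "\<And>x w. x \<in> carrier H \<Longrightarrow> w \<in> carrier H \<Longrightarrow> vis a w \<ge> 8 * r \<Longrightarrow> vis w x \<le> r \<Longrightarrow> u x = 0"
proof -
  obtain D where D: "\<And>x. x \<in> carrier H \<Longrightarrow> D x \<le> vis a x" "\<And>x. x \<in> carrier H \<Longrightarrow> vis a x \<le> 2 * D x"
    "\<And>x y. x \<in> carrier H \<Longrightarrow> y \<in> carrier H \<Longrightarrow> D x \<le> D y + vis y x"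
    using chain_distance[of "exp (\<epsilon> * \<delta>)" "carrier H" vis a, OF exp_\<epsilon> vis_quasi less_imp_le[OF vis_pos] a]
    by blast
  define u where "u x = max 0 (min 1 (2 - D x / r))" for x
  show thesis
  proof (rule that[of u])
    show "0 \<le> u x \<and> u x \<le> 1" for x by (auto simp: u_def)
    fix x assume x: "x \<in> carrier H"
    show "\<bar>u x - u y\<bar> \<le> vis x y / r" if "y \<in> carrier H" for y
    proof -
      have "\<bar>D x - D y\<bar> \<le> vis x y" using D(3)[of x y] D(3)[of y x] vis_sym x that by auto
      then have "\<bar>D x / r - D y / r\<bar> \<le> vis x y / r"
        using r by (simp add: diff_divide_distrib[symmetric] divide_right_mono)
      then show ?thesis unfolding u_def by linarith
    qed
    show near: "vis a x < 4 * r" if "u x \<noteq> 0"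
    proof -
      have "D x / r < 2" using that by (auto simp: u_def max_def split: if_splits)
      then have "D x < 2 * r" using r by (simp add: field_simps)
      then show ?thesis using D(2)[OF x] by simp
    qed
    show "u x = 0" if "w \<in> carrier H" "vis a w \<ge> 8 * r" "vis w x \<le> r" for w
    proof (rule ccontr)
      assume "u x \<noteq> 0"
      then have "vis a x < 4 * r" "vis x w < 4 * r" using near that vis_sym[of x w] x r by auto
      then have "vis a w < 2 * (4 * r)" using that x a by (intro vis_quasi2[of a x w])
      then show False using that(2) by simp
    qed
    show "u x = 1" if "vis a x \<le> r"
    proof -
      have "D x / r \<le> 1" using D(1)[OF x] that r by simp
      then show ?thesis by (simp add: u_def)
    qed
  qed
qed

text \<open>Small products of \<open>x\<close> with \<open>y\<close> and with \<open>z\<close> at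
  \<open>p\<close> say that \<open>p\<close> is near the leg of the triangle that runs from
  \<open>x\<close> to the centre; the product of \<open>y\<close> and \<open>z\<close> at
  \<open>p\<close> is then about the distance to the centre. Two points of one leg at about equal
  distance from the centre are close. By the four-point condition, \<open>p'\<close> as seen from
  \<open>p\<close> is either not in the direction of \<open>x\<close> or in neither of the other
  two, and likewise with \<open>p\<close> and \<open>p'\<close> exchanged; each of the four
  combinations bounds \<open>d p p'\<close>.\<close>

lemma same_leg_close:
  assumes c: "p \<in> carrier H" "p' \<in> carrier H" "x \<in> carrier H" "y \<in> carrier H" "z \<in> carrier H"
    and p: "gromov_product d p x y \<le> Q" "gromov_product d p x z \<le> Q"
    and p': "gromov_product d p' x y \<le> Q" "gromov_product d p' x z \<le> Q"
    and eq: "\<bar>gromov_product d p y z - gromov_product d p' y z\<bar> \<le> 1"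
  shows "d p p' \<le> 2 * (Q + \<delta>) + 1"
proof -
  let ?q = "gromov_product d p" and ?q' = "gromov_product d p'"
  have sum: "?q p' w + ?q' p w = d p p'" if "w \<in> carrier H" for w
    using gromov_product_eq[of p p' w] gromov_product_eq[of p' p w] d_sym c that by simp
  have alt: "?q p' x \<le> Q + \<delta> \<or> (?q p' y \<le> Q + \<delta> \<and> ?q p' z \<le> Q + \<delta>)"
    using four_point[of p x p' y] four_point[of p x p' z] p c gromov_product_sym[of x p' p] by auto
  have alt': "?q' p x \<le> Q + \<delta> \<or> (?q' p y \<le> Q + \<delta> \<and> ?q' p z \<le> Q + \<delta>)"
    using four_point[of p' x p y] four_point[of p' x p z] p' c gromov_product_sym[of x p p'] by auto
  have base: "?q y z = ?q' y z + ?q p' y - ?q' p z"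
    using gromov_product_eq[of p y z] gromov_product_eq[of p' y z] gromov_product_eq[of p p' y]
      gromov_product_eq[of p' p z] d_sym c by simp
  have base': "?q' y z = ?q y z + ?q' p y - ?q p' z"
    using gromov_product_eq[of p y z] gromov_product_eq[of p' y z] gromov_product_eq[of p' p y]
      gromov_product_eq[of p p' z] d_sym c by simp
  have eq': "?q y z - ?q' y z \<le> 1" "?q' y z - ?q y z \<le> 1" using eq by linarith+
  note sums = sum[OF c(3)] sum[OF c(4)] sum[OF c(5)]
  from alt alt' show ?thesis
  proof (elim disjE conjE)
    assume "?q p' x \<le> Q + \<delta>" "?q' p x \<le> Q + \<delta>"
    then show ?thesis using sums by (simp add: algebra_simps)
  next
    assume "?q p' x \<le> Q + \<delta>" "?q' p y \<le> Q + \<delta>" "?q' p z \<le> Q + \<delta>"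
    then show ?thesis using sums base eq' by (simp add: algebra_simps)
  next
    assume "?q p' y \<le> Q + \<delta>" "?q p' z \<le> Q + \<delta>" "?q' p x \<le> Q + \<delta>"
    then show ?thesis using sums base' eq' by (simp add: algebra_simps)
  next
    assume "?q p' y \<le> Q + \<delta>" "?q' p y \<le> Q + \<delta>"
    then show ?thesis using sums by (simp add: algebra_simps)
  qed
qed

text \<open>Translating by g amounts to taking \<open>inv g\<close> as base point. The condition on
  \<open>W\<close> puts \<open>inv g\<close> on the leg of \<open>x\<close>, and the product of the
  other two vertices is about its distance from the centre. Boundedly many g belong to each unit of
  distance, while the summand decays exponentially in it; the geometric series does not depend on
  the triangle.\<close>

lemma sum_along_leg:
  obtains C where "\<And>x y z W. x \<in> carrier H \<Longrightarrow> y \<in> carrier H \<Longrightarrow> z \<in> carrier H \<Longrightarrow>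
     finite W \<Longrightarrow> W \<subseteq> {g \<in> carrier H. gp (g \<otimes> x) (g \<otimes> y) \<le> Q \<and> gp (g \<otimes> x) (g \<otimes> z) \<le> Q} \<Longrightarrow>
     (\<Sum>g\<in>W. (vis (g \<otimes> y) (g \<otimes> z))\<^sup>2) \<le> C" "C \<ge> 0"
proof -
  define B where "B = real (card {g \<in> carrier H. len g \<le> 2 * (Q + \<delta>) + 1})"
  define q where "q = exp (- 2 * \<epsilon>)"
  have q: "0 < q" "q < 1" using \<epsilon> by (auto simp: q_def)
  show thesis
  proof (rule that[of "B / (1 - q)"])
    show "B / (1 - q) \<ge> 0" using q by (auto simp: B_def)
    fix x y z W assume xyz: "x \<in> carrier H" "y \<in> carrier H" "z \<in> carrier H" and W: "finite W"
      "W \<subseteq> {g \<in> carrier H. gp (g \<otimes> x) (g \<otimes> y) \<le> Q \<and> gp (g \<otimes> x) (g \<otimes> z) \<le> Q}"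
    define t where "t g = nat \<lfloor>gp (g \<otimes> y) (g \<otimes> z)\<rfloor>" for g
    have t: "real (t g) \<le> gp (g \<otimes> y) (g \<otimes> z)" "gp (g \<otimes> y) (g \<otimes> z) < real (t g) + 1" if "g \<in> W" for g
    proof -
      have "gp (g \<otimes> y) (g \<otimes> z) \<ge> 0" using that W xyz by (intro gromov_product_nonneg) auto
      then show "real (t g) \<le> gp (g \<otimes> y) (g \<otimes> z)" "gp (g \<otimes> y) (g \<otimes> z) < real (t g) + 1"
        unfolding t_def by linarith+
    qed
    have card: "real (card {g \<in> W. t g = n}) \<le> B" for n
    proof (cases "{g \<in> W. t g = n} = {}")
      case True
      then show ?thesis by (simp only: card.empty) (simp add: B_def)
    next
      case False
      then obtain g' where g': "g' \<in> W" "t g' = n" by auto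
      have g'c: "g' \<in> carrier H" using g' W by auto
      \<comment> \<open>Since \<open>d (inv g) (inv g')\<close> is the length of
        \<open>g \<otimes> inv g'\<close>, a right translate of the level set lies in a fixed
        ball.\<close>
      have "(\<lambda>g. g \<otimes> inv g') ` {g \<in> W. t g = n} \<subseteq> {g \<in> carrier H. len g \<le> 2 * (Q + \<delta>) + 1}"
      proof
        fix h assume "h \<in> (\<lambda>g. g \<otimes> inv g') ` {g \<in> W. t g = n}"
        then obtain g where g: "g \<in> W" "t g = n" "h = g \<otimes> inv g'" by auto
        have gc: "g \<in> carrier H" using g W by auto
        have "d (inv g) (inv g') \<le> 2 * (Q + \<delta>) + 1"
        proof (rule same_leg_close[of _ _ x y z])
          show "\<bar>gromov_product d (inv g) y z - gromov_product d (inv g') y z\<bar> \<le> 1"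
            using t[OF g(1)] t[OF g'(1)] g g' gc g'c xyz by (auto simp: gp_mult)
        qed (use xyz gc g'c W g g' in \<open>auto simp: gp_mult[symmetric]\<close>)
        then show "h \<in> {g \<in> carrier H. len g \<le> 2 * (Q + \<delta>) + 1}"
          using g gc g'c by (simp add: d_eq)
      qed
      then have "card ((\<lambda>g. g \<otimes> inv g') ` {g \<in> W. t g = n}) \<le> card {g \<in> carrier H. len g \<le> 2 * (Q + \<delta>) + 1}"
        by (intro card_mono finite_ball)
      moreover have "inj_on (\<lambda>g. g \<otimes> inv g') {g \<in> W. t g = n}"
        using W g'c by (intro inj_onI) (metis (no_types, lifting) inv_closed mem_Collect_eq r_cancel subsetD)
      ultimately show ?thesis by (simp add: card_image B_def)
    qed
    have "(\<Sum>g\<in>W. (vis (g \<otimes> y) (g \<otimes> z))\<^sup>2) \<le> (\<Sum>g\<in>W. q ^ t g)"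
    proof (intro sum_mono)
      fix g assume g: "g \<in> W"
      have "(vis (g \<otimes> y) (g \<otimes> z))\<^sup>2 = exp (- 2 * \<epsilon> * gp (g \<otimes> y) (g \<otimes> z))"
        unfolding vis_def by (simp flip: exp_double)
      also have "\<dots> \<le> exp (real (t g) * (- 2 * \<epsilon>))" using t(1)[OF g] \<epsilon> by (simp add: mult.commute)
      also have "\<dots> = q ^ t g" unfolding q_def exp_of_nat_mult ..
      finally show "(vis (g \<otimes> y) (g \<otimes> z))\<^sup>2 \<le> q ^ t g" .
    qed
    also have "\<dots> = (\<Sum>n\<in>t ` W. \<Sum>g\<in>{g \<in> W. t g = n}. q ^ t g)" by (rule sum.image_gen[OF W(1)])
    also have "\<dots> = (\<Sum>n\<in>t ` W. real (card {g \<in> W. t g = n}) * q ^ n)" by (intro sum.cong refl) simp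
    also have "\<dots> \<le> (\<Sum>n\<in>t ` W. B * q ^ n)" using q by (intro sum_mono mult_right_mono card) auto
    also have "\<dots> = B * (\<Sum>n\<in>t ` W. q ^ n)" by (simp add: sum_distrib_left)
    also have "\<dots> \<le> B * suminf (\<lambda>n. q ^ n)"
      using q W(1) by (intro mult_left_mono sum_le_suminf) (auto simp: B_def)
    also have "\<dots> = B / (1 - q)" using q by (simp add: suminf_geometric)
    finally show "(\<Sum>g\<in>W. (vis (g \<otimes> y) (g \<otimes> z))\<^sup>2) \<le> B / (1 - q)" .
  qed
qed


text \<open>If the cyclic sum does not vanish, some pair of vertices has a bounded product, and by
  the four-point condition some vertex then has bounded products with both others: the base point is
  on the leg of that vertex. There the cyclic sum is a difference of two increments of
  \<open>F\<close> between the other two vertices, so it is at most a multiple of their visual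
  distance. The three legs are summed separately.\<close>

lemma cyclic_sum_l2_bounded:
  assumes anti: "\<And>x y. x \<in> carrier H \<Longrightarrow> y \<in> carrier H \<Longrightarrow> F x y = - F y x"
    and lip: "\<And>x y z. x \<in> carrier H \<Longrightarrow> y \<in> carrier H \<Longrightarrow> z \<in> carrier H \<Longrightarrow> \<bar>F x y - F x z\<bar> \<le> L * vis y z"
    and supp: "\<And>x y. x \<in> carrier H \<Longrightarrow> y \<in> carrier H \<Longrightarrow> F x y \<noteq> 0 \<Longrightarrow> gp x y \<le> Q"
  obtains C where "\<And>x y z W. x \<in> carrier H \<Longrightarrow> y \<in> carrier H \<Longrightarrow> z \<in> carrier H \<Longrightarrow>
     finite W \<Longrightarrow> W \<subseteq> carrier H \<Longrightarrow>
     (\<Sum>g\<in>W. (cyclic_sum F (g \<otimes> x) (g \<otimes> y) (g \<otimes> z))\<^sup>2) \<le> C"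
proof -
  define f where "f = cyclic_sum F"
  have f_eq: "f x y z = F x y + F y z + F z x" for x y z by (simp add: f_def cyclic_sum_def)
  have f_le: "\<bar>f x y z\<bar> \<le> 2 * L * vis y z" if "x \<in> carrier H" "y \<in> carrier H" "z \<in> carrier H" for x y z
  proof -
    have "F z z = 0" using anti[of z z] that by simp
    then have "f x y z = (F x y - F x z) - (F z y - F z z)"
      using anti[of z x] anti[of y z] that by (simp add: f_eq)
    then show ?thesis using lip[of x y z] lip[of z y z] that by linarith
  qed
  have cyc: "f y z x = f x y z" "f z x y = f x y z" for x y z by (simp_all add: f_eq)
  have legs: "(gp x y \<le> Q + \<delta> \<and> gp x z \<le> Q + \<delta>) \<or> (gp y x \<le> Q + \<delta> \<and> gp y z \<le> Q + \<delta>)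
      \<or> (gp z x \<le> Q + \<delta> \<and> gp z y \<le> Q + \<delta>)"
    if "x \<in> carrier H" "y \<in> carrier H" "z \<in> carrier H" "f x y z \<noteq> 0" for x y z
  proof -
    have "F x y \<noteq> 0 \<or> F y z \<noteq> 0 \<or> F z x \<noteq> 0" using that(4) by (auto simp: f_eq)
    then have "gp x y \<le> Q \<or> gp y z \<le> Q \<or> gp z x \<le> Q" using supp[of x y] supp[of y z] supp[of z x] that(1-3) by blast
    then show ?thesis
      using four_point[of \<one> x z y] four_point[of \<one> y x z] four_point[of \<one> z y x] that \<delta>
        gromov_product_sym[of x y \<one>] gromov_product_sym[of y z \<one>] gromov_product_sym[of x z \<one>] by auto
  qed
  obtain C where C: "\<And>x y z W. x \<in> carrier H \<Longrightarrow> y \<in> carrier H \<Longrightarrow> z \<in> carrier H \<Longrightarrow>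
     finite W \<Longrightarrow> W \<subseteq> {g \<in> carrier H. gp (g \<otimes> x) (g \<otimes> y) \<le> Q + \<delta> \<and> gp (g \<otimes> x) (g \<otimes> z) \<le> Q + \<delta>} \<Longrightarrow>
     (\<Sum>g\<in>W. (vis (g \<otimes> y) (g \<otimes> z))\<^sup>2) \<le> C" "C \<ge> 0"
    using sum_along_leg[of "Q + \<delta>"] by blast
  show thesis
  proof (rule that[of "3 * ((2 * L)\<^sup>2 * C)"])
    fix x y z W assume xyz: "x \<in> carrier H" "y \<in> carrier H" "z \<in> carrier H" and W: "finite W" "W \<subseteq> carrier H"
    define \<phi> where "\<phi> g = (f (g \<otimes> x) (g \<otimes> y) (g \<otimes> z))\<^sup>2" for g
    have leg: "(\<Sum>g\<in>V. (f (g \<otimes> x) (g \<otimes> y) (g \<otimes> z))\<^sup>2) \<le> (2 * L)\<^sup>2 * C"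
      if "x \<in> carrier H" "y \<in> carrier H" "z \<in> carrier H" "finite V"
        "V \<subseteq> {g \<in> carrier H. gp (g \<otimes> x) (g \<otimes> y) \<le> Q + \<delta> \<and> gp (g \<otimes> x) (g \<otimes> z) \<le> Q + \<delta>}" for x y z V
    proof -
      have "(\<Sum>g\<in>V. (f (g \<otimes> x) (g \<otimes> y) (g \<otimes> z))\<^sup>2) \<le> (\<Sum>g\<in>V. (2 * L)\<^sup>2 * (vis (g \<otimes> y) (g \<otimes> z))\<^sup>2)"
      proof (intro sum_mono)
        fix g assume "g \<in> V"
        then have "\<bar>f (g \<otimes> x) (g \<otimes> y) (g \<otimes> z)\<bar> \<le> 2 * L * vis (g \<otimes> y) (g \<otimes> z)"
          using that by (intro f_le) auto
        then show "(f (g \<otimes> x) (g \<otimes> y) (g \<otimes> z))\<^sup>2 \<le> (2 * L)\<^sup>2 * (vis (g \<otimes> y) (g \<otimes> z))\<^sup>2"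
          unfolding power_mult_distrib[symmetric] by (rule abs_le_square_iff[THEN iffD1, OF order_trans[OF _ abs_ge_self]])
      qed
      also have "\<dots> = (2 * L)\<^sup>2 * (\<Sum>g\<in>V. (vis (g \<otimes> y) (g \<otimes> z))\<^sup>2)" by (simp add: sum_distrib_left)
      also have "\<dots> \<le> (2 * L)\<^sup>2 * C" using that by (intro mult_left_mono C) auto
      finally show ?thesis .
    qed
    define V where "V x y z = {g \<in> W. gp (g \<otimes> x) (g \<otimes> y) \<le> Q + \<delta> \<and> gp (g \<otimes> x) (g \<otimes> z) \<le> Q + \<delta>}" for x y z
    have V: "finite (V x y z)" "V x y z \<subseteq> W"
      "V x y z \<subseteq> {g \<in> carrier H. gp (g \<otimes> x) (g \<otimes> y) \<le> Q + \<delta> \<and> gp (g \<otimes> x) (g \<otimes> z) \<le> Q + \<delta>}" for x y z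
      using W by (auto simp: V_def)
    have "sum \<phi> W \<le> sum \<phi> (V x y z \<union> V y x z \<union> V z x y)"
    proof (rule sum_mono2[THEN order_trans[rotated]])
      have "sum \<phi> W = sum \<phi> (W \<inter> (V x y z \<union> V y x z \<union> V z x y))"
      proof (intro sum.mono_neutral_right ballI W(1))
        fix g assume g: "g \<in> W - W \<inter> (V x y z \<union> V y x z \<union> V z x y)"
        then show "\<phi> g = 0"
          using legs[of "g \<otimes> x" "g \<otimes> y" "g \<otimes> z"] xyz W by (auto simp: \<phi>_def V_def)
      qed auto
      then show "sum \<phi> W \<le> sum \<phi> (W \<inter> (V x y z \<union> V y x z \<union> V z x y))" by simp
    qed (auto simp: V \<phi>_def)
    also have "\<dots> \<le> sum \<phi> (V x y z) + sum \<phi> (V y x z) + sum \<phi> (V z x y)"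
    proof -
      have un: "sum \<phi> (A \<union> B) \<le> sum \<phi> A + sum \<phi> B" if "finite A" "finite B" for A B
        using sum.union_inter[OF that, of \<phi>] sum_nonneg[of "A \<inter> B" \<phi>] by (simp add: \<phi>_def)
      show ?thesis
        using un[of "V x y z \<union> V y x z" "V z x y"] un[of "V x y z" "V y x z"] V(1) by simp
    qed
    also have "\<dots> \<le> 3 * ((2 * L)\<^sup>2 * C)"
    proof -
      have "sum \<phi> (V x y z) \<le> (2 * L)\<^sup>2 * C" unfolding \<phi>_def using xyz V by (intro leg)
      moreover have "sum \<phi> (V y x z) \<le> (2 * L)\<^sup>2 * C"
      proof -
        have "sum \<phi> (V y x z) = (\<Sum>g\<in>V y x z. (f (g \<otimes> y) (g \<otimes> x) (g \<otimes> z))\<^sup>2)"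
        proof (intro sum.cong refl)
          fix g assume "g \<in> V y x z"
          then have "g \<in> carrier H" using V W by blast
          then have "f (g \<otimes> y) (g \<otimes> x) (g \<otimes> z) = - f (g \<otimes> x) (g \<otimes> y) (g \<otimes> z)"
            using anti[of "g \<otimes> x" "g \<otimes> y"] anti[of "g \<otimes> y" "g \<otimes> z"] anti[of "g \<otimes> z" "g \<otimes> x"] xyz
            by (simp add: f_eq)
          then show "\<phi> g = (f (g \<otimes> y) (g \<otimes> x) (g \<otimes> z))\<^sup>2" by (simp add: \<phi>_def)
        qed
        then show ?thesis using leg[OF xyz(2,1,3) V(1) V(3)] by simp
      qed
      moreover have "sum \<phi> (V z x y) \<le> (2 * L)\<^sup>2 * C"
        using leg[OF xyz(3,1,2) V(1) V(3)] by (simp add: \<phi>_def cyc)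
      ultimately show ?thesis by simp
    qed
    finally show "(\<Sum>g\<in>W. (cyclic_sum F (g \<otimes> x) (g \<otimes> y) (g \<otimes> z))\<^sup>2) \<le> 3 * ((2 * L)\<^sup>2 * C)"
      by (simp add: \<phi>_def f_def)
  qed
qed

text \<open>Bumps around \<open>a\<close> and \<open>b\<close> suffice: both vanish near
  \<open>c\<close>, so of the three terms of the cyclic sum only \<open>F x y\<close> survives.
  \<open>M\<close> depends on \<open>D\<close> alone, so the points may afterwards be taken as far
  out as desired.\<close>

lemma separating_cocycle:
  obtains M where "\<And>a b c. a \<in> carrier H \<Longrightarrow> b \<in> carrier H \<Longrightarrow> c \<in> carrier H \<Longrightarrow>
    gp a b \<le> D \<Longrightarrow> gp a c \<le> D \<Longrightarrow> gp b c \<le> D \<Longrightarrow>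
    \<exists>F C. l2_kernel H F C \<and>
      (\<forall>x\<in>carrier H. \<forall>y\<in>carrier H. \<forall>z\<in>carrier H. gp a x \<ge> M \<and> gp b y \<ge> M \<and> gp c z \<ge> M \<longrightarrow>
        cyclic_sum F x y z = 1)"
proof -
  \<comment> \<open>Products at most \<open>D\<close> become visual distances at least 8r, the
    separation that bumps of radius \<open>r\<close> require. \<open>M\<close> and \<open>Q\<close>
    are the products that correspond to the visual distances r and 4r.\<close>
  define r where "r = exp (- \<epsilon> * D) / 8"
  have r: "r > 0" by (simp add: r_def)
  define M where "M = - ln r / \<epsilon>"
  define Q where "Q = - ln (4 * r) / \<epsilon>"
  have near: "vis a x \<le> r" if "gp a x \<ge> M" for a x
  proof -
    have "- \<epsilon> * gp a x \<le> ln r" using that \<epsilon> by (simp add: M_def field_simps)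
    then show ?thesis unfolding vis_def using r by (metis exp_le_cancel_iff exp_ln)
  qed
  have far: "vis a b \<ge> 8 * r" if "gp a b \<le> D" for a b
    using that \<epsilon> by (simp add: vis_def r_def)
  show thesis
  proof (rule that[of M], goal_cases)
    case (1 a b c)
    obtain u where u: "\<And>x. 0 \<le> u x \<and> u x \<le> 1"
      "\<And>x y. x \<in> carrier H \<Longrightarrow> y \<in> carrier H \<Longrightarrow> \<bar>u x - u y\<bar> \<le> vis x y / r"
      "\<And>x. x \<in> carrier H \<Longrightarrow> u x \<noteq> 0 \<Longrightarrow> vis a x < 4 * r"
      "\<And>x. x \<in> carrier H \<Longrightarrow> vis a x \<le> r \<Longrightarrow> u x = 1"
      "\<And>x w. x \<in> carrier H \<Longrightarrow> w \<in> carrier H \<Longrightarrow> vis a w \<ge> 8 * r \<Longrightarrow> vis w x \<le> r \<Longrightarrow> u x = 0"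
      using obtain_bump[OF 1(1) r] by blast
    obtain v where v: "\<And>x. 0 \<le> v x \<and> v x \<le> 1"
      "\<And>x y. x \<in> carrier H \<Longrightarrow> y \<in> carrier H \<Longrightarrow> \<bar>v x - v y\<bar> \<le> vis x y / r"
      "\<And>x. x \<in> carrier H \<Longrightarrow> v x \<noteq> 0 \<Longrightarrow> vis b x < 4 * r"
      "\<And>x. x \<in> carrier H \<Longrightarrow> vis b x \<le> r \<Longrightarrow> v x = 1"
      "\<And>x w. x \<in> carrier H \<Longrightarrow> w \<in> carrier H \<Longrightarrow> vis b w \<ge> 8 * r \<Longrightarrow> vis w x \<le> r \<Longrightarrow> v x = 0"
      using obtain_bump[OF 1(2) r] by blast
    define F where "F x y = u x * v y - u y * v x" for x y
    have bound: "\<bar>F x y\<bar> \<le> 1" for x y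
    proof -
      have "0 \<le> u x * v y" "u x * v y \<le> 1" "0 \<le> u y * v x" "u y * v x \<le> 1"
        using u(1) v(1) by (auto intro: mult_le_one)
      then show ?thesis by (simp add: F_def)
    qed
    \<comment> \<open>The supports are apart: otherwise \<open>a\<close>, \<open>x\<close>,
      \<open>y\<close>, \<open>b\<close> would be a path of three steps below 4r, against the
      separation of \<open>a\<close> and \<open>b\<close>.\<close>
    have sep: "vis x y \<ge> 4 * r" if "x \<in> carrier H" "y \<in> carrier H" "u x \<noteq> 0" "v y \<noteq> 0" for x y
    proof (rule ccontr)
      assume "\<not> vis x y \<ge> 4 * r"
      then have "vis a b < 2 * (4 * r)"
        using that 1 u(3) v(3) by (intro vis_quasi3[of a x y b]) (auto simp: vis_sym[of y b])
      then show False using far[OF 1(4)] by simp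
    qed
    have supp: "gp x y \<le> Q" if "x \<in> carrier H" "y \<in> carrier H" "F x y \<noteq> 0" for x y
    proof -
      have "(u x \<noteq> 0 \<and> v y \<noteq> 0) \<or> (u y \<noteq> 0 \<and> v x \<noteq> 0)" using that(3) by (auto simp: F_def)
      then have "vis x y \<ge> 4 * r" using that(1,2) sep[of x y] sep[of y x] vis_sym[of x y] by auto
      then have "ln (4 * r) \<le> - \<epsilon> * gp x y" unfolding vis_def using r by (metis exp_le_cancel_iff exp_ln mult_pos_pos zero_less_numeral)
      then show ?thesis using \<epsilon> by (simp add: Q_def field_simps)
    qed
    have lip: "\<bar>F x y - F x z\<bar> \<le> 2 / r * vis y z" if "x \<in> carrier H" "y \<in> carrier H" "z \<in> carrier H" for x y z
    proof -
      have "F x y - F x z = u x * (v y - v z) - v x * (u y - u z)" by (simp add: F_def algebra_simps)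
      also have "\<bar>\<dots>\<bar> \<le> \<bar>u x * (v y - v z)\<bar> + \<bar>v x * (u y - u z)\<bar>" by linarith
      also have "\<dots> \<le> 1 * (vis y z / r) + 1 * (vis y z / r)"
        unfolding abs_mult using u v that vis_pos[of y z] r by (intro add_mono mult_mono) auto
      finally show ?thesis by simp
    qed
    obtain C where C: "\<And>x y z W. x \<in> carrier H \<Longrightarrow> y \<in> carrier H \<Longrightarrow> z \<in> carrier H \<Longrightarrow>
       finite W \<Longrightarrow> W \<subseteq> carrier H \<Longrightarrow>
       (\<Sum>g\<in>W. (cyclic_sum F (g \<otimes> x) (g \<otimes> y) (g \<otimes> z))\<^sup>2) \<le> C"
      using cyclic_sum_l2_bounded[of F, OF _ lip supp] by (auto simp: F_def)
    have val: "cyclic_sum F x y z = 1"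
      if "x \<in> carrier H" "y \<in> carrier H" "z \<in> carrier H" "gp a x \<ge> M" "gp b y \<ge> M" "gp c z \<ge> M" for x y z
    proof -
      have "u x = 1" "v y = 1" using u(4) v(4) near that by auto
      moreover have "u y = 0" "u z = 0" using u(5)[of y b] u(5)[of z c] near far that 1 by auto
      moreover have "v x = 0" "v z = 0"
        using v(5)[of x a] v(5)[of z c] near far that 1 gromov_product_sym[of a b \<one>] by auto
      ultimately show ?thesis by (simp add: F_def cyclic_sum_def)
    qed
    show ?case
    proof (intro exI[of _ F] exI[of _ C] conjI ballI impI)
      have "F x y = - F y x" for x y by (simp add: F_def)
      then show "l2_kernel H F C" using bound C unfolding l2_kernel_def by blast
    next
      fix x y z assume "x \<in> carrier H" "y \<in> carrier H" "z \<in> carrier H" "M \<le> gp a x \<and> M \<le> gp b y \<and> M \<le> gp c z"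
      then show "cyclic_sum F x y z = 1" by (intro val) auto
    qed
  qed
qed

end

section \<open>Stabilizers of boundary points\<close>

lemma (in group) virtually_cyclicI:
  assumes g: "g \<in> carrier G" and F: "finite F" "F \<subseteq> carrier G"
    and cover: "\<And>x. x \<in> carrier G \<Longrightarrow> \<exists>n::int. \<exists>f\<in>F. x = g [^] n \<otimes> f"
  shows "virtually_cyclic G"
  unfolding virtually_cyclic_def
proof (intro conjI exI)
  define C where "C = generate G {g}"
  have C: "C = range (\<lambda>n::int. g [^] n)" using generate_pow[OF g] by (auto simp: C_def)
  show sub: "subgroup C G" unfolding C_def using g by (intro generate_is_subgroup) auto
  interpret C: group "G\<lparr>carrier := C\<rparr>" using sub by (rule subgroup.subgroup_is_group) (rule is_group)
  have gC: "g \<in> C" using g by (auto simp: C_def intro: generate.incl)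
  show "cyclic_group (G\<lparr>carrier := C\<rparr>)"
    unfolding C.cyclic_group
  proof (intro bexI[of _ g])
    show "carrier (G\<lparr>carrier := C\<rparr>) = range (\<lambda>n::int. g [^]\<^bsub>G\<lparr>carrier := C\<rparr>\<^esub> n)"
      using C int_pow_consistent[OF sub gC] by simp
  qed (simp add: gC)
  have "rcosets C \<subseteq> (\<lambda>f. C #> f) ` F"
  proof
    fix R assume "R \<in> rcosets C"
    then obtain x where x: "x \<in> carrier G" "R = C #> x" by (auto simp: RCOSETS_def)
    then obtain n :: int and f where f: "f \<in> F" "x = g [^] n \<otimes> f" using cover by blast
    have "g [^] n \<in> C" using C by auto
    then have "C #> (g [^] n) = C" using g sub by (intro coset_join2) auto
    then have "C #> (g [^] n \<otimes> f) = C #> f"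
      using coset_mult_assoc[OF subgroup.subset[OF sub], of "g [^] n" f] F f g by auto
    then show "R \<in> (\<lambda>f. C #> f) ` F" using x f by auto
  qed
  then show "finite (rcosets C)" using F(1) finite_subset by blast
qed (rule is_group)

lemma (in group) virtually_cyclic_if_finite:
  assumes "finite (carrier G)"
  shows "virtually_cyclic G"
proof (rule virtually_cyclicI[of \<one> "carrier G"])
  show "\<exists>n::int. \<exists>f\<in>carrier G. x = \<one> [^] n \<otimes> f" if "x \<in> carrier G" for x
    using that by (intro exI[of _ 0] bexI[of _ x]) auto
qed (use assms in auto)

text \<open>A discrete intermediate value theorem: at the first index where the increasing sequence
  is nonnegative it has overshot 0 by at most one step.\<close>

lemma bounded_somewhere:
  fixes t :: "nat \<Rightarrow> real"
  assumes "t 0 \<le> 0" "c > 0" "\<And>n. c \<le> t (Suc n) - t n" "\<And>n. t (Suc n) - t n \<le> B"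
  shows "\<exists>n. \<bar>t n\<bar> \<le> B"
proof -
  have lower: "t n \<ge> t 0 + n * c" for n
  proof (induction n)
    case (Suc n)
    then show ?case using assms(3)[of n] by (simp add: algebra_simps)
  qed simp
  obtain n :: nat where "real n > - t 0 / c" using reals_Archimedean2 by blast
  then have "t n \<ge> 0" using lower[of n] assms(2) by (simp add: field_simps)
  define m where "m = (LEAST n. t n \<ge> 0)"
  have m: "t m \<ge> 0" unfolding m_def using \<open>t n \<ge> 0\<close> by (rule LeastI)
  have B: "B > 0" using assms(2) assms(3)[of 0] assms(4)[of 0] by linarith
  show ?thesis
  proof (cases m)
    case 0
    then show ?thesis using m assms(1) B by (intro exI[of _ 0]) auto
  next
    case (Suc k)
    then have "t k < 0" using not_less_Least[of k "\<lambda>n. t n \<ge> 0"] by (auto simp: m_def)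
    then show ?thesis using assms(4)[of k] m Suc by (intro exI[of _ m]) auto
  qed
qed

lemma eventually_common_bound:
  fixes f :: "'i \<Rightarrow> nat \<Rightarrow> real"
  assumes "finite S" "\<And>s. s \<in> S \<Longrightarrow> \<exists>D. \<forall>\<^sub>F n in sequentially. f s n \<le> D"
  shows "\<exists>D. \<forall>\<^sub>F n in sequentially. \<forall>s\<in>S. f s n \<le> D"
proof -
  obtain D where D: "\<And>s. s \<in> S \<Longrightarrow> \<forall>\<^sub>F n in sequentially. f s n \<le> D s" using assms(2) by metis
  have le: "D s \<le> (\<Sum>s\<in>S. \<bar>D s\<bar>)" if "s \<in> S" for s
    using member_le_sum[of s S "\<lambda>s. \<bar>D s\<bar>"] that assms(1) by simp
  have "\<forall>\<^sub>F n in sequentially. \<forall>s\<in>S. f s n \<le> D s"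
    using assms(1) D by (simp add: eventually_ball_finite_distrib)
  then show ?thesis using le by (intro exI[of _ "\<Sum>s\<in>S. \<bar>D s\<bar>"]) (force elim!: eventually_mono)
qed

section \<open>Boundary points as sequences, and the Busemann quasimorphism of a stabilizer\<close>

context hyp_group
begin

text \<open>Stands for a boundary point, so that no boundary has to be constructed. The last clause
  provides, at every depth \<open>k\<close>, one point that lies on geodesics from \<one> to almost
  all members of the sequence; this makes the sequence converge at infinity.\<close>

definition geo :: "(nat \<Rightarrow> 'a) \<Rightarrow> bool" where
  "geo l \<longleftrightarrow> (\<forall>n. l n \<in> carrier H) \<and> filterlim (\<lambda>n. len (l n)) at_top sequentially \<and>
     (\<forall>k::nat. \<exists>p\<in>carrier H. len p = k \<and> (\<forall>\<^sub>F n in sequentially. d p (l n) = len (l n) - k))"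

text \<open>\<open>g\<close> fixes the boundary point of \<open>l\<close>: the sequence and its
  translate have the same limit.\<close>

definition stabilizes :: "(nat \<Rightarrow> 'a) \<Rightarrow> 'a \<Rightarrow> bool" where
  "stabilizes l g \<longleftrightarrow> filterlim (\<lambda>n. gp (g \<otimes> l n) (l n)) at_top sequentially"

lemma geoD: "geo l \<Longrightarrow> l n \<in> carrier H" by (simp add: geo_def)

text \<open>Compactness of the boundary. Along a diagonal subsequence it is eventually decided, for
  each p, whether p lies on a geodesic from \<one> to \<open>l n\<close>. Every \<open>l n\<close>
  that is long enough has such a point at distance \<open>k\<close>, and spheres are finite, so some
  point of the sphere is eventually always on a geodesic.\<close>

lemma geo_subseq:
  assumes l: "\<And>n. l n \<in> carrier H" "filterlim (\<lambda>n. len (l n)) at_top sequentially"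
  obtains r where "strict_mono (r :: nat \<Rightarrow> nat)" "geo (l \<circ> r)"
proof -
  \<comment> \<open>A 0/1 indicator: its convergence means that it is eventually constant, so a
    selection theorem for bounded functions decides a property of each \<open>p\<close>.\<close>
  define f where "f n p = (of_bool (d p (l n) = len (l n) - len p) :: real)" for n p
  obtain r where r: "strict_mono (r :: nat \<Rightarrow> nat)" "\<And>p. p \<in> carrier H \<Longrightarrow> \<exists>x. (\<lambda>n. f (r n) p) \<longlonglongrightarrow> x"
    using function_convergent_subsequence[OF countable_carrier, of f 1] by (auto simp: f_def)
  have inf: "filterlim (\<lambda>n. len (l (r n))) at_top sequentially"
    using filterlim_compose[OF l(2) filterlim_subseq[OF r(1)]] .
  have dich: "(\<forall>\<^sub>F n in sequentially. f (r n) p = 1) \<or> (\<forall>\<^sub>F n in sequentially. f (r n) p = 0)"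
    if "p \<in> carrier H" for p
  proof -
    obtain x where x: "(\<lambda>n. f (r n) p) \<longlonglongrightarrow> x" using r(2)[OF \<open>p \<in> _\<close>] by blast
    show ?thesis
    proof (cases "x = 0")
      case True
      then have "\<forall>\<^sub>F n in sequentially. \<bar>f (r n) p\<bar> < 1"
        using tendstoD[OF x, of 1] by (simp add: dist_real_def)
      then show ?thesis by (intro disjI2) (auto simp: f_def elim!: eventually_mono)
    next
      case False
      then have "\<forall>\<^sub>F n in sequentially. f (r n) p \<noteq> 0" using tendsto_imp_eventually_ne[OF x] by blast
      then show ?thesis by (intro disjI1) (auto simp: f_def elim!: eventually_mono)
    qed
  qed
  have "\<exists>p\<in>carrier H. len p = k \<and> (\<forall>\<^sub>F n in sequentially. d p (l (r n)) = len (l (r n)) - k)" for k :: nat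
  proof (rule ccontr)
    assume no: "\<not> ?thesis"
    have "\<forall>\<^sub>F n in sequentially. f (r n) p = 0" if "p \<in> {p \<in> carrier H. len p = k}" for p
      using dich[of p] that no by (auto simp: f_def elim!: eventually_mono)
    moreover have "finite {p \<in> carrier H. len p = k}"
      by (rule finite_subset[OF _ finite_ball[of k]]) auto
    ultimately have "\<forall>\<^sub>F n in sequentially. \<forall>p\<in>{p \<in> carrier H. len p = k}. f (r n) p = 0"
      by (intro eventually_ball_finite) blast+
    moreover have "\<forall>\<^sub>F n in sequentially. len (l (r n)) \<ge> k"
      using inf by (simp add: filterlim_at_top)
    ultimately have "\<forall>\<^sub>F n in sequentially. False"
    proof eventually_elim
      case (elim n)
      obtain p where "p \<in> carrier H" "len p = k" "d p (l (r n)) = len (l (r n)) - k"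
        using obtain_prefix[OF l(1) elim(2)] .
      then show False using elim(1) by (auto simp: f_def)
    qed
    then show False by simp
  qed
  then show thesis using that[OF r(1)] inf l(1) by (simp add: geo_def)
qed

lemma geo_compose:
  assumes "geo l" "strict_mono (r :: nat \<Rightarrow> nat)"
  shows "geo (l \<circ> r)"
proof -
  note sub = filterlim_subseq[OF assms(2)]
  show ?thesis
    using assms(1) filterlim_compose[OF _ sub] eventually_compose_filterlim[OF _ sub]
    unfolding geo_def comp_def by blast
qed

lemma geo_gp:
  assumes "geo l"
  shows "\<exists>N. \<forall>n\<ge>N. \<forall>m\<ge>N. gp (l n) (l m) \<ge> K"
proof -
  define k where "k = nat \<lceil>K\<rceil>"
  obtain p where p: "p \<in> carrier H" "len p = k" "\<forall>\<^sub>F n in sequentially. d p (l n) = len (l n) - k"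
    using assms by (auto simp: geo_def)
  then obtain N where N: "\<And>n. n \<ge> N \<Longrightarrow> d p (l n) = len (l n) - k" by (auto simp: eventually_sequentially)
  have "gp (l n) (l m) \<ge> K" if "n \<ge> N" "m \<ge> N" for n m
  proof -
    have "d (l n) (l m) \<le> d p (l n) + d p (l m)"
      using d_triangle[of "l n" p "l m"] d_sym[of p "l n"] p(1) geoD[OF assms] by simp
    then have "gp (l n) (l m) \<ge> k"
      using N that gp_eq[of "l n" "l m"] geoD[OF assms] by simp
    then show ?thesis unfolding k_def by linarith
  qed
  then show ?thesis by blast
qed

lemma len_mult_left:
  assumes "g \<in> carrier H" "x \<in> carrier H"
  shows "len (g \<otimes> x) - len x = len g - 2 * gp (inv g) x"
  using gp_eq[of "inv g" x] assms by (simp add: d_eq)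

text \<open>The increment of length is \<open>len g - 2 * gp (inv g) x\<close>, and this product
  cannot exceed \<open>len g\<close>. So \<open>x\<close> matters only to the depth
  \<open>len g\<close>, up to \<delta>.\<close>

lemma busemann_shift:
  assumes c: "g \<in> carrier H" "x \<in> carrier H" "y \<in> carrier H" and xy: "gp x y \<ge> len g"
  shows "\<bar>(len (g \<otimes> x) - len x) - (len (g \<otimes> y) - len y)\<bar> \<le> 2 * \<delta>"
proof -
  have "gp (inv g) x \<le> len g" "gp (inv g) y \<le> len g"
    using gp_le_len[of "inv g" x] gp_le_len[of "inv g" y] c by auto
  moreover have "gp (inv g) y \<ge> min (gp (inv g) x) (gp x y) - \<delta>"
    "gp (inv g) x \<ge> min (gp (inv g) y) (gp x y) - \<delta>"
    using four_point[of \<one> "inv g" x y] four_point[of \<one> "inv g" y x] gromov_product_sym[of y x \<one>] c by auto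
  ultimately have "\<bar>gp (inv g) x - gp (inv g) y\<bar> \<le> \<delta>" using xy by linarith
  then show ?thesis using len_mult_left[of g x] len_mult_left[of g y] c by linarith
qed

text \<open>Far out on a geodesic towards a boundary point, an isometry fixing that point
  moves by its Busemann value only, independently of its length.\<close>

lemma displacement:
  assumes c: "g \<in> carrier H" "p \<in> carrier H" "x \<in> carrier H"
    and p: "d p x = len x - len p" and far: "len p \<ge> len g + \<delta> + 1"
    and stab: "gp (g \<otimes> x) x \<ge> len p + len g"
  shows "d p (g \<otimes> p) \<le> \<bar>len (g \<otimes> x) - len x\<bar> + 6 * \<delta>"
proof -
  define b where "b = len (g \<otimes> x) - len x"
  let ?gp = "gromov_product d (g \<otimes> p)"
  have dist: "d g (g \<otimes> p) = len p" "d (g \<otimes> x) (g \<otimes> p) = len x - len p" "d g (g \<otimes> x) = len x"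
    "d (g \<otimes> p) (g \<otimes> x) = len x - len p"
    using d_mult[of g \<one> p] d_mult[of g x p] d_mult[of g \<one> x] c p d_sym[of p x] by (auto simp: d_mult)
  have lg: "len (g \<otimes> p) \<ge> len p - len g" "\<bar>b\<bar> \<le> len g"
    using len_mult[of "inv g" "g \<otimes> p"] len_mult[of "inv g" "g \<otimes> x"] len_mult[of g x] c by (auto simp: b_def)
  have "?gp g (g \<otimes> x) = 0" using gromov_product_eq[of "g \<otimes> p" g "g \<otimes> x"] dist by simp
  moreover have "?gp g \<one> \<ge> len p - len g"
    using gromov_product_eq[of "g \<otimes> p" g \<one>] dist c lg by simp
  \<comment> \<open>Seen from \<open>g \<otimes> p\<close>, the points \<open>g\<close> and \<one>
    lie in one direction because \<open>p\<close> is far out, while \<open>g\<close> and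
    \<open>g \<otimes> x\<close> lie in opposite ones. Hence \<open>g \<otimes> p\<close> is almost
    on a geodesic from \<one> to \<open>g \<otimes> x\<close>.\<close>
  ultimately have "?gp \<one> (g \<otimes> x) \<le> \<delta>"
    using four_point[of "g \<otimes> p" g \<one> "g \<otimes> x"] c far by auto
  then have up: "len (g \<otimes> p) \<le> len p + b + 2 * \<delta>"
    using gromov_product_eq[of "g \<otimes> p" \<one> "g \<otimes> x"] dist c by (simp add: b_def)
  have lo: "len (g \<otimes> p) \<ge> len p + b"
    using d_triangle[of \<one> "g \<otimes> p" "g \<otimes> x"] dist c by (simp add: b_def)
  have "gp p x = len p" using gp_eq[of p x] p c by simp
  moreover have "gp (g \<otimes> p) (g \<otimes> x) \<ge> len p + b"
    using gp_eq[of "g \<otimes> p" "g \<otimes> x"] dist c lo by (simp add: b_def)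
  moreover have "gp p (g \<otimes> p) \<ge> min (gp p x) (gp x (g \<otimes> p)) - \<delta>"
    "gp x (g \<otimes> p) \<ge> min (gp x (g \<otimes> x)) (gp (g \<otimes> x) (g \<otimes> p)) - \<delta>"
    using four_point[of \<one>] c by auto
  ultimately have "gp p (g \<otimes> p) \<ge> len p + min 0 b - 2 * \<delta>"
    using stab gromov_product_sym[of x "g \<otimes> x" \<one>] gromov_product_sym[of "g \<otimes> p" "g \<otimes> x" \<one>] c \<delta> lg by auto
  then show ?thesis using up gp_eq[of p "g \<otimes> p"] c unfolding b_def[symmetric] by auto
qed

text \<open>All of \<open>A\<close> is tested at one point \<open>p\<close>, taken so far out that
  the displacement estimate holds for every element of \<open>A\<close>. Conjugation by
  \<open>p\<close> then embeds \<open>A\<close> into a ball whose radius depends neither on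
  \<open>p\<close> nor on the lengths of the elements.\<close>

lemma card_stabilizer_le:
  assumes l: "geo l" and A: "finite A" "A \<subseteq> carrier H" "\<And>g. g \<in> A \<Longrightarrow> stabilizes l g"
    and K: "\<And>g. g \<in> A \<Longrightarrow> \<forall>\<^sub>F n in sequentially. \<bar>len (g \<otimes> l n) - len (l n)\<bar> \<le> K"
  shows "card A \<le> card {g \<in> carrier H. len g \<le> K + 6 * \<delta>}"
proof -
  define k where "k = nat \<lceil>(\<Sum>g\<in>A. len g) + \<delta> + 1\<rceil>"
  have k: "real k \<ge> len g + \<delta> + 1" if "g \<in> A" for g
    using member_le_sum[of g A len] A(1) that unfolding k_def by simp linarith
  obtain p where p: "p \<in> carrier H" "len p = k" "\<forall>\<^sub>F n in sequentially. d p (l n) = len (l n) - k"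
    using l by (auto simp: geo_def)
  have "\<forall>\<^sub>F n in sequentially. \<forall>g\<in>A. \<bar>len (g \<otimes> l n) - len (l n)\<bar> \<le> K"
    using A(1) K by (simp add: eventually_ball_finite_distrib)
  moreover have "\<forall>\<^sub>F n in sequentially. \<forall>g\<in>A. gp (g \<otimes> l n) (l n) \<ge> k + len g"
    using A(1,3) by (auto simp: eventually_ball_finite_distrib stabilizes_def filterlim_at_top)
  ultimately have "\<forall>\<^sub>F n in sequentially. \<forall>g\<in>A. d p (g \<otimes> p) \<le> K + 6 * \<delta>"
    using p(3)
  proof eventually_elim
    case (elim n)
    show ?case
    proof
      fix g assume g: "g \<in> A"
      have "d p (g \<otimes> p) \<le> \<bar>len (g \<otimes> l n) - len (l n)\<bar> + 6 * \<delta>"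
        using elim p k[OF g] g A(2) geoD[OF l, of n] by (intro displacement) auto
      then show "d p (g \<otimes> p) \<le> K + 6 * \<delta>" using elim(1) g by fastforce
    qed
  qed
  then have "\<forall>g\<in>A. d p (g \<otimes> p) \<le> K + 6 * \<delta>" by simp
  then have "(\<lambda>g. inv p \<otimes> (g \<otimes> p)) ` A \<subseteq> {g \<in> carrier H. len g \<le> K + 6 * \<delta>}"
    using p(1) A(2) by (auto simp: d_eq)
  then have "card ((\<lambda>g. inv p \<otimes> (g \<otimes> p)) ` A) \<le> card {g \<in> carrier H. len g \<le> K + 6 * \<delta>}"
    by (intro card_mono finite_ball)
  moreover have "inj_on (\<lambda>g. inv p \<otimes> (g \<otimes> p)) A"
  proof (rule inj_onI)
    fix g h assume "g \<in> A" "h \<in> A" "inv p \<otimes> (g \<otimes> p) = inv p \<otimes> (h \<otimes> p)"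
    then show "g = h" using p(1) A(2) by (simp add: subset_iff)
  qed
  ultimately show ?thesis by (simp add: card_image)
qed

text \<open>The Busemann value of \<open>g\<close> at the boundary point of \<open>l\<close>. The
  differences of lengths need not converge and settle only up to 2 \<delta>, so a value in that
  range is picked.\<close>

definition bus :: "(nat \<Rightarrow> 'a) \<Rightarrow> 'a \<Rightarrow> real" where
  "bus l g = (SOME \<beta>. \<forall>\<^sub>F n in sequentially. \<bar>len (g \<otimes> l n) - len (l n) - \<beta>\<bar> \<le> 2 * \<delta>)"

lemma bus:
  assumes l: "geo l" and g: "g \<in> carrier H"
  shows "\<forall>\<^sub>F n in sequentially. \<bar>len (g \<otimes> l n) - len (l n) - bus l g\<bar> \<le> 2 * \<delta>"
  unfolding bus_def
proof (rule someI_ex)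
  obtain N where N: "\<forall>n\<ge>N. \<forall>m\<ge>N. gp (l n) (l m) \<ge> len g" using geo_gp[OF l] by blast
  have "\<forall>\<^sub>F n in sequentially. \<bar>len (g \<otimes> l n) - len (l n) - (len (g \<otimes> l N) - len (l N))\<bar> \<le> 2 * \<delta>"
    using eventually_ge_at_top[of N]
  proof eventually_elim
    case (elim n)
    then show ?case using N g geoD[OF l] by (intro busemann_shift) auto
  qed
  then show "\<exists>\<beta>. \<forall>\<^sub>F n in sequentially. \<bar>len (g \<otimes> l n) - len (l n) - \<beta>\<bar> \<le> 2 * \<delta>" by blast
qed

text \<open>Passing from \<open>l n\<close> to \<open>g \<otimes> h \<otimes> l n\<close> by way of
  \<open>h \<otimes> l n\<close> splits the increment of length. As \<open>h\<close> fixes the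
  boundary point, the increment under \<open>g\<close> is the same at \<open>h \<otimes> l n\<close>
  as at \<open>l n\<close>, up to 2 \<delta>; the three Busemann values add 2 \<delta> each.\<close>

lemma bus_quasimorphism:
  assumes l: "geo l" and g: "g \<in> carrier H" and h: "h \<in> carrier H" "stabilizes l h"
  shows "\<bar>bus l (g \<otimes> h) - bus l g - bus l h\<bar> \<le> 8 * \<delta>"
proof -
  have "\<forall>\<^sub>F n in sequentially. gp (h \<otimes> l n) (l n) \<ge> len g"
    using h(2) by (simp add: stabilizes_def filterlim_at_top)
  then have "\<forall>\<^sub>F n in sequentially. \<bar>bus l (g \<otimes> h) - bus l g - bus l h\<bar> \<le> 8 * \<delta>"
    using bus[OF l g] bus[OF l h(1)] bus[OF l m_closed[OF g h(1)]]
  proof eventually_elim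
    case (elim n)
    have "\<bar>(len (g \<otimes> (h \<otimes> l n)) - len (h \<otimes> l n)) - (len (g \<otimes> l n) - len (l n))\<bar> \<le> 2 * \<delta>"
      using elim(1) g h geoD[OF l, of n] by (intro busemann_shift) auto
    then have "\<bar>(len (g \<otimes> h \<otimes> l n) - len (h \<otimes> l n)) - (len (g \<otimes> l n) - len (l n))\<bar> \<le> 2 * \<delta>"
      using g h geoD[OF l, of n] by (simp add: m_assoc)
    then show ?case using elim(2-4) by linarith
  qed
  then show ?thesis by simp
qed

text \<open>The cardinality bound is the same for all finite subsets, hence holds for the whole set.
  The Busemann quasimorphism therefore has finite fibres on a coarse scale.\<close>

lemma finite_small_bus:
  assumes l: "geo l"
  shows "finite {g \<in> carrier H. stabilizes l g \<and> \<bar>bus l g\<bar> \<le> K}"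
proof -
  have "card A \<le> card {g \<in> carrier H. len g \<le> (K + 2 * \<delta>) + 6 * \<delta>}"
    if "A \<subseteq> {g \<in> carrier H. stabilizes l g \<and> \<bar>bus l g\<bar> \<le> K}" "finite A" for A
  proof (rule card_stabilizer_le[OF l that(2)])
    fix g assume "g \<in> A"
    then have "g \<in> carrier H" "\<bar>bus l g\<bar> \<le> K" using that by auto
    then show "\<forall>\<^sub>F n in sequentially. \<bar>len (g \<otimes> l n) - len (l n)\<bar> \<le> K + 2 * \<delta>"
      by (intro eventually_mono[OF bus[OF l, of g]]) auto
  qed (use that in auto)
  then show ?thesis using finite_if_finite_subsets_card_bdd by blast
qed

lemma stabilizes_mult:
  assumes l: "geo l" and g: "g \<in> carrier H" "stabilizes l g" and h: "h \<in> carrier H" "stabilizes l h"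
  shows "stabilizes l (g \<otimes> h)"
  unfolding stabilizes_def filterlim_at_top
proof
  fix Z
  have "\<forall>\<^sub>F n in sequentially. gp (g \<otimes> l n) (l n) \<ge> Z + \<delta>"
    "\<forall>\<^sub>F n in sequentially. gp (h \<otimes> l n) (l n) \<ge> Z + \<delta> + len g"
    using g(2) h(2) unfolding stabilizes_def filterlim_at_top by blast+
  then show "\<forall>\<^sub>F n in sequentially. Z \<le> gp (g \<otimes> h \<otimes> l n) (l n)"
  proof eventually_elim
    case (elim n)
    have c: "l n \<in> carrier H" using geoD[OF l] .
    then show ?case
      using elim four_point[of \<one> "g \<otimes> h \<otimes> l n" "g \<otimes> l n" "l n"] gp_translate(2)[of g "h \<otimes> l n" "l n"] g h
      by (simp add: m_assoc)
  qed
qed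

lemma stabilizes_inv:
  assumes l: "geo l" and g: "g \<in> carrier H" "stabilizes l g"
  shows "stabilizes l (inv g)"
  unfolding stabilizes_def filterlim_at_top
proof
  fix Z
  have "\<forall>\<^sub>F n in sequentially. gp (g \<otimes> l n) (l n) \<ge> Z + len g"
    using g(2) unfolding stabilizes_def filterlim_at_top by blast
  then show "\<forall>\<^sub>F n in sequentially. Z \<le> gp (inv g \<otimes> l n) (l n)"
  proof eventually_elim
    case (elim n)
    have c: "l n \<in> carrier H" using geoD[OF l] .
    have "gp (inv g \<otimes> l n) (inv g \<otimes> (g \<otimes> l n)) \<ge> gp (l n) (g \<otimes> l n) - len (inv g)"
      using c g by (intro gp_translate) auto
    then show ?case using elim c g gromov_product_sym[of "l n" "g \<otimes> l n" \<one>] by simp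
  qed
qed

lemma stabilizes_one:
  assumes "geo l"
  shows "stabilizes l \<one>"
proof -
  have "gp (\<one> \<otimes> l n) (l n) = len (l n)" for n
    using gp_eq[of "l n" "l n"] geoD[OF assms, of n] by simp
  then show ?thesis using assms by (simp add: stabilizes_def geo_def)
qed


text \<open>Each further factor \<open>g\<close> changes the Busemann value by
  \<open>bus l g\<close> up to 8 \<delta>, which is less than \<open>bus l g\<close> in size. The
  values thus drift in one direction by bounded steps and visit a window around 0; multiplying by
  the sign makes the drift upward.\<close>

lemma int_power_translate:
  assumes l: "geo l" and y: "y \<in> carrier H" and g: "g \<in> carrier H" "stabilizes l g" "\<bar>bus l g\<bar> > 8 * \<delta>"
  shows "\<exists>n::int. \<bar>bus l (y \<otimes> g [^] n)\<bar> \<le> \<bar>bus l g\<bar> + 8 * \<delta>"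
proof -
  define s where "s n = sgn (bus l g) * bus l (y \<otimes> g [^] n)" for n :: int
  have step: "\<bar>s (n + 1) - s n - \<bar>bus l g\<bar>\<bar> \<le> 8 * \<delta>" for n
  proof -
    have "y \<otimes> g [^] (n + 1) = (y \<otimes> g [^] n) \<otimes> g" using y g by (simp add: int_pow_mult m_assoc)
    then have "\<bar>bus l (y \<otimes> g [^] (n + 1)) - bus l (y \<otimes> g [^] n) - bus l g\<bar> \<le> 8 * \<delta>"
      using bus_quasimorphism[OF l _ g(1,2), of "y \<otimes> g [^] n"] y g by simp
    moreover have "bus l g > 0 \<or> bus l g < 0" using g(3) \<delta> by linarith
    ultimately show ?thesis by (auto simp: s_def sgn_if)
  qed
  have "\<exists>n. \<bar>s n\<bar> \<le> \<bar>bus l g\<bar> + 8 * \<delta>"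
  proof (cases "s 0 \<le> 0")
    case True
    have "\<exists>n. \<bar>s (int n)\<bar> \<le> \<bar>bus l g\<bar> + 8 * \<delta>"
    proof (rule bounded_somewhere[of "\<lambda>n. s (int n)" "\<bar>bus l g\<bar> - 8 * \<delta>"])
      fix n show "\<bar>bus l g\<bar> - 8 * \<delta> \<le> s (int (Suc n)) - s (int n)"
        "s (int (Suc n)) - s (int n) \<le> \<bar>bus l g\<bar> + 8 * \<delta>"
        using step[of "int n"] by (simp_all add: add.commute[of 1] abs_le_iff)
    qed (use True g(3) in auto)
    then show ?thesis by blast
  next
    case False
    have st: "\<bar>- s (- int (Suc n)) - - s (- int n) - \<bar>bus l g\<bar>\<bar> \<le> 8 * \<delta>" for n
      using step[of "- int (Suc n)"] by simp
    have "\<exists>n. \<bar>- s (- int n)\<bar> \<le> \<bar>bus l g\<bar> + 8 * \<delta>"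
    proof (rule bounded_somewhere[of "\<lambda>n. - s (- int n)" "\<bar>bus l g\<bar> - 8 * \<delta>"])
      fix n show "\<bar>bus l g\<bar> - 8 * \<delta> \<le> - s (- int (Suc n)) - - s (- int n)"
        "- s (- int (Suc n)) - - s (- int n) \<le> \<bar>bus l g\<bar> + 8 * \<delta>"
        using st[of n] by linarith+
    qed (use False g(3) in auto)
    then show ?thesis by (metis abs_minus_cancel)
  qed
  then obtain n where n: "\<bar>s n\<bar> \<le> \<bar>bus l g\<bar> + 8 * \<delta>" by blast
  have "\<bar>s n\<bar> = \<bar>bus l (y \<otimes> g [^] n)\<bar>"
    using g(3) \<delta> by (auto simp: s_def abs_mult sgn_if)
  then show ?thesis using n by auto
qed

text \<open>Inside \<open>L\<close>, multiplying a stabilizing element by a power of one fixed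
  \<open>g\<close> brings its Busemann value into a bounded window, where only finitely many
  stabilizing elements live. If no element has a value beyond 8 \<delta>, this holds already with
  \<open>g\<close> = \<one>. The finite set \<open>A\<close> of coset representatives extends this
  to all of \<open>L\<close>.\<close>

lemma virtually_cyclic_if_stabilizer_finite_index:
  assumes L: "subgroup L H" and l: "geo l" and A: "finite A" "A \<subseteq> L"
    and cover: "\<And>x. x \<in> L \<Longrightarrow> \<exists>a\<in>A. stabilizes l (inv a \<otimes> x)"
  shows "virtually_cyclic (H\<lparr>carrier := L\<rparr>)"
proof -
  interpret L: subgroup L H by fact
  interpret K: group "H\<lparr>carrier := L\<rparr>" by (rule L.subgroup_is_group) (rule is_group)
  have LH: "x \<in> carrier H" if "x \<in> L" for x using that L.subset by blast
  have "\<exists>g\<in>L. \<exists>B. \<forall>y\<in>L. stabilizes l y \<longrightarrow> (\<exists>n::int. stabilizes l (y \<otimes> g [^] n) \<and> \<bar>bus l (y \<otimes> g [^] n)\<bar> \<le> B)"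
  proof (cases "\<exists>g\<in>L. stabilizes l g \<and> \<bar>bus l g\<bar> > 8 * \<delta>")
    case True
    then obtain g where g: "g \<in> L" "stabilizes l g" "\<bar>bus l g\<bar> > 8 * \<delta>" by blast
    have pow_nat: "stabilizes l (g [^] k)" for k :: nat
      using g LH by (induction k) (auto intro: stabilizes_mult[OF l] stabilizes_one[OF l])
    have pow: "stabilizes l (g [^] n)" for n :: int
      using pow_nat stabilizes_inv[OF l] g LH by (cases n rule: int_cases2) (auto simp: int_pow_neg int_pow_int)
    show ?thesis
      using int_power_translate[OF l LH LH[OF g(1)] g(2,3)] stabilizes_mult[OF l LH _ _ pow] g LH
      by (intro bexI[OF _ g(1)] exI[of _ "\<bar>bus l g\<bar> + 8 * \<delta>"]) (meson int_pow_closed)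
  next
    case False
    then show ?thesis
      using LH by (intro bexI[of _ \<one>] exI[of _ "8 * \<delta>"]) (auto simp: not_less int_pow_one)
  qed
  then obtain g B where g: "g \<in> L" and B: "\<And>y. y \<in> L \<Longrightarrow> stabilizes l y \<Longrightarrow>
      \<exists>n::int. stabilizes l (y \<otimes> g [^] n) \<and> \<bar>bus l (y \<otimes> g [^] n)\<bar> \<le> B" by blast
  define E where "E = {y \<in> L. stabilizes l y \<and> \<bar>bus l y\<bar> \<le> B}"
  have E: "finite E" by (rule finite_subset[OF _ finite_small_bus[OF l, of B]]) (auto simp: E_def LH)
  define F where "F = (\<lambda>(a, f). inv (a \<otimes> f)) ` (A \<times> E)"
  show ?thesis
  proof (rule K.virtually_cyclicI[of g F])
    show "finite F" using A E by (auto simp: F_def)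
    show "F \<subseteq> carrier (H\<lparr>carrier := L\<rparr>)" using A by (auto simp: F_def E_def)
    fix x assume "x \<in> carrier (H\<lparr>carrier := L\<rparr>)"
    then have x: "x \<in> L" by simp
    \<comment> \<open>The cover is by left cosets of the stabilizer, while the power of
      \<open>g\<close> is to stand on the left of a finite set; working with \<open>inv x\<close>
      exchanges the sides.\<close>
    then obtain a where a: "a \<in> A" "stabilizes l (inv a \<otimes> inv x)" using cover[of "inv x"] by auto
    define y where "y = inv a \<otimes> inv x"
    have y: "y \<in> L" using a A x by (auto simp: y_def)
    obtain n :: int where n: "stabilizes l (y \<otimes> g [^] n)" "\<bar>bus l (y \<otimes> g [^] n)\<bar> \<le> B"
      using B[OF y] a by (auto simp: y_def)
    define f where "f = y \<otimes> g [^] n"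
    have gn: "g [^] n \<in> L" using subgroup_int_pow_closed[OF L g] .
    have f: "f \<in> E" using n y gn by (auto simp: f_def E_def)
    have aL: "a \<in> L" using a A by auto
    have "a \<otimes> f = inv x \<otimes> g [^] n"
      using aL x g gn LH by (simp add: f_def y_def m_assoc)
    then have "inv (a \<otimes> f) = inv (g [^] n) \<otimes> x" using x gn LH by (simp add: inv_mult_group)
    then have "x = g [^] n \<otimes> inv (a \<otimes> f)" using x gn LH by simp
    moreover have "inv (a \<otimes> f) \<in> F" using a f by (auto simp: F_def)
    moreover have "g [^]\<^bsub>H\<lparr>carrier := L\<rparr>\<^esub> n = g [^] n" using int_pow_consistent[OF L g] by simp
    ultimately show "\<exists>n::int. \<exists>f\<in>F. x = g [^]\<^bsub>H\<lparr>carrier := L\<rparr>\<^esub> n \<otimes>\<^bsub>H\<lparr>carrier := L\<rparr>\<^esub> f"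
      by (intro exI[of _ n] bexI[of _ "inv (a \<otimes> f)"]) auto
  qed (simp add: g)
qed

text \<open>Greedy choice: if no further element could be added, finitely many cosets of the
  stabilizer would cover \<open>L\<close>, which would then be virtually cyclic.\<close>

lemma distinct_directions:
  fixes J :: nat
  assumes L: "subgroup L H" and nve: "\<not> virtually_cyclic (H\<lparr>carrier := L\<rparr>)" and l: "geo l"
  shows "\<exists>a. \<forall>j<J. a j \<in> L \<and> (\<forall>i<j. \<not> stabilizes l (inv (a i) \<otimes> a j))"
proof (induction J)
  case (Suc J)
  then obtain a where a: "\<forall>j<J. a j \<in> L \<and> (\<forall>i<j. \<not> stabilizes l (inv (a i) \<otimes> a j))" by blast
  then have "a ` {..<J} \<subseteq> L" by auto
  then have "\<not> (\<forall>x\<in>L. \<exists>b\<in>a ` {..<J}. stabilizes l (inv b \<otimes> x))"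
    using virtually_cyclic_if_stabilizer_finite_index[OF L l, of "a ` {..<J}"] nve by blast
  then obtain x where x: "x \<in> L" "\<forall>b\<in>a ` {..<J}. \<not> stabilizes l (inv b \<otimes> x)" by blast
  show ?case
    using a x by (intro exI[of _ "a(J := x)"]) (auto simp: less_Suc_eq)
qed simp

text \<open>Failure to diverge gives a small product at arbitrarily late indices only. One late
  index \<open>m\<close> is enough: a large product at another late n would carry over to
  \<open>m\<close>, because the sequence agrees to great depth at n and \<open>m\<close>.\<close>

lemma not_stabilizes_bounded:
  assumes l: "geo l" and g: "g \<in> carrier H" "\<not> stabilizes l g"
  shows "\<exists>D. \<forall>\<^sub>F n in sequentially. gp (g \<otimes> l n) (l n) \<le> D"
proof -
  obtain K where K: "\<exists>\<^sub>F n in sequentially. gp (g \<otimes> l n) (l n) < K"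
    using g(2) by (auto simp: stabilizes_def filterlim_at_top not_eventually not_le)
  obtain N where N: "\<forall>n\<ge>N. \<forall>m\<ge>N. gp (l n) (l m) \<ge> K + 2 * \<delta> + 1 + len g" using geo_gp[OF l] by blast
  obtain m where m: "m \<ge> N" "gp (g \<otimes> l m) (l m) < K"
    using frequently_ex[OF frequently_eventually_conj[OF K eventually_ge_at_top[of N]]] by blast
  have "gp (g \<otimes> l n) (l n) \<le> K + 2 * \<delta>" if n: "n \<ge> N" for n
  proof (rule ccontr)
    assume "\<not> ?thesis"
    then have 1: "gp (g \<otimes> l n) (l n) > K + 2 * \<delta>" by simp
    have c: "l n \<in> carrier H" "l m \<in> carrier H" using geoD[OF l] by auto
    have "gp (l n) (l m) \<ge> K + 2 * \<delta> + 1 + len g" "gp (l m) (l n) \<ge> K + 2 * \<delta> + 1 + len g"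
      using N n m by auto
    then have 2: "gp (l n) (l m) \<ge> K + 2 * \<delta> + 1" "gp (g \<otimes> l m) (g \<otimes> l n) \<ge> K + 2 * \<delta> + 1"
      using gp_translate(2)[of g "l m" "l n"] c g len_nonneg[of g] by linarith+
    have 3: "gp (g \<otimes> l m) (l m) \<ge> min (gp (g \<otimes> l m) (g \<otimes> l n)) (gp (g \<otimes> l n) (l m)) - \<delta>"
      "gp (g \<otimes> l n) (l m) \<ge> min (gp (g \<otimes> l n) (l n)) (gp (l n) (l m)) - \<delta>"
      using four_point[of \<one>] c g by auto
    have "gp (g \<otimes> l n) (l m) > K + \<delta>" using 3(2) 1 2(1) \<delta> by linarith
    then have "gp (g \<otimes> l m) (l m) > K" using 3(1) 2(2) \<delta> by linarith
    then show False using m by simp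
  qed
  then show ?thesis by (auto simp: eventually_sequentially)
qed

text \<open>The right factors move the points by bounded distances. Up to \<open>len (a i)\<close>,
  what is left is the product of \<open>inv (a i) \<otimes> a j \<otimes> l n\<close> with
  \<open>l n\<close>, bounded because the quotient moves the boundary point.\<close>

lemma translated_directions_bounded:
  fixes J :: nat
  assumes l: "geo l" and a: "\<And>j. j < J \<Longrightarrow> a j \<in> carrier H" and b: "\<And>j. j < J \<Longrightarrow> b j \<in> carrier H"
    and ns: "\<And>i j. i < j \<Longrightarrow> j < J \<Longrightarrow> \<not> stabilizes l (inv (a i) \<otimes> a j)"
  shows "\<exists>D. \<forall>\<^sub>F n in sequentially. \<forall>i<J. \<forall>j<J. i \<noteq> j \<longrightarrow> gp (a i \<otimes> l n \<otimes> b i) (a j \<otimes> l n \<otimes> b j) \<le> D"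
proof -
  let ?S = "{(i, j). i < j \<and> j < J}"
  have fin: "finite ?S" by (rule finite_subset[of _ "{..<J} \<times> {..<J}"]) auto
  have "\<exists>D. \<forall>\<^sub>F n in sequentially. \<forall>s\<in>?S. gp (a (fst s) \<otimes> l n \<otimes> b (fst s)) (a (snd s) \<otimes> l n \<otimes> b (snd s)) \<le> D"
  proof (rule eventually_common_bound[OF fin])
    fix s assume "s \<in> ?S"
    then obtain i j where s: "s = (i, j)" "i < j" "j < J" by auto
    have c: "a i \<in> carrier H" "a j \<in> carrier H" "b i \<in> carrier H" "b j \<in> carrier H" using a b s by auto
    obtain D where D: "\<forall>\<^sub>F n in sequentially. gp (inv (a i) \<otimes> a j \<otimes> l n) (l n) \<le> D"
      using not_stabilizes_bounded[OF l _ ns[OF s(2,3)]] c by auto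
    have "\<forall>\<^sub>F n in sequentially. gp (a i \<otimes> l n \<otimes> b i) (a j \<otimes> l n \<otimes> b j) \<le> D + len (a i) + len (b i) + len (b j)"
      using D
    proof eventually_elim
      case (elim n)
      have ln: "l n \<in> carrier H" using geoD[OF l] .
      have "gp (a i \<otimes> l n \<otimes> b i) (a j \<otimes> l n \<otimes> b j) \<le> gp (a i \<otimes> l n) (a j \<otimes> l n \<otimes> b j) + len (b i)"
        using c ln by (intro gp_mult_right) auto
      also have "gp (a i \<otimes> l n) (a j \<otimes> l n \<otimes> b j) \<le> gp (a j \<otimes> l n) (a i \<otimes> l n) + len (b j)"
        using gp_mult_right[of "a j \<otimes> l n" "b j" "a i \<otimes> l n"] c ln
          gromov_product_sym[of "a i \<otimes> l n" "a j \<otimes> l n \<otimes> b j" \<one>] by simp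
      also have "gp (a j \<otimes> l n) (a i \<otimes> l n) \<le> gp (inv (a i) \<otimes> a j \<otimes> l n) (l n) + len (a i)"
        using gp_translate(1)[of "a i" "inv (a i) \<otimes> a j \<otimes> l n" "l n"] c ln by (simp add: m_assoc)
      finally show ?case using elim by simp
    qed
    then show "\<exists>D. \<forall>\<^sub>F n in sequentially. gp (a (fst s) \<otimes> l n \<otimes> b (fst s)) (a (snd s) \<otimes> l n \<otimes> b (snd s)) \<le> D"
      using s by auto
  qed
  then obtain D where D: "\<forall>\<^sub>F n in sequentially. \<forall>s\<in>?S. gp (a (fst s) \<otimes> l n \<otimes> b (fst s)) (a (snd s) \<otimes> l n \<otimes> b (snd s)) \<le> D"
    by blast
  show ?thesis
  proof (intro exI[of _ D] eventually_mono[OF D] allI impI)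
    fix n i j assume D: "\<forall>s\<in>?S. gp (a (fst s) \<otimes> l n \<otimes> b (fst s)) (a (snd s) \<otimes> l n \<otimes> b (snd s)) \<le> D"
      and ij: "i < J" "j < J" "i \<noteq> j"
    have "gp (a j \<otimes> l n \<otimes> b j) (a i \<otimes> l n \<otimes> b i) = gp (a i \<otimes> l n \<otimes> b i) (a j \<otimes> l n \<otimes> b j)"
      using a b ij geoD[OF l, of n] by (intro gromov_product_sym) auto
    then show "gp (a i \<otimes> l n \<otimes> b i) (a j \<otimes> l n \<otimes> b j) \<le> D"
      using bspec[OF D, of "(i, j)"] bspec[OF D, of "(j, i)"] ij by (cases "i < j") auto
  qed
qed

text \<open>Take a sequence in \<open>L\<close> such that it and the sequence of its inverses both
  converge at infinity. Then \<open>a j \<otimes> l n \<otimes> inv (b j)\<close> tends to the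
  translate by \<open>a j\<close> of the first limit, and its inverse to the translate by
  \<open>b j\<close> of the second. Different translates have bounded products, so \<open>D\<close>
  is fixed while the lengths grow with n.\<close>

lemma many_directions:
  fixes J :: nat
  assumes L: "subgroup L H" and nve: "\<not> virtually_cyclic (H\<lparr>carrier := L\<rparr>)"
  shows "\<exists>D. \<forall>R. \<exists>l::nat \<Rightarrow> 'a. (\<forall>j<J. l j \<in> L \<and> len (l j) \<ge> R) \<and>
      (\<forall>i<J. \<forall>j<J. i \<noteq> j \<longrightarrow> gp (l i) (l j) \<le> D \<and> gp (inv (l i)) (inv (l j)) \<le> D)"
proof -
  interpret L: subgroup L H by fact
  interpret K: group "H\<lparr>carrier := L\<rparr>" by (rule L.subgroup_is_group) (rule is_group)
  have LH: "x \<in> carrier H" if "x \<in> L" for x using that L.subset by blast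
  have "infinite L" using K.virtually_cyclic_if_finite nve by auto
  then obtain l0 :: "nat \<Rightarrow> 'a" where l0: "inj l0" "range l0 \<subseteq> L" using infinite_countable_subset by blast
  have c0: "l0 n \<in> carrier H" for n using l0 LH by blast
  have len0: "filterlim (\<lambda>n. len (l0 n)) at_top sequentially"
    unfolding filterlim_at_top
  proof
    fix Z
    have "finite (l0 -` {g \<in> carrier H. len g \<le> Z})" using finite_vimageI[OF finite_ball l0(1)] .
    then have "finite {n. len (l0 n) \<le> Z}" by (rule rev_finite_subset) (auto simp: c0)
    then have "\<forall>\<^sub>F n in sequentially. \<not> len (l0 n) \<le> Z"
      unfolding cofinite_eq_sequentially[symmetric] eventually_cofinite by simp
    then show "\<forall>\<^sub>F n in sequentially. Z \<le> len (l0 n)" by (rule eventually_mono) auto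
  qed
  obtain r where r: "strict_mono (r :: nat \<Rightarrow> nat)" "geo (l0 \<circ> r)" using geo_subseq[OF c0 len0] .
  have "filterlim (\<lambda>n. len (inv ((l0 \<circ> r) n))) at_top sequentially"
    using r(2) c0 by (simp add: geo_def)
  \<comment> \<open>A second extraction makes the inverses converge as well; the first convergence
    passes to subsequences.\<close>
  then obtain r' where r': "strict_mono (r' :: nat \<Rightarrow> nat)" "geo ((\<lambda>n. inv ((l0 \<circ> r) n)) \<circ> r')"
    using geo_subseq[of "\<lambda>n. inv ((l0 \<circ> r) n)"] c0 by auto
  define l where "l n = l0 (r (r' n))" for n
  have l: "geo l" using geo_compose[OF r(2) r'(1)] by (simp add: l_def[abs_def] comp_def)
  have li: "geo (\<lambda>n. inv (l n))" using r'(2) by (simp add: l_def[abs_def] comp_def)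
  have lL: "l n \<in> L" for n using l0 by (auto simp: l_def)
  obtain a where a: "\<forall>j<J. a j \<in> L \<and> (\<forall>i<j. \<not> stabilizes l (inv (a i) \<otimes> a j))"
    using distinct_directions[OF L nve l] by blast
  obtain b where b: "\<forall>j<J. b j \<in> L \<and> (\<forall>i<j. \<not> stabilizes (\<lambda>n. inv (l n)) (inv (b i) \<otimes> b j))"
    using distinct_directions[OF L nve li] by blast
  obtain D1 where D1: "\<forall>\<^sub>F n in sequentially. \<forall>i<J. \<forall>j<J. i \<noteq> j \<longrightarrow>
      gp (a i \<otimes> l n \<otimes> inv (b i)) (a j \<otimes> l n \<otimes> inv (b j)) \<le> D1"
    using translated_directions_bounded[OF l, of J a "\<lambda>j. inv (b j)"] a b LH by auto
  obtain D2 where D2: "\<forall>\<^sub>F n in sequentially. \<forall>i<J. \<forall>j<J. i \<noteq> j \<longrightarrow>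
      gp (b i \<otimes> inv (l n) \<otimes> inv (a i)) (b j \<otimes> inv (l n) \<otimes> inv (a j)) \<le> D2"
    using translated_directions_bounded[OF li, of J b "\<lambda>j. inv (a j)"] a b LH by auto
  show ?thesis
  proof (intro exI[of _ "max D1 D2"] allI)
    fix R
    define R' where "R' = R + (\<Sum>j<J. len (a j) + len (b j))"
    have "\<forall>\<^sub>F n in sequentially. len (l n) \<ge> R'" using l by (simp add: geo_def filterlim_at_top)
    from eventually_happens'[OF _ eventually_conj[OF this eventually_conj[OF D1 D2]]]
    obtain n where n: "len (l n) \<ge> R'"
      "\<forall>i<J. \<forall>j<J. i \<noteq> j \<longrightarrow> gp (a i \<otimes> l n \<otimes> inv (b i)) (a j \<otimes> l n \<otimes> inv (b j)) \<le> D1"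
      "\<forall>i<J. \<forall>j<J. i \<noteq> j \<longrightarrow> gp (b i \<otimes> inv (l n) \<otimes> inv (a i)) (b j \<otimes> inv (l n) \<otimes> inv (a j)) \<le> D2"
      by auto
    define m where "m j = a j \<otimes> l n \<otimes> inv (b j)" for j
    have inv_m: "inv (m j) = b j \<otimes> inv (l n) \<otimes> inv (a j)" if "j < J" for j
      using a b LH lL that by (simp add: m_def inv_mult_group m_assoc)
    have "len (m j) \<ge> R" if j: "j < J" for j
    proof -
      have c: "a j \<in> carrier H" "b j \<in> carrier H" "l n \<in> carrier H" using a b LH lL j by auto
      have "l n = inv (a j) \<otimes> m j \<otimes> b j" using c by (simp add: m_def m_assoc)
      then have "len (l n) \<le> len (a j) + len (m j) + len (b j)"
        using len_mult[of "inv (a j) \<otimes> m j" "b j"] len_mult[of "inv (a j)" "m j"] c by (simp add: m_def)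
      moreover have "len (a j) + len (b j) \<le> (\<Sum>j<J. len (a j) + len (b j))"
        using j by (intro member_le_sum) auto
      ultimately show ?thesis using n(1) by (simp add: R'_def)
    qed
    moreover have "m j \<in> L" if "j < J" for j using a b lL that by (auto simp: m_def)
    moreover have "gp (m i) (m j) \<le> max D1 D2" "gp (inv (m i)) (inv (m j)) \<le> max D1 D2"
      if "i < J" "j < J" "i \<noteq> j" for i j
      using n(2,3) that inv_m by (auto simp: m_def le_max_iff_disj)
    ultimately show "\<exists>l. (\<forall>j<J. l j \<in> L \<and> len (l j) \<ge> R) \<and>
      (\<forall>i<J. \<forall>j<J. i \<noteq> j \<longrightarrow> gp (l i) (l j) \<le> max D1 D2 \<and> gp (inv (l i)) (inv (l j)) \<le> max D1 D2)"
      by (intro exI[of _ m]) auto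
  qed
qed

text \<open>\<open>D\<close> bounds the mutual products, \<open>M\<close> depends on
  \<open>D\<close>, and only then are the elements chosen with length at least \<open>M\<close> +
  \<open>R\<close>. Off the repelling set the product of \<open>inv (l j)\<close> with x is below
  \<open>R\<close>, so that of \<open>l j\<close> with \<open>l j \<otimes> x\<close> is above
  \<open>M\<close>.\<close>

lemma separated_attractors:
  fixes J :: nat
  assumes L: "subgroup L H" and nve: "\<not> virtually_cyclic (H\<lparr>carrier := L\<rparr>)"
  obtains l :: "nat \<Rightarrow> 'a" and bad :: "nat \<Rightarrow> 'a set"
  where "\<And>j. j < J \<Longrightarrow> l j \<in> L" "disjoint_family_on bad {..<J}"
    "\<And>i j k. i < J \<Longrightarrow> j < J \<Longrightarrow> k < J \<Longrightarrow> i \<noteq> j \<Longrightarrow> i \<noteq> k \<Longrightarrow> j \<noteq> k \<Longrightarrow>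
       \<exists>F C. l2_kernel (H\<lparr>carrier := L\<rparr>) F C \<and>
         separates (H\<lparr>carrier := L\<rparr>) F (l i, bad i) (l j, bad j) (l k, bad k)"
proof -
  have LH: "x \<in> carrier H" if "x \<in> L" for x using that subgroup.subset[OF L] by blast
  obtain D where D: "\<And>R. \<exists>l::nat \<Rightarrow> 'a. (\<forall>j<J. l j \<in> L \<and> len (l j) \<ge> R) \<and>
      (\<forall>i<J. \<forall>j<J. i \<noteq> j \<longrightarrow> gp (l i) (l j) \<le> D \<and> gp (inv (l i)) (inv (l j)) \<le> D)"
    using many_directions[OF L nve, of J] by blast
  obtain M where M: "\<And>a b c. a \<in> carrier H \<Longrightarrow> b \<in> carrier H \<Longrightarrow> c \<in> carrier H \<Longrightarrow>
    gp a b \<le> D \<Longrightarrow> gp a c \<le> D \<Longrightarrow> gp b c \<le> D \<Longrightarrow>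
    \<exists>F C. l2_kernel H F C \<and>
      (\<forall>x\<in>carrier H. \<forall>y\<in>carrier H. \<forall>z\<in>carrier H. gp a x \<ge> M \<and> gp b y \<ge> M \<and> gp c z \<ge> M \<longrightarrow>
        cyclic_sum F x y z = 1)"
    using separating_cocycle[of D] by blast
  \<comment> \<open>Larger than \<open>D\<close> + \<delta>: a point common to two repelling sets
    would force the product of the two inverses above \<open>D\<close>.\<close>
  define R where "R = D + \<delta> + 1"
  obtain l where l: "\<And>j. j < J \<Longrightarrow> l j \<in> L" "\<And>j. j < J \<Longrightarrow> len (l j) \<ge> M + R"
    "\<And>i j. i < J \<Longrightarrow> j < J \<Longrightarrow> i \<noteq> j \<Longrightarrow> gp (l i) (l j) \<le> D \<and> gp (inv (l i)) (inv (l j)) \<le> D"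
    using D[of "M + R"] by blast
  define bad where "bad j = {x \<in> carrier H. gp (inv (l j)) x \<ge> R}" for j
  have att: "gp (l j) (l j \<otimes> x) \<ge> M" if "j < J" "x \<in> L" "x \<notin> bad j" for j x
    using attracting[of "l j" x] l(1,2)[OF that(1)] that LH by (auto simp: bad_def)
  show thesis
  proof (rule that[of l bad])
    show "disjoint_family_on bad {..<J}"
      unfolding disjoint_family_on_def
    proof (intro ballI impI equals0I)
      fix i j x assume ij: "i \<in> {..<J}" "j \<in> {..<J}" "i \<noteq> j" and x: "x \<in> bad i \<inter> bad j"
      have "gp (inv (l i)) (inv (l j)) \<ge> min (gp (inv (l i)) x) (gp x (inv (l j))) - \<delta>"
        using ij x l(1) LH by (intro four_point) (auto simp: bad_def)
      moreover have "gp x (inv (l j)) = gp (inv (l j)) x"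
        using ij x l(1) LH by (intro gromov_product_sym) (auto simp: bad_def)
      ultimately show False using x l(3)[of i j] ij by (auto simp: bad_def R_def)
    qed
  next
    fix i j k assume ijk: "i < J" "j < J" "k < J" "i \<noteq> j" "i \<noteq> k" "j \<noteq> k"
    have lH: "l i \<in> carrier H" "l j \<in> carrier H" "l k \<in> carrier H" using l(1) ijk LH by auto
    have gD: "gp (l i) (l j) \<le> D" "gp (l i) (l k) \<le> D" "gp (l j) (l k) \<le> D" using l(3) ijk by auto
    obtain F C where F: "l2_kernel H F C"
      "\<forall>x\<in>carrier H. \<forall>y\<in>carrier H. \<forall>z\<in>carrier H. gp (l i) x \<ge> M \<and> gp (l j) y \<ge> M \<and> gp (l k) z \<ge> M \<longrightarrow>
        cyclic_sum F x y z = 1"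
      using M[OF lH gD] by (elim exE conjE) (rule that)
    have "l2_kernel (H\<lparr>carrier := L\<rparr>) F C"
      unfolding l2_kernel_def
    proof (intro conjI ballI allI impI)
      fix x y z W
      assume "x \<in> carrier (H\<lparr>carrier := L\<rparr>)" "y \<in> carrier (H\<lparr>carrier := L\<rparr>)" "z \<in> carrier (H\<lparr>carrier := L\<rparr>)"
        "finite W \<and> W \<subseteq> carrier (H\<lparr>carrier := L\<rparr>)"
      then have "x \<in> carrier H" "y \<in> carrier H" "z \<in> carrier H" "finite W" "W \<subseteq> carrier H" using LH by auto
      then show "(\<Sum>g\<in>W. (cyclic_sum F (g \<otimes>\<^bsub>H\<lparr>carrier := L\<rparr>\<^esub> x) (g \<otimes>\<^bsub>H\<lparr>carrier := L\<rparr>\<^esub> y) (g \<otimes>\<^bsub>H\<lparr>carrier := L\<rparr>\<^esub> z))\<^sup>2) \<le> C"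
        using F(1) by (simp add: l2_kernel_def)
    qed (use F(1) in \<open>unfold l2_kernel_def, blast+\<close>)
    moreover have "separates (H\<lparr>carrier := L\<rparr>) F (l i, bad i) (l j, bad j) (l k, bad k)"
      unfolding separates_def
    proof (intro ballI)
      fix x y z
      assume "x \<in> carrier (H\<lparr>carrier := L\<rparr>) - snd (l i, bad i)" "y \<in> carrier (H\<lparr>carrier := L\<rparr>) - snd (l j, bad j)"
        "z \<in> carrier (H\<lparr>carrier := L\<rparr>) - snd (l k, bad k)"
      then have "cyclic_sum F (l i \<otimes> x) (l j \<otimes> y) (l k \<otimes> z) = 1"
        using LH lH ijk att by (intro F(2)[rule_format]) auto
      then show "cyclic_sum F (fst (l i, bad i) \<otimes>\<^bsub>H\<lparr>carrier := L\<rparr>\<^esub> x) (fst (l j, bad j) \<otimes>\<^bsub>H\<lparr>carrier := L\<rparr>\<^esub> y)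
          (fst (l k, bad k) \<otimes>\<^bsub>H\<lparr>carrier := L\<rparr>\<^esub> z) = 1" by simp
    qed
    ultimately show "\<exists>F C. l2_kernel (H\<lparr>carrier := L\<rparr>) F C \<and>
         separates (H\<lparr>carrier := L\<rparr>) F (l i, bad i) (l j, bad j) (l k, bad k)" by blast
  qed (rule l(1))
qed

end

section \<open>Measure equivalence couplings\<close>

lemma nn_integral_count_space_le:
  fixes f :: "'i \<Rightarrow> ennreal"
  assumes "countable A" "\<And>W. finite W \<Longrightarrow> W \<subseteq> A \<Longrightarrow> (\<Sum>i\<in>W. f i) \<le> C"
  shows "(\<integral>\<^sup>+i. f i \<partial>count_space A) \<le> C"
proof (cases "finite A")
  case True
  then show ?thesis using assms(2)[of A] by (simp add: nn_integral_count_space_finite)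
next
  case False
  have bij: "bij_betw (from_nat_into A) UNIV A" using bij_betw_from_nat_into[OF assms(1) False] .
  have "(\<integral>\<^sup>+i. f i \<partial>count_space A) = (\<integral>\<^sup>+n. f (from_nat_into A n) \<partial>count_space UNIV)"
    using nn_integral_bij_count_space[OF bij, of f] by simp
  also have "\<dots> = suminf (\<lambda>n. f (from_nat_into A n))" by (rule nn_integral_count_space_nat)
  also have "\<dots> \<le> C"
  proof (rule suminf_le_const)
    fix n
    have "inj_on (from_nat_into A) {..<n}" using bij by (auto simp: bij_betw_def intro: inj_on_subset)
    then have "(\<Sum>i<n. f (from_nat_into A i)) = sum f (from_nat_into A ` {..<n})" by (simp add: sum.reindex)
    also have "\<dots> \<le> C" using bij by (intro assms(2)) (auto simp: bij_betw_def)
    finally show "(\<Sum>i<n. f (from_nat_into A i)) \<le> C" .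
  qed simp
  finally show ?thesis .
qed

lemma nn_integral_count_space_unique:
  assumes "\<exists>!i. i \<in> A \<and> P i"
  shows "(\<integral>\<^sup>+i. indicator {i. P i} i \<partial>count_space A) = 1"
proof -
  obtain i where i: "i \<in> A" "P i" "\<And>j. j \<in> A \<Longrightarrow> P j \<Longrightarrow> j = i" using assms by blast
  have "(\<integral>\<^sup>+i. indicator {i. P i} i \<partial>count_space A) = (\<Sum>j\<in>{i}. indicator {i. P i} j :: ennreal)"
  proof (rule nn_integral_count_space')
    fix j assume "j \<in> A" "j \<notin> {i}"
    then show "indicator {i. P i} j = (0 :: ennreal)" using i(3)[of j] by (auto simp: indicator_def)
  qed (use i(1) in auto)
  then show ?thesis using i(1,2) by simp
qed

section \<open>A single measure-preserving action with a fundamental domain of finite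
  measure\<close>

locale fd_action = group G for G (structure) +
  fixes M :: "'s measure" and a and Y
  assumes countable: "countable (carrier G)"
    and act: "measure_preserving_action G M a"
    and fd: "fundamental_domain G M a Y"
    and fin: "emeasure M Y < \<infinity>"
begin

lemma group_action: "group_action G (space M) a"
  using act by (simp add: measure_preserving_action_def)

lemma Y [measurable]: "Y \<in> sets M"
  using fd by (simp add: fundamental_domain_def)

lemma act_closed [simp]: "g \<in> carrier G \<Longrightarrow> s \<in> space M \<Longrightarrow> a g s \<in> space M"
  using group_action.element_image[OF group_action] by blast

lemma act_mult: "g \<in> carrier G \<Longrightarrow> h \<in> carrier G \<Longrightarrow> s \<in> space M \<Longrightarrow> a g (a h s) = a (g \<otimes> h) s"
  using group_action.composition_rule[OF group_action] by simp

lemma act_one [simp]: "s \<in> space M \<Longrightarrow> a \<one> s = s"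
  using group_action.id_eq_one[OF group_action] by (metis restrict_apply')

lemma measurable_act: "g \<in> carrier G \<Longrightarrow> a g \<in> M \<rightarrow>\<^sub>M M"
  using act by (simp add: measure_preserving_action_def)

lemma distr_act: "g \<in> carrier G \<Longrightarrow> distr M M (a g) = M"
  using act by (simp add: measure_preserving_action_def)

lemma mem_image_act:
  assumes "g \<in> carrier G" "s \<in> space M"
  shows "s \<in> a g ` Y \<longleftrightarrow> a (inv g) s \<in> Y"
proof
  assume "s \<in> a g ` Y"
  then obtain y where y: "y \<in> Y" "s = a g y" by blast
  then have "y \<in> space M" using sets.sets_into_space[OF Y] by blast
  then show "a (inv g) s \<in> Y" using y assms by (simp add: act_mult)
next
  assume "a (inv g) s \<in> Y"
  moreover have "s = a g (a (inv g) s)" using assms by (simp add: act_mult)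
  ultimately show "s \<in> a g ` Y" by blast
qed

lemma AE_act:
  assumes "AE s in M. P s" "g \<in> carrier G"
  shows "AE s in M. P (a g s)"
proof -
  have "AE s in distr M M (a g). P s" using assms(1) by (simp only: distr_act[OF assms(2)])
  then show ?thesis by (rule AE_distrD[OF measurable_act[OF assms(2)]])
qed

lemma nn_integral_act:
  assumes "f \<in> borel_measurable M" "g \<in> carrier G"
  shows "(\<integral>\<^sup>+s. f (a g s) \<partial>M) = (\<integral>\<^sup>+s. f s \<partial>M)"
  using nn_integral_distr[OF measurable_act[OF assms(2)], of f] assms(1) distr_act[OF assms(2)] by simp

definition good :: "'s \<Rightarrow> bool" where
  "good s \<longleftrightarrow> s \<in> space M \<and> (\<exists>!g. g \<in> carrier G \<and> a (inv g) s \<in> Y)"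

text \<open>Labels the translate of \<open>Y\<close> that contains \<open>s\<close>, and so is
  equivariant on good points. The value \<one> elsewhere keeps it total with values in the
  group.\<close>

definition idx :: "'s \<Rightarrow> 'a" where
  "idx s = (if good s then THE g. g \<in> carrier G \<and> a (inv g) s \<in> Y else \<one>)"

lemma AE_good: "AE s in M. good s"
proof -
  have "AE s in M. \<exists>!g. g \<in> carrier G \<and> s \<in> a g ` Y" using fd by (simp add: fundamental_domain_def)
  then show ?thesis
  proof (rule AE_mp, intro AE_I2 impI)
    fix s assume s: "s \<in> space M" and ex: "\<exists>!g. g \<in> carrier G \<and> s \<in> a g ` Y"
    have "(g \<in> carrier G \<and> s \<in> a g ` Y) \<longleftrightarrow> (g \<in> carrier G \<and> a (inv g) s \<in> Y)" for g
      using mem_image_act[of g s] s by blast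
    then show "good s" using s ex by (simp add: good_def)
  qed
qed

lemma idx:
  assumes "good s"
  shows "idx s \<in> carrier G \<and> a (inv (idx s)) s \<in> Y"
proof -
  have "\<exists>!g. g \<in> carrier G \<and> a (inv g) s \<in> Y" using assms by (simp add: good_def)
  then show ?thesis using theI'[of "\<lambda>g. g \<in> carrier G \<and> a (inv g) s \<in> Y"] assms by (simp add: idx_def)
qed

lemma bad_idx: "\<not> good s \<Longrightarrow> idx s = \<one>"
  by (simp add: idx_def)

lemma good_space: "good s \<Longrightarrow> s \<in> space M"
  by (simp add: good_def)

lemma idx_closed [simp]: "idx s \<in> carrier G"
  using idx[of s] by (cases "good s") (auto simp: idx_def)

lemma idx_eqI: "good s \<Longrightarrow> g \<in> carrier G \<Longrightarrow> a (inv g) s \<in> Y \<Longrightarrow> idx s = g"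
  using idx[of s] unfolding good_def by blast

lemma
  assumes s: "good s" and g: "g \<in> carrier G"
  shows good_act: "good (a g s)" and idx_act: "idx (a g s) = g \<otimes> idx s"
proof -
  have sp: "s \<in> space M" using s by (simp add: good_def)
  have eq: "a (inv h) (a g s) = a (inv (inv g \<otimes> h)) s" if "h \<in> carrier G" for h
    using that g sp by (simp add: act_mult inv_mult_group)
  have iff: "h \<in> carrier G \<and> a (inv h) (a g s) \<in> Y \<longleftrightarrow> h = g \<otimes> idx s" for h
  proof
    assume h: "h \<in> carrier G \<and> a (inv h) (a g s) \<in> Y"
    then have "idx s = inv g \<otimes> h" using eq[of h] g by (intro idx_eqI[OF s]) auto
    then show "h = g \<otimes> idx s" using h g by (simp add: m_assoc[symmetric])
  next
    assume h: "h = g \<otimes> idx s"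
    then have hc: "h \<in> carrier G" using g by simp
    have "inv g \<otimes> h = idx s" using h g by (simp add: m_assoc[symmetric])
    then show "h \<in> carrier G \<and> a (inv h) (a g s) \<in> Y" using eq[OF hc] idx[OF s] hc by simp
  qed
  show good: "good (a g s)" using iff g sp by (auto simp: good_def)
  show "idx (a g s) = g \<otimes> idx s" using iff[of "g \<otimes> idx s"] by (intro idx_eqI[OF good]) auto
qed

text \<open>On good points a level set of \<open>idx\<close> is the part of one translate of
  \<open>Y\<close> that no other translate meets, a countable Boolean combination of measurable
  sets. Measurability of the set of good points is a consequence.\<close>

lemma measurable_idx [measurable]: "idx \<in> M \<rightarrow>\<^sub>M count_space (carrier G)"
  unfolding measurable_count_space_eq_countable[OF countable]
proof (intro conjI ballI)
  show "idx \<in> space M \<rightarrow> carrier G" by auto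
  fix g assume g: "g \<in> carrier G"
  define V where "V h = a (inv h) -` Y \<inter> space M" for h
  have V: "V h \<in> sets M" if "h \<in> carrier G" for h
    unfolding V_def by (rule measurable_sets[OF measurable_act Y]) (use that in simp)
  define U where "U h = V h - (\<Union>h'\<in>carrier G - {h}. V h')" for h
  have U: "U h \<in> sets M" if "h \<in> carrier G" for h
    unfolding U_def using V that countable
    by (intro sets.Diff sets.countable_UN') (auto intro: countable_subset)
  have U_eq: "U h = {s. good s \<and> idx s = h}" if h: "h \<in> carrier G" for h
  proof (intro equalityI subsetI)
    fix s assume "s \<in> U h"
    then have s: "s \<in> space M" "a (inv h) s \<in> Y" "\<And>h'. h' \<in> carrier G \<Longrightarrow> a (inv h') s \<in> Y \<Longrightarrow> h' = h"
      by (auto simp: U_def V_def)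
    then have "good s" using h unfolding good_def by blast
    then show "s \<in> {s. good s \<and> idx s = h}" using idx_eqI[OF _ h s(2)] by blast
  next
    fix s assume "s \<in> {s. good s \<and> idx s = h}"
    then have s: "good s" "idx s = h" by auto
    then show "s \<in> U h" using idx[OF s(1)] idx_eqI[OF s(1)] by (auto simp: U_def V_def good_def)
  qed
  then have pieces: "{s. good s \<and> idx s = h} \<in> sets M" if "h \<in> carrier G" for h
    using U[OF that] by (simp only: U_eq[OF that])
  have "(\<Union>h\<in>carrier G. {s. good s \<and> idx s = h}) \<in> sets M"
    using pieces countable by (intro sets.countable_UN') auto
  moreover have "(\<Union>h\<in>carrier G. {s. good s \<and> idx s = h}) = {s. good s}" by auto
  ultimately have gd: "{s. good s} \<in> sets M" by (simp only:)
  have "idx -` {g} \<inter> space M = {s. good s \<and> idx s = g} \<union> (if g = \<one> then space M - {s. good s} else {})"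
    using bad_idx good_space by auto
  also have "\<dots> \<in> sets M" using pieces[OF g] gd by auto
  finally show "idx -` {g} \<inter> space M \<in> sets M" .
qed

text \<open>Almost every point is in exactly one translate of \<open>Y\<close>, and moving a
  translate back to \<open>Y\<close> preserves the measure. Countability of the group permits the
  exchange of sum and integral.\<close>

lemma nn_integral_unfold:
  assumes f: "f \<in> borel_measurable M"
  shows "(\<integral>\<^sup>+s. f s \<partial>M) = (\<integral>\<^sup>+g. (\<integral>\<^sup>+s. f (a g s) * indicator Y s \<partial>M) \<partial>count_space (carrier G))"
proof -
  have m: "(\<lambda>s. f s * indicator Y (a (inv g) s)) \<in> borel_measurable M" if "g \<in> carrier G" for g
  proof -
    have "(\<lambda>s. indicator Y (a (inv g) s) :: ennreal) \<in> borel_measurable M"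
      by (rule measurable_compose[OF measurable_act borel_measurable_indicator[OF Y]]) (use that in simp)
    with f show ?thesis by (rule borel_measurable_times_ennreal)
  qed
  have "(\<integral>\<^sup>+s. f s \<partial>M) = (\<integral>\<^sup>+s. (\<integral>\<^sup>+g. f s * indicator Y (a (inv g) s) \<partial>count_space (carrier G)) \<partial>M)"
  proof (rule nn_integral_cong_AE, rule AE_mp[OF AE_good], intro AE_I2 impI)
    fix s assume "good s"
    then have "(\<integral>\<^sup>+g. indicator {g. a (inv g) s \<in> Y} g \<partial>count_space (carrier G)) = 1"
      by (intro nn_integral_count_space_unique) (auto simp: good_def)
    then show "f s = (\<integral>\<^sup>+g. f s * indicator Y (a (inv g) s) \<partial>count_space (carrier G))"
      by (subst nn_integral_cmult) (auto simp: indicator_def)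
  qed
  also have "\<dots> = (\<integral>\<^sup>+g. (\<integral>\<^sup>+s. f s * indicator Y (a (inv g) s) \<partial>M) \<partial>count_space (carrier G))"
    using m by (intro nn_integral_count_space_nn_integral countable)
  also have "\<dots> = (\<integral>\<^sup>+g. (\<integral>\<^sup>+s. f (a g s) * indicator Y s \<partial>M) \<partial>count_space (carrier G))"
  proof (rule nn_integral_cong)
    fix g assume "g \<in> space (count_space (carrier G))"
    then have g: "g \<in> carrier G" by simp
    have "(\<integral>\<^sup>+s. f s * indicator Y (a (inv g) s) \<partial>M) = (\<integral>\<^sup>+s. f (a g s) * indicator Y (a (inv g) (a g s)) \<partial>M)"
      using nn_integral_act[OF m[OF g] g] by simp
    also have "\<dots> = (\<integral>\<^sup>+s. f (a g s) * indicator Y s \<partial>M)"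
      using g by (intro nn_integral_cong) (simp add: act_mult)
    finally show "(\<integral>\<^sup>+s. f s * indicator Y (a (inv g) s) \<partial>M) = (\<integral>\<^sup>+s. f (a g s) * indicator Y s \<partial>M)" .
  qed
  finally show ?thesis .
qed

lemma nn_integral_translates_le:
  assumes f: "f \<in> borel_measurable M" and W: "finite W" "W \<subseteq> carrier G"
  shows "(\<Sum>g\<in>W. \<integral>\<^sup>+s. f (a (inv g) s) * indicator Y s \<partial>M) \<le> (\<integral>\<^sup>+s. f s \<partial>M)"
proof -
  have inj: "inj_on (m_inv G) W" using inj_on_subset[OF inv_inj W(2)] .
  let ?h = "\<lambda>g. \<integral>\<^sup>+s. f (a g s) * indicator Y s \<partial>M"
  have "(\<Sum>g\<in>W. ?h (inv g)) = sum ?h (m_inv G ` W)" using inj by (simp add: sum.reindex)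
  also have "\<dots> = (\<integral>\<^sup>+g. ?h g \<partial>count_space (m_inv G ` W))"
    using W by (simp add: nn_integral_count_space_finite)
  also have "\<dots> \<le> (\<integral>\<^sup>+g. ?h g \<partial>count_space (carrier G))"
  proof -
    have "m_inv G ` W \<subseteq> carrier G" using W by auto
    then show ?thesis
      unfolding nn_integral_count_space_indicator[of "m_inv G ` W", simplified]
        nn_integral_count_space_indicator[of "carrier G", simplified]
      by (intro nn_integral_mono mult_left_mono) (auto simp: indicator_def)
  qed
  also have "\<dots> = (\<integral>\<^sup>+s. f s \<partial>M)" using nn_integral_unfold[OF f] by simp
  finally show ?thesis .
qed

text \<open>For a nonzero measure this makes finiteness of the group equivalent to finite total
  measure, through which infinitude passes from one group of a coupling to the other.\<close>

lemma total_measure: "emeasure M (space M) = (\<integral>\<^sup>+g. emeasure M Y \<partial>count_space (carrier G))"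
  using nn_integral_unfold[of "\<lambda>_. 1"] by simp

lemma emeasure_Y_pos:
  assumes "emeasure M (space M) \<noteq> 0"
  shows "emeasure M Y \<noteq> 0"
proof
  assume Y0: "emeasure M Y = 0"
  then show False using assms total_measure by simp
qed

lemma finite_if_finite_total_measure:
  assumes "emeasure M (space M) \<noteq> 0" "emeasure M (space M) < \<infinity>"
  shows "finite (carrier G)"
proof (rule ccontr)
  assume "infinite (carrier G)"
  then have "emeasure M (space M) = \<infinity>"
    using emeasure_Y_pos[OF assms(1)] by (simp add: total_measure ennreal_mult_top)
  then show False using assms(2) by simp
qed

lemma finite_total_measure_if_finite:
  assumes "finite (carrier G)"
  shows "emeasure M (space M) < \<infinity>"
  using assms fin by (simp add: total_measure ennreal_mult_less_top ennreal_of_nat_eq_real_of_nat)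

end

definition mean3 :: "'i set \<Rightarrow> ('i \<Rightarrow> real) \<Rightarrow> ('i \<Rightarrow> 'i \<Rightarrow> 'i \<Rightarrow> real) \<Rightarrow> real" where
  "mean3 I q \<phi> = (\<Sum>i\<in>I. \<Sum>j\<in>I. \<Sum>k\<in>I. q i * q j * q k * \<phi> i j k)"

section \<open>Orbit maps between the two coupled groups\<close>

locale me_coupling = G: fd_action G M a Y + K: fd_action K M b D
  for G :: "('g, 'x) monoid_scheme" (structure) and K :: "('k, 'y) monoid_scheme" (structure) and M :: "'s measure" and a b Y D +
  assumes commute: "g \<in> carrier G \<Longrightarrow> h \<in> carrier K \<Longrightarrow> s \<in> space M \<Longrightarrow> a g (b h s) = b h (a g s)"
    and nonzero: "emeasure M (space M) \<noteq> 0"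
begin

abbreviation \<mu> :: "'s set \<Rightarrow> real" where "\<mu> \<equiv> measure M"

lemma \<mu>_Y: "emeasure M Y = ennreal (\<mu> Y)" "\<mu> Y > 0"
proof -
  show "emeasure M Y = ennreal (\<mu> Y)" using G.fin by (intro emeasure_eq_ennreal_measure) auto
  then show "\<mu> Y > 0" using G.emeasure_Y_pos[OF nonzero] by (cases "\<mu> Y = 0") (auto simp: less_le)
qed

lemma \<mu>_D: "emeasure M D = ennreal (\<mu> D)"
  using K.fin by (intro emeasure_eq_ennreal_measure) auto

text \<open>For fixed \<open>s\<close> this is a map from \<open>G\<close> to \<open>K\<close>.
  Moving \<open>s\<close> by \<open>K\<close> multiplies all its values on the left by one element,
  and moving \<open>s\<close> by \<open>G\<close> shifts its argument; it is along these maps that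
  cocycles of \<open>K\<close> are pulled back.\<close>

definition ev :: "'g \<Rightarrow> 's \<Rightarrow> 'k" where "ev x s = K.idx (a (inv x) s)"

definition generic :: "'s \<Rightarrow> bool" where
  "generic s \<longleftrightarrow> s \<in> space M \<and> (\<forall>x\<in>carrier G. K.good (a x s)) \<and> (\<forall>h\<in>carrier K. G.good (b h s))"

lemma AE_generic: "AE s in M. generic s"
proof -
  have "AE s in M. \<forall>x\<in>carrier G. K.good (a x s)"
    using G.AE_act[OF K.AE_good] by (intro AE_ball_countable' G.countable)
  moreover have "AE s in M. \<forall>h\<in>carrier K. G.good (b h s)"
    using K.AE_act[OF G.AE_good] by (intro AE_ball_countable' K.countable)
  ultimately show ?thesis using AE_space by eventually_elim (simp add: generic_def)
qed

lemma ev_closed [simp]: "ev x s \<in> carrier K" by (simp add: ev_def)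

lemma measurable_ev [measurable]: "x \<in> carrier G \<Longrightarrow> ev x \<in> M \<rightarrow>\<^sub>M count_space (carrier K)"
  unfolding ev_def[abs_def] by (rule measurable_compose[OF G.measurable_act K.measurable_idx]) simp

lemma ev_mult:
  "g \<in> carrier G \<Longrightarrow> x \<in> carrier G \<Longrightarrow> s \<in> space M \<Longrightarrow> ev (g \<otimes> x) s = ev x (a (inv g) s)"
  by (simp add: ev_def G.act_mult G.inv_mult_group)

lemma ev_act:
  "x \<in> carrier G \<Longrightarrow> h \<in> carrier K \<Longrightarrow> generic s \<Longrightarrow> ev x (b h s) = h \<otimes>\<^bsub>K\<^esub> ev x s"
  by (simp add: ev_def commute generic_def K.idx_act)

lemma measurable_three:
  fixes f :: "'k \<Rightarrow> 'k \<Rightarrow> 'k \<Rightarrow> real"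
  assumes "u \<in> M \<rightarrow>\<^sub>M count_space (carrier K)" "v \<in> M \<rightarrow>\<^sub>M count_space (carrier K)" "w \<in> M \<rightarrow>\<^sub>M count_space (carrier K)"
  shows "(\<lambda>s. f (u s) (v s) (w s)) \<in> borel_measurable M"
proof -
  have 1: "(\<lambda>s. f i j (w s)) \<in> borel_measurable M" for i j
    by (rule measurable_compose[OF assms(3)]) simp
  have 2: "(\<lambda>s. f i (v s) (w s)) \<in> borel_measurable M" for i
    by (rule measurable_compose_countable'[of "carrier K" "\<lambda>j s. f i j (w s)", OF 1 assms(2) K.countable])
  show ?thesis
    by (rule measurable_compose_countable'[of "carrier K" "\<lambda>i s. f i (v s) (w s)", OF 2 assms(1) K.countable])
qed

lemma integrable_on_Y:
  fixes \<phi> :: "'s \<Rightarrow> real"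
  assumes "A \<in> sets M" "A \<subseteq> Y" "\<phi> \<in> borel_measurable M" "\<And>s. s \<in> space M \<Longrightarrow> \<bar>\<phi> s\<bar> \<le> B"
  shows "integrable M (\<lambda>s. indicator A s * \<phi> s)"
proof -
  have "emeasure M A \<le> emeasure M Y" using assms(2) by (intro emeasure_mono G.Y)
  then have "emeasure M A < \<infinity>" using G.fin by (rule le_less_trans)
  then have "integrable M (\<lambda>s. indicator A s *\<^sub>R \<phi> s)"
    using assms by (intro integrableI_bounded_set_indicator[where B=B]) auto
  then show ?thesis by simp
qed

text \<open>The Cauchy-Schwarz inequality, obtained by expanding the integral over \<open>Y\<close>
  of the squared deviation from the mean \<open>c\<close>.\<close>

lemma square_integral_le:
  fixes \<phi> :: "'s \<Rightarrow> real"
  assumes A: "A \<in> sets M" "A \<subseteq> Y" and \<phi>: "\<phi> \<in> borel_measurable M" "\<And>s. s \<in> space M \<Longrightarrow> \<bar>\<phi> s\<bar> \<le> B"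
  shows "(\<integral>s. indicator A s * \<phi> s \<partial>M)\<^sup>2 \<le> \<mu> Y * (\<integral>s. indicator Y s * (\<phi> s)\<^sup>2 \<partial>M)"
proof -
  define m where "m = (\<integral>s. indicator A s * \<phi> s \<partial>M)"
  define c where "c = m / \<mu> Y"
  have sq: "(\<lambda>s. (\<phi> s)\<^sup>2) \<in> borel_measurable M" using \<phi>(1) by simp
  have sqb: "\<bar>(\<phi> s)\<^sup>2\<bar> \<le> B\<^sup>2" if "s \<in> space M" for s
    using \<phi>(2)[OF that] by (simp add: abs_le_square_iff[symmetric])
  have i1: "integrable M (\<lambda>s. indicator A s * (\<phi> s)\<^sup>2)" by (rule integrable_on_Y[OF A sq sqb])
  have i2: "integrable M (\<lambda>s. indicator Y s * (\<phi> s)\<^sup>2)" by (rule integrable_on_Y[OF G.Y order_refl sq sqb])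
  have i3: "integrable M (\<lambda>s. indicator A s * \<phi> s)" by (rule integrable_on_Y[OF A \<phi>])
  have i4: "integrable M (indicator Y :: 's \<Rightarrow> real)" using G.fin by simp
  have "0 \<le> (\<integral>s. indicator Y s * (indicator A s * \<phi> s - c)\<^sup>2 \<partial>M)"
    by (intro integral_nonneg_AE AE_I2) simp
  also have "\<dots> = (\<integral>s. indicator A s * (\<phi> s)\<^sup>2 - 2 * c * (indicator A s * \<phi> s) + c\<^sup>2 * indicator Y s \<partial>M)"
    using A(2) by (intro Bochner_Integration.integral_cong refl)
      (auto simp: indicator_def power2_eq_square algebra_simps)
  also have "\<dots> = (\<integral>s. indicator A s * (\<phi> s)\<^sup>2 \<partial>M) - 2 * c * m + c\<^sup>2 * \<mu> Y"
    using i1 i3 i4 sets.sets_into_space[OF G.Y] by (simp add: m_def Int_absorb2)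
  also have "\<dots> = (\<integral>s. indicator A s * (\<phi> s)\<^sup>2 \<partial>M) - m\<^sup>2 / \<mu> Y"
    using \<mu>_Y(2) by (simp add: c_def power2_eq_square field_simps)
  finally have "m\<^sup>2 / \<mu> Y \<le> (\<integral>s. indicator A s * (\<phi> s)\<^sup>2 \<partial>M)" by simp
  also have "\<dots> \<le> (\<integral>s. indicator Y s * (\<phi> s)\<^sup>2 \<partial>M)"
    using A(2) by (intro integral_mono i1 i2) (auto simp: indicator_def)
  finally show ?thesis using \<mu>_Y(2) by (simp add: m_def field_simps)
qed

text \<open>The return cocycle of the \<open>K\<close>-action on \<open>Y\<close> as the space of
  \<open>G\<close>-orbits: \<open>inv l\<close> moves a point of \<open>Y\<close> into the translate
  of \<open>Y\<close> labelled by this element.\<close>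

definition gm :: "'k \<Rightarrow> 's \<Rightarrow> 'g" where "gm l s = G.idx (b (inv\<^bsub>K\<^esub> l) s)"

lemma measurable_gm: "l \<in> carrier K \<Longrightarrow> gm l \<in> M \<rightarrow>\<^sub>M count_space (carrier G)"
  unfolding gm_def[abs_def] by (rule measurable_compose[OF K.measurable_act G.measurable_idx]) simp

lemma gm_closed [simp]: "gm l s \<in> carrier G" by (simp add: gm_def)

text \<open>The value of \<open>ev z\<close> at the representative in \<open>Y\<close> of the
  \<open>G\<close>-orbit of \<open>s\<close>; thus, up to null sets, a function on the space of
  orbits.\<close>

definition R :: "'g \<Rightarrow> 's \<Rightarrow> 'k" where
  "R z s = K.idx (a (inv z) (a (inv (G.idx s)) s))"

lemma R_closed [simp]: "R z s \<in> carrier K" by (simp add: R_def)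

lemma measurable_R:
  assumes "z \<in> carrier G"
  shows "R z \<in> M \<rightarrow>\<^sub>M count_space (carrier K)"
proof -
  have "(\<lambda>s. K.idx (a (inv z) (a (inv g) s))) \<in> M \<rightarrow>\<^sub>M count_space (carrier K)" if "g \<in> carrier G" for g
    by (intro measurable_compose[OF G.measurable_act measurable_compose[OF G.measurable_act K.measurable_idx]])
      (use assms that in auto)
  then show ?thesis
    unfolding R_def[abs_def]
    by (rule measurable_compose_countable'[of "carrier G" "\<lambda>g s. K.idx (a (inv z) (a (inv g) s))",
          OF _ G.measurable_idx G.countable])
qed

text \<open>How left multiplication by \<open>l\<close> in \<open>K\<close> is simulated inside
  \<open>G\<close>. The inverse of \<open>gm l s\<close> brings \<open>b (inv l) s\<close> back to
  \<open>Y\<close>, where \<open>R z\<close> reads it, and commuting the actions releases the factor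
  \<open>l\<close>.\<close>

lemma ev_gm:
  assumes "generic s" "l \<in> carrier K" "z \<in> carrier G"
  shows "ev (gm l s \<otimes> z) s = l \<otimes>\<^bsub>K\<^esub> R z (b (inv\<^bsub>K\<^esub> l) s)"
proof -
  have s: "s \<in> space M" using assms(1) by (simp add: generic_def)
  define g where "g = gm l s"
  have g: "g \<in> carrier G" by (simp add: g_def)
  have good: "K.good (a (inv z \<otimes> inv g) s)"
    using assms g by (simp add: generic_def)
  have "R z (b (inv\<^bsub>K\<^esub> l) s) = K.idx (a (inv z) (a (inv g) (b (inv\<^bsub>K\<^esub> l) s)))"
    by (simp add: R_def g_def gm_def)
  also have "a (inv z) (a (inv g) (b (inv\<^bsub>K\<^esub> l) s)) = b (inv\<^bsub>K\<^esub> l) (a (inv z \<otimes> inv g) s)"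
    using assms g s by (simp add: commute G.act_mult)
  also have "K.idx \<dots> = inv\<^bsub>K\<^esub> l \<otimes>\<^bsub>K\<^esub> K.idx (a (inv z \<otimes> inv g) s)"
    using assms by (intro K.idx_act good) simp
  finally have "l \<otimes>\<^bsub>K\<^esub> R z (b (inv\<^bsub>K\<^esub> l) s) = K.idx (a (inv z \<otimes> inv g) s)"
    using assms by (simp add: K.m_assoc[symmetric])
  then show ?thesis using assms g by (simp add: ev_def G.inv_mult_group g_def)
qed

lemma R_act:
  assumes "G.good s" "g \<in> carrier G"
  shows "R z (a g s) = R z s"
proof -
  have s: "s \<in> space M" using assms(1) G.good_space by blast
  have "a (inv (G.idx (a g s))) (a g s) = a (inv (G.idx s)) s"
    using assms s by (simp add: G.idx_act G.act_mult G.inv_mult_group G.m_assoc)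
  then show ?thesis by (simp add: R_def)
qed

definition sampled ::
    "('k \<Rightarrow> 'k \<Rightarrow> 'k \<Rightarrow> real) \<Rightarrow> 's set \<Rightarrow> 'k \<Rightarrow> 'k \<Rightarrow> 'k \<Rightarrow> 'g \<Rightarrow> 'g \<Rightarrow> 'g \<Rightarrow> real" where
  "sampled f E l0 l1 l2 z0 z1 z2 =
     (\<integral>s. indicator E s * f (ev (gm l0 s \<otimes> z0) s) (ev (gm l1 s \<otimes> z1) s) (ev (gm l2 s \<otimes> z2) s) \<partial>M)"

text \<open>The points of \<open>Y\<close> at which the sample \<open>z\<close>, before
  multiplication by \<open>l\<close>, is read in \<open>K\<close> as an element of the set
  \<open>P\<close> to be avoided.\<close>

definition level :: "'k \<Rightarrow> 'g \<Rightarrow> 'k set \<Rightarrow> 's set" where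
  "level l z P = {s \<in> Y. R z (b (inv\<^bsub>K\<^esub> l) s) \<in> P}"

lemma sets_level: "l \<in> carrier K \<Longrightarrow> z \<in> carrier G \<Longrightarrow> level l z P \<in> sets M"
proof -
  assume c: "l \<in> carrier K" "z \<in> carrier G"
  have m: "(\<lambda>s. R z (b (inv\<^bsub>K\<^esub> l) s)) \<in> M \<rightarrow>\<^sub>M count_space (carrier K)"
    by (rule measurable_compose[OF K.measurable_act measurable_R]) (use c in auto)
  have "level l z P = Y \<inter> ((\<lambda>s. R z (b (inv\<^bsub>K\<^esub> l) s)) -` (P \<inter> carrier K) \<inter> space M)"
    using sets.sets_into_space[OF G.Y] by (auto simp: level_def)
  also have "\<dots> \<in> sets M" by (rule sets.Int[OF G.Y measurable_sets[OF m]]) simp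
  finally show ?thesis .
qed

text \<open>The measure-preserving action of \<open>K\<close> on \<open>Y\<close>, seen as the space of \<open>G\<close>-orbits:
  the law of \<open>R z\<close> on \<open>Y\<close> is invariant under it.\<close>

lemma measure_level:
  assumes "l \<in> carrier K" "z \<in> carrier G"
  shows "\<mu> (level l z P) = \<mu> (level \<one>\<^bsub>K\<^esub> z P)"
proof -
  define r :: "'s \<Rightarrow> ennreal" where "r s = indicator P (R z s)" for s
  have r: "r \<in> borel_measurable M"
    unfolding r_def[abs_def] by (rule measurable_compose[OF measurable_R[OF assms(2)]]) simp
  have em: "emeasure M (level l z P) = (\<integral>\<^sup>+s. indicator Y s * r (b (inv\<^bsub>K\<^esub> l) s) \<partial>M)" if "l \<in> carrier K" for l
  proof -
    have "emeasure M (level l z P) = (\<integral>\<^sup>+s. indicator (level l z P) s \<partial>M)"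
      using sets_level[OF that assms(2)] by simp
    also have "\<dots> = (\<integral>\<^sup>+s. indicator Y s * r (b (inv\<^bsub>K\<^esub> l) s) \<partial>M)"
      by (intro nn_integral_cong) (auto simp: level_def r_def indicator_def)
    finally show ?thesis .
  qed
  have rb: "(\<lambda>s. r (b (inv\<^bsub>K\<^esub> l) s)) \<in> borel_measurable M"
    by (rule measurable_compose[OF K.measurable_act r]) (use assms in simp)
  have Yb: "(\<lambda>s. indicator Y (b l s) :: ennreal) \<in> borel_measurable M"
    by (rule measurable_compose[OF K.measurable_act borel_measurable_indicator[OF G.Y]]) (use assms in simp)
  have Ybr: "(\<lambda>s. indicator Y (b l s) * r s) \<in> borel_measurable M"
    by (rule borel_measurable_times_ennreal[OF Yb r])
  have "(\<integral>\<^sup>+s. indicator Y s * r (b (inv\<^bsub>K\<^esub> l) s) \<partial>M) = (\<integral>\<^sup>+s. indicator Y (b l s) * r (b (inv\<^bsub>K\<^esub> l) (b l s)) \<partial>M)"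
    using rb assms by (subst K.nn_integral_act[symmetric, of _ l]) (auto intro!: borel_measurable_times_ennreal)
  also have "\<dots> = (\<integral>\<^sup>+s. indicator Y (b l s) * r s \<partial>M)"
    using assms by (intro nn_integral_cong) (simp add: K.act_mult)
  \<comment> \<open>The preimage of \<open>Y\<close> under \<open>b l\<close> is another fundamental
    domain for \<open>G\<close>, since the actions commute. Unfolding compares it with
    \<open>Y\<close>: almost every orbit meets it exactly once, and \<open>r\<close> is constant
    along that orbit.\<close>
  also have "\<dots> = (\<integral>\<^sup>+g. (\<integral>\<^sup>+s. indicator Y (b l (a g s)) * r (a g s) * indicator Y s \<partial>M) \<partial>count_space (carrier G))"
    by (rule G.nn_integral_unfold[OF Ybr])
  also have "\<dots> = (\<integral>\<^sup>+s. (\<integral>\<^sup>+g. indicator Y (b l (a g s)) * r (a g s) * indicator Y s \<partial>count_space (carrier G)) \<partial>M)"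
  proof (rule nn_integral_count_space_nn_integral[symmetric, OF G.countable])
    fix g assume "g \<in> carrier G"
    then show "(\<lambda>s. indicator Y (b l (a g s)) * r (a g s) * indicator Y s) \<in> borel_measurable M"
      by (intro borel_measurable_times_ennreal measurable_compose[OF G.measurable_act Ybr]) auto
  qed
  also have "\<dots> = (\<integral>\<^sup>+s. indicator Y s * r s \<partial>M)"
  proof (rule nn_integral_cong_AE, rule AE_mp[OF AE_generic], intro AE_I2 impI)
    fix s assume s: "generic s"
    have sp: "s \<in> space M" using s by (simp add: generic_def)
    have gs: "G.good s" using s K.one_closed K.act_one[OF sp] unfolding generic_def by metis
    have gb: "\<exists>!g. g \<in> carrier G \<and> a (inv g) (b l s) \<in> Y"
      using s assms by (simp add: generic_def G.good_def)
    have one: "(\<integral>\<^sup>+g. indicator {g. b l (a g s) \<in> Y} g \<partial>count_space (carrier G)) = 1"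
    proof (rule nn_integral_count_space_unique)
      obtain g0 where g0: "g0 \<in> carrier G" "a (inv g0) (b l s) \<in> Y"
        "\<And>g. g \<in> carrier G \<Longrightarrow> a (inv g) (b l s) \<in> Y \<Longrightarrow> g = g0" using gb by blast
      show "\<exists>!g. g \<in> carrier G \<and> b l (a g s) \<in> Y"
      proof (rule ex1I[of _ "inv g0"])
        show "inv g0 \<in> carrier G \<and> b l (a (inv g0) s) \<in> Y"
          using g0(1,2) assms sp by (simp add: commute)
        fix g assume g: "g \<in> carrier G \<and> b l (a g s) \<in> Y"
        then have "a (inv (inv g)) (b l s) \<in> Y" using assms sp by (simp add: commute)
        then have "inv g = g0" using g by (intro g0(3)) auto
        then show "g = inv g0" using g by auto
      qed
    qed
    have "(\<integral>\<^sup>+g. indicator Y (b l (a g s)) * r (a g s) * indicator Y s \<partial>count_space (carrier G))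
        = (\<integral>\<^sup>+g. (indicator Y s * r s) * indicator {g. b l (a g s) \<in> Y} g \<partial>count_space (carrier G))"
      using R_act[OF gs] by (intro nn_integral_cong) (auto simp: r_def indicator_def)
    also have "\<dots> = indicator Y s * r s"
      by (subst nn_integral_cmult) (auto simp: one)
    finally show "(\<integral>\<^sup>+g. indicator Y (b l (a g s)) * r (a g s) * indicator Y s \<partial>count_space (carrier G)) = indicator Y s * r s" .
  qed
  also have "\<dots> = (\<integral>\<^sup>+s. indicator Y s * r (b (inv\<^bsub>K\<^esub> \<one>\<^bsub>K\<^esub>) s) \<partial>M)"
    by (intro nn_integral_cong) simp
  finally have "emeasure M (level l z P) = emeasure M (level \<one>\<^bsub>K\<^esub> z P)"
    using em[OF assms(1)] em[OF K.one_closed] by simp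
  then show ?thesis by (simp add: measure_def)
qed

end

section \<open>Induced cocycles and their means over spreading samples\<close>

locale coupled_cocycle = me_coupling G K M a b Y D
  for G :: "('g, 'x) monoid_scheme" (structure) and K :: "('k, 'y) monoid_scheme" (structure) and M :: "'s measure" and a b Y D +
  fixes f :: "'k \<Rightarrow> 'k \<Rightarrow> 'k \<Rightarrow> real" and C :: real
  assumes f_bound: "\<bar>f x y z\<bar> \<le> 3"
    and f_cocycle: "f y z w - f x z w + f x y w - f x y z = 0"
    and f_l2: "x \<in> carrier K \<Longrightarrow> y \<in> carrier K \<Longrightarrow> z \<in> carrier K \<Longrightarrow> finite W \<Longrightarrow> W \<subseteq> carrier K \<Longrightarrow>
      (\<Sum>g\<in>W. (f (g \<otimes>\<^bsub>K\<^esub> x) (g \<otimes>\<^bsub>K\<^esub> y) (g \<otimes>\<^bsub>K\<^esub> z))\<^sup>2) \<le> C"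
begin

text \<open>The cocycle of \<open>K\<close> pulled back along the maps \<open>ev _ s\<close> and
  integrated over \<open>A\<close>. The set is a parameter because it will be a piece of
  \<open>Y\<close> on which the return elements are constant.\<close>

definition ind_f :: "'s set \<Rightarrow> 'g \<Rightarrow> 'g \<Rightarrow> 'g \<Rightarrow> real" where
  "ind_f A x y z = (\<integral>s. indicator A s * f (ev x s) (ev y s) (ev z s) \<partial>M)"

text \<open>Unfolding along \<open>K\<close> turns the integral over the infinite coupling into one
  over \<open>D\<close>, whose integrand is a sum along a diagonal orbit and so at most
  \<open>C\<close>.\<close>

lemma nn_integral_f_square_le:
  assumes "x \<in> carrier G" "y \<in> carrier G" "z \<in> carrier G"
  shows "(\<integral>\<^sup>+s. ennreal ((f (ev x s) (ev y s) (ev z s))\<^sup>2) \<partial>M) \<le> ennreal (C * \<mu> D)"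
proof -
  define \<phi> where "\<phi> s = ennreal ((f (ev x s) (ev y s) (ev z s))\<^sup>2)" for s
  have "(\<lambda>s. f (ev x s) (ev y s) (ev z s)) \<in> borel_measurable M"
    by (intro measurable_three measurable_ev assms)
  then have m: "\<phi> \<in> borel_measurable M" unfolding \<phi>_def[abs_def] by simp
  have C0: "C \<ge> 0" using f_l2[of "\<one>\<^bsub>K\<^esub>" "\<one>\<^bsub>K\<^esub>" "\<one>\<^bsub>K\<^esub>" "{}"] by simp
  have mb: "(\<lambda>s. \<phi> (b h s) * indicator D s) \<in> borel_measurable M" if "h \<in> carrier K" for h
    using measurable_compose[OF K.measurable_act[OF that] m] by (intro borel_measurable_times_ennreal) auto
  have "(\<integral>\<^sup>+s. \<phi> s \<partial>M) = (\<integral>\<^sup>+h. (\<integral>\<^sup>+s. \<phi> (b h s) * indicator D s \<partial>M) \<partial>count_space (carrier K))"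
    by (rule K.nn_integral_unfold[OF m])
  also have "\<dots> = (\<integral>\<^sup>+s. (\<integral>\<^sup>+h. \<phi> (b h s) * indicator D s \<partial>count_space (carrier K)) \<partial>M)"
    using mb by (intro nn_integral_count_space_nn_integral[symmetric] K.countable)
  also have "\<dots> \<le> (\<integral>\<^sup>+s. ennreal C * indicator D s \<partial>M)"
  proof (rule nn_integral_mono_AE, rule AE_mp[OF AE_generic], intro AE_I2 impI)
    fix s assume s: "generic s"
    show "(\<integral>\<^sup>+h. \<phi> (b h s) * indicator D s \<partial>count_space (carrier K)) \<le> ennreal C * indicator D s"
    proof (rule nn_integral_count_space_le[OF K.countable])
      fix W assume W: "finite W" "W \<subseteq> carrier K"
      have "(\<Sum>h\<in>W. \<phi> (b h s)) = ennreal (\<Sum>h\<in>W. (f (h \<otimes>\<^bsub>K\<^esub> ev x s) (h \<otimes>\<^bsub>K\<^esub> ev y s) (h \<otimes>\<^bsub>K\<^esub> ev z s))\<^sup>2)"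
        using W s assms by (subst sum_ennreal[symmetric]) (auto simp: \<phi>_def ev_act subset_iff intro!: sum.cong)
      also have "\<dots> \<le> ennreal C" using W by (intro ennreal_leI f_l2) auto
      finally show "(\<Sum>h\<in>W. \<phi> (b h s) * indicator D s) \<le> ennreal C * indicator D s"
        unfolding sum_distrib_right[symmetric] by (rule mult_right_mono) simp
    qed
  qed
  also have "\<dots> = ennreal C * emeasure M D" by (simp add: nn_integral_cmult_indicator)
  also have "\<dots> = ennreal (C * \<mu> D)" using C0 by (simp add: \<mu>_D ennreal_mult)
  finally show ?thesis by (simp add: \<phi>_def)
qed

text \<open>Translating the triple by g is the same as moving the point by \<open>inv g\<close>.
  After Cauchy-Schwarz on \<open>Y\<close>, the sum over g becomes a sum over disjoint translates of
  \<open>Y\<close>, bounded by the integral over the whole coupling.\<close>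

lemma ind_f_l2:
  assumes A: "A \<in> sets M" "A \<subseteq> Y" and xyz: "x \<in> carrier G" "y \<in> carrier G" "z \<in> carrier G"
    and W: "finite W" "W \<subseteq> carrier G"
  shows "(\<Sum>g\<in>W. (ind_f A (g \<otimes> x) (g \<otimes> y) (g \<otimes> z))\<^sup>2) \<le> \<mu> Y * (C * \<mu> D)"
proof -
  define \<phi> where "\<phi> s = f (ev x s) (ev y s) (ev z s)" for s
  have m: "\<phi> \<in> borel_measurable M"
    unfolding \<phi>_def[abs_def] by (intro measurable_three measurable_ev xyz)
  have C0: "C \<ge> 0" using f_l2[of "\<one>\<^bsub>K\<^esub>" "\<one>\<^bsub>K\<^esub>" "\<one>\<^bsub>K\<^esub>" "{}"] by simp
  define J where "J g = (\<integral>s. indicator Y s * (\<phi> (a (inv g) s))\<^sup>2 \<partial>M)" for g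
  have mg: "(\<lambda>s. \<phi> (a (inv g) s)) \<in> borel_measurable M" if "g \<in> carrier G" for g
    using measurable_compose[OF G.measurable_act m] that by simp
  have J_eq: "ennreal (J g) = (\<integral>\<^sup>+s. ennreal ((\<phi> (a (inv g) s))\<^sup>2) * indicator Y s \<partial>M)" if g: "g \<in> carrier G" for g
  proof -
    have "integrable M (\<lambda>s. indicator Y s * (\<phi> (a (inv g) s))\<^sup>2)"
    proof (rule integrable_on_Y[OF G.Y order_refl])
      show "(\<lambda>s. (\<phi> (a (inv g) s))\<^sup>2) \<in> borel_measurable M" using mg[OF g] by simp
      have "\<bar>\<phi> t\<bar>\<^sup>2 \<le> 3\<^sup>2" for t
        unfolding \<phi>_def by (intro power_mono f_bound abs_ge_zero)
      then show "\<bar>(\<phi> (a (inv g) s))\<^sup>2\<bar> \<le> 3\<^sup>2" for s by simp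
    qed
    then have "(\<integral>\<^sup>+s. ennreal (indicator Y s * (\<phi> (a (inv g) s))\<^sup>2) \<partial>M) = ennreal (J g)"
      unfolding J_def by (intro nn_integral_eq_integral) auto
    moreover have "(\<integral>\<^sup>+s. ennreal (indicator Y s * (\<phi> (a (inv g) s))\<^sup>2) \<partial>M) =
        (\<integral>\<^sup>+s. ennreal ((\<phi> (a (inv g) s))\<^sup>2) * indicator Y s \<partial>M)"
      by (intro nn_integral_cong) (auto simp: indicator_def)
    ultimately show ?thesis by simp
  qed
  have J0: "J g \<ge> 0" for g unfolding J_def by (intro integral_nonneg_AE AE_I2) simp
  have "ennreal (\<Sum>g\<in>W. J g) = (\<Sum>g\<in>W. ennreal (J g))" using J0 by (intro sum_ennreal[symmetric])
  also have "\<dots> = (\<Sum>g\<in>W. \<integral>\<^sup>+s. ennreal ((\<phi> (a (inv g) s))\<^sup>2) * indicator Y s \<partial>M)"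
    using W by (intro sum.cong refl J_eq) auto
  also have "\<dots> \<le> (\<integral>\<^sup>+s. ennreal ((\<phi> s)\<^sup>2) \<partial>M)"
    using m W by (intro G.nn_integral_translates_le) auto
  also have "\<dots> \<le> ennreal (C * \<mu> D)"
    unfolding \<phi>_def by (rule nn_integral_f_square_le[OF xyz])
  finally have "(\<Sum>g\<in>W. J g) \<le> C * \<mu> D" using C0 by (simp add: ennreal_le_iff)
  moreover have "(ind_f A (g \<otimes> x) (g \<otimes> y) (g \<otimes> z))\<^sup>2 \<le> \<mu> Y * J g" if g: "g \<in> W" for g
  proof -
    have gc: "g \<in> carrier G" using g W by auto
    have "ind_f A (g \<otimes> x) (g \<otimes> y) (g \<otimes> z) = (\<integral>s. indicator A s * \<phi> (a (inv g) s) \<partial>M)"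
      unfolding ind_f_def \<phi>_def using gc xyz by (intro Bochner_Integration.integral_cong) (auto simp: ev_mult)
    then show ?thesis
      using square_integral_le[OF A mg[OF gc], of 3] f_bound by (simp add: J_def \<phi>_def)
  qed
  then have "(\<Sum>g\<in>W. (ind_f A (g \<otimes> x) (g \<otimes> y) (g \<otimes> z))\<^sup>2) \<le> \<mu> Y * (\<Sum>g\<in>W. J g)"
    unfolding sum_distrib_left by (rule sum_mono)
  ultimately show ?thesis using \<mu>_Y(2) by (meson mult_left_mono less_imp_le order_trans)
qed

lemma ind_f_cocycle:
  assumes A: "A \<in> sets M" "A \<subseteq> Y" and x: "x \<in> carrier G" "y \<in> carrier G" "z \<in> carrier G" "w \<in> carrier G"
  shows "ind_f A y z w - ind_f A x z w + ind_f A x y w - ind_f A x y z = 0"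
proof -
  have i: "integrable M (\<lambda>s. indicator A s * f (ev x s) (ev y s) (ev z s))"
    if "x \<in> carrier G" "y \<in> carrier G" "z \<in> carrier G" for x y z
    using that f_bound by (intro integrable_on_Y[OF A, of _ 3] measurable_three measurable_ev) auto
  have "ind_f A y z w - ind_f A x z w + ind_f A x y w - ind_f A x y z =
    (\<integral>s. indicator A s * f (ev y s) (ev z s) (ev w s) - indicator A s * f (ev x s) (ev z s) (ev w s)
        + indicator A s * f (ev x s) (ev y s) (ev w s) - indicator A s * f (ev x s) (ev y s) (ev z s) \<partial>M)"
    unfolding ind_f_def using i x by simp
  also have "\<dots> = (\<integral>s. 0 \<partial>M)"
  proof (intro Bochner_Integration.integral_cong refl)
    fix s
    show "indicator A s * f (ev y s) (ev z s) (ev w s) - indicator A s * f (ev x s) (ev z s) (ev w s)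
        + indicator A s * f (ev x s) (ev y s) (ev w s) - indicator A s * f (ev x s) (ev y s) (ev z s) = 0"
      using f_cocycle[of "ev y s" "ev z s" "ev w s" "ev x s"] by (auto simp: indicator_def)
  qed
  finally show ?thesis by simp
qed

text \<open>Outside the class the induced cocycle has a primitive that is square summable along
  diagonal orbits. Each of the three terms of its coboundary involves only two of the three samples;
  the third averages out, and spreading makes the rest small. \<open>B\<close> is fixed before the
  accuracy \<eta> and the law are chosen.\<close>

lemma ind_f_small:
  assumes A: "A \<in> sets M" "A \<subseteq> Y" and nC: "\<not> class_C_reg G"
  shows "\<exists>B\<ge>0. \<forall>\<eta> F (I :: 'i set) q z. F \<subseteq> carrier G \<and> G.spreads F \<eta> I q z \<longrightarrow>
    (\<forall>g0\<in>F. \<forall>g1\<in>F. \<forall>g2\<in>F.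
      \<bar>mean3 I q (\<lambda>i j k. ind_f A (g0 \<otimes> z i) (g1 \<otimes> z j) (g2 \<otimes> z k))\<bar> \<le> \<eta> * B)"
proof -
  obtain h :: "'g \<Rightarrow> 'g \<Rightarrow> complex" and C' where
    h: "\<And>x y z. x \<in> carrier G \<Longrightarrow> y \<in> carrier G \<Longrightarrow> z \<in> carrier G \<Longrightarrow>
        complex_of_real (ind_f A x y z) = h y z - h x z + h x y"
    and C': "\<And>x y W. x \<in> carrier G \<Longrightarrow> y \<in> carrier G \<Longrightarrow> finite W \<Longrightarrow> W \<subseteq> carrier G \<Longrightarrow>
        (\<Sum>g\<in>W. (cmod (h (g \<otimes> x) (g \<otimes> y)))\<^sup>2) \<le> C'"
    using scalar_primitive_if_not_C_reg[OF G.is_group G.countable nC, of "ind_f A" "\<mu> Y * (C * \<mu> D)",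
        OF ind_f_cocycle[OF A] ind_f_l2[OF A]] by blast
  have C'0: "C' \<ge> 0" using C'[of "\<one>" "\<one>" "{}"] by simp
  show ?thesis
  proof (intro exI[of _ "3 * (C' + 1)"] conjI allI impI ballI)
    fix \<eta> F and I :: "'i set" and q z g0 g1 g2
    assume FG: "F \<subseteq> carrier G \<and> G.spreads F \<eta> I q z" and g: "g0 \<in> F" "g1 \<in> F" "g2 \<in> F"
    then have I: "finite I" "\<And>i. i \<in> I \<Longrightarrow> q i \<ge> 0" "sum q I = 1" "\<And>i. i \<in> I \<Longrightarrow> z i \<in> carrier G"
      by (auto simp: G.spreads_def)
    define k where "k x y = cmod (h x y)" for x y
    have small: "(\<Sum>i\<in>I. \<Sum>j\<in>I. q i * q j * k (u \<otimes> z i) (v \<otimes> z j)) \<le> \<eta> * (C' + 1)"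
      if "u \<in> F" "v \<in> F" for u v
    proof -
      have "\<forall>x y. k x y \<ge> 0" by (simp add: k_def)
      moreover have "\<forall>x\<in>carrier G. \<forall>y\<in>carrier G. \<forall>W. finite W \<and> W \<subseteq> carrier G \<longrightarrow>
          (\<Sum>g\<in>W. (k (g \<otimes> x) (g \<otimes> y))\<^sup>2) \<le> C'"
        using C' by (simp add: k_def)
      ultimately show ?thesis using FG that unfolding G.spreads_def by blast
    qed
    have gG: "g0 \<in> carrier G" "g1 \<in> carrier G" "g2 \<in> carrier G" using g FG by auto
    let ?x = "\<lambda>i. g0 \<otimes> z i" and ?y = "\<lambda>j. g1 \<otimes> z j" and ?z = "\<lambda>k. g2 \<otimes> z k"
    have pt: "\<bar>ind_f A (?x i) (?y j) (?z l)\<bar> \<le> k (?y j) (?z l) + k (?x i) (?z l) + k (?x i) (?y j)"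
      if "i \<in> I" "j \<in> I" "l \<in> I" for i j l
    proof -
      have "\<bar>ind_f A (?x i) (?y j) (?z l)\<bar> = cmod (complex_of_real (ind_f A (?x i) (?y j) (?z l)))" by simp
      also have "\<dots> = cmod (h (?y j) (?z l) - h (?x i) (?z l) + h (?x i) (?y j))"
        using h[of "?x i" "?y j" "?z l"] gG I(4) that by simp
      also have "\<dots> \<le> k (?y j) (?z l) + k (?x i) (?z l) + k (?x i) (?y j)"
        unfolding k_def by (meson add_mono norm_triangle_ineq norm_triangle_ineq4 order_trans order_refl)
      finally show ?thesis .
    qed
    have "\<bar>\<Sum>i\<in>I. \<Sum>j\<in>I. \<Sum>l\<in>I. q i * q j * q l * ind_f A (?x i) (?y j) (?z l)\<bar>
        \<le> (\<Sum>i\<in>I. \<Sum>j\<in>I. \<Sum>l\<in>I. \<bar>q i * q j * q l * ind_f A (?x i) (?y j) (?z l)\<bar>)"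
      by (intro order_trans[OF sum_abs] sum_mono order_refl)
    also have "\<dots> \<le> (\<Sum>i\<in>I. \<Sum>j\<in>I. \<Sum>l\<in>I. q i * q j * q l *
        (k (?y j) (?z l) + k (?x i) (?z l) + k (?x i) (?y j)))"
    proof (intro sum_mono)
      fix i j l assume "i \<in> I" "j \<in> I" "l \<in> I"
      then show "\<bar>q i * q j * q l * ind_f A (?x i) (?y j) (?z l)\<bar> \<le>
         q i * q j * q l * (k (?y j) (?z l) + k (?x i) (?z l) + k (?x i) (?y j))"
        using pt I(2) by (simp add: abs_mult mult_left_mono)
    qed
    also have "\<dots> = (\<Sum>i\<in>I. \<Sum>j\<in>I. \<Sum>l\<in>I. q i * (q j * q l * k (?y j) (?z l)))
        + (\<Sum>i\<in>I. \<Sum>j\<in>I. \<Sum>l\<in>I. q j * (q i * q l * k (?x i) (?z l)))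
        + (\<Sum>i\<in>I. \<Sum>j\<in>I. \<Sum>l\<in>I. q l * (q i * q j * k (?x i) (?y j)))"
      unfolding sum.distrib[symmetric] by (intro sum.cong refl) (simp add: algebra_simps)
    also have "(\<Sum>i\<in>I. \<Sum>j\<in>I. \<Sum>l\<in>I. q i * (q j * q l * k (?y j) (?z l)))
        = sum q I * (\<Sum>j\<in>I. \<Sum>l\<in>I. q j * q l * k (?y j) (?z l))"
      by (simp only: sum_distrib_left[symmetric] sum_distrib_right[symmetric])
    also have "(\<Sum>i\<in>I. \<Sum>j\<in>I. \<Sum>l\<in>I. q j * (q i * q l * k (?x i) (?z l)))
        = sum q I * (\<Sum>i\<in>I. \<Sum>l\<in>I. q i * q l * k (?x i) (?z l))"
      by (subst sum.swap) (simp only: sum_distrib_left[symmetric] sum_distrib_right[symmetric])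
    also have "(\<Sum>i\<in>I. \<Sum>j\<in>I. \<Sum>l\<in>I. q l * (q i * q j * k (?x i) (?y j)))
        = sum q I * (\<Sum>i\<in>I. \<Sum>j\<in>I. q i * q j * k (?x i) (?y j))"
      by (simp only: sum_distrib_right[symmetric]) (simp only: sum_distrib_left)
    also have "sum q I * (\<Sum>j\<in>I. \<Sum>l\<in>I. q j * q l * k (?y j) (?z l))
       + sum q I * (\<Sum>i\<in>I. \<Sum>l\<in>I. q i * q l * k (?x i) (?z l))
       + sum q I * (\<Sum>i\<in>I. \<Sum>j\<in>I. q i * q j * k (?x i) (?y j)) \<le> \<eta> * (3 * (C' + 1))"
    proof -
      have "\<eta> * (3 * (C' + 1)) = \<eta> * (C' + 1) + \<eta> * (C' + 1) + \<eta> * (C' + 1)" by (simp add: algebra_simps)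
      then show ?thesis
        unfolding I(3) mult_1 using small[OF g(2,3)] small[OF g(1,3)] small[OF g(1,2)] by linarith
    qed
    finally show "\<bar>mean3 I q (\<lambda>i j k. ind_f A (?x i) (?y j) (?z k))\<bar> \<le> \<eta> * (3 * (C' + 1))"
      by (simp only: mean3_def)
  qed (use C'0 in simp)
qed

text \<open>The return elements vary with s, but on \<open>E\<close> they take values in a finite
  set. Cutting \<open>E\<close> along these values makes the translations constant on each piece,
  where the mean of the induced cocycle is small; the constants of the pieces add up.\<close>

lemma restricted_mean_small:
  assumes E: "E \<in> sets M" "E \<subseteq> Y" and nC: "\<not> class_C_reg G"
    and l: "l0 \<in> carrier K" "l1 \<in> carrier K" "l2 \<in> carrier K"
    and F: "finite F" "F \<subseteq> carrier G" "\<And>s. s \<in> E \<Longrightarrow> gm l0 s \<in> F \<and> gm l1 s \<in> F \<and> gm l2 s \<in> F"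
  shows "\<exists>B\<ge>0. \<forall>\<eta> (I :: 'i set) q z. G.spreads F \<eta> I q z \<longrightarrow>
      mean3 I q (\<lambda>i j k. sampled f E l0 l1 l2 (z i) (z j) (z k)) \<le> \<eta> * B"
proof -
  define T where "T = F \<times> F \<times> F"
  have T: "finite T" using F by (simp add: T_def)
  define A where "A t = {s \<in> E. gm l0 s = fst t \<and> gm l1 s = fst (snd t) \<and> gm l2 s = snd (snd t)}" for t
  have A: "A t \<in> sets M" "A t \<subseteq> Y" if "t \<in> T" for t
  proof -
    have eq: "A t = E \<inter> (gm l0 -` {fst t} \<inter> space M) \<inter> (gm l1 -` {fst (snd t)} \<inter> space M) \<inter> (gm l2 -` {snd (snd t)} \<inter> space M)"
      using sets.sets_into_space[OF E(1)] by (auto simp: A_def)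
    show "A t \<in> sets M"
      unfolding eq using that F
      by (intro sets.Int E measurable_sets[OF measurable_gm]) (auto simp: T_def l)
    show "A t \<subseteq> Y" using E by (auto simp: A_def)
  qed
  define Q where "Q t B \<longleftrightarrow> B \<ge> 0 \<and> (\<forall>\<eta> F (I :: 'i set) q z. F \<subseteq> carrier G \<and> G.spreads F \<eta> I q z \<longrightarrow>
    (\<forall>g0\<in>F. \<forall>g1\<in>F. \<forall>g2\<in>F.
      \<bar>mean3 I q (\<lambda>i j k. ind_f (A t) (g0 \<otimes> z i) (g1 \<otimes> z j) (g2 \<otimes> z k))\<bar> \<le> \<eta> * B))"
    for t B
  have "\<forall>t\<in>T. \<exists>B. Q t B"
  proof
    fix t assume "t \<in> T"
    from ind_f_small[OF A[OF this] nC] show "\<exists>B. Q t B" unfolding Q_def by (elim exE conjE) (intro exI conjI)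
  qed
  from bchoice[OF this] obtain B where QB: "\<forall>t\<in>T. Q t (B t)" by blast
  have B: "B t \<ge> 0" if "t \<in> T" for t using QB that by (simp add: Q_def)
  have B': "\<bar>mean3 I q (\<lambda>i j k. ind_f (A t) (g0 \<otimes> z i) (g1 \<otimes> z j) (g2 \<otimes> z k))\<bar> \<le> \<eta> * B t"
    if "t \<in> T" "G.spreads F \<eta> I q z" "g0 \<in> F" "g1 \<in> F" "g2 \<in> F" for t \<eta> and I :: "'i set" and q z g0 g1 g2
  proof -
    have "Q t (B t)" using QB that(1) by blast
    then show ?thesis unfolding Q_def using that(2-5) F(2) by simp
  qed
  show ?thesis
  proof (intro exI[of _ "sum B T"] conjI allI impI)
    show "sum B T \<ge> 0" by (intro sum_nonneg B)
    fix \<eta> and I :: "'i set" and q z assume sp: "G.spreads F \<eta> I q z"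
    then have z: "z i \<in> carrier G" if "i \<in> I" for i using that by (simp add: G.spreads_def)
    let ?f = "\<lambda>t i j k. ind_f (A t) (fst t \<otimes> z i) (fst (snd t) \<otimes> z j) (snd (snd t) \<otimes> z k)"
    have split: "sampled f E l0 l1 l2 (z i) (z j) (z k) = (\<Sum>t\<in>T. ?f t i j k)" if "i \<in> I" "j \<in> I" "k \<in> I" for i j k
    proof -
      define \<phi> where "\<phi> t s = f (ev (fst t \<otimes> z i) s) (ev (fst (snd t) \<otimes> z j) s) (ev (snd (snd t) \<otimes> z k) s)" for t s
      have "indicator E s * f (ev (gm l0 s \<otimes> z i) s) (ev (gm l1 s \<otimes> z j) s) (ev (gm l2 s \<otimes> z k) s)
          = (\<Sum>t\<in>T. indicator (A t) s * \<phi> t s)" for s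
      proof (cases "s \<in> E")
        case True
        define t0 where "t0 = (gm l0 s, gm l1 s, gm l2 s)"
        have "t0 \<in> T" using F(3)[OF True] by (simp add: t0_def T_def)
        have "(\<Sum>t\<in>T. indicator (A t) s * \<phi> t s) = (\<Sum>t\<in>T. if t = t0 then \<phi> t s else 0)"
          using True by (intro sum.cong refl) (auto simp: A_def t0_def indicator_def)
        also have "\<dots> = \<phi> t0 s" using T \<open>t0 \<in> T\<close> by simp
        finally show ?thesis using True by (simp add: \<phi>_def t0_def)
      next
        case False
        then show ?thesis by (simp add: A_def)
      qed
      then have "sampled f E l0 l1 l2 (z i) (z j) (z k) = (\<integral>s. (\<Sum>t\<in>T. indicator (A t) s * \<phi> t s) \<partial>M)"
        by (simp only: sampled_def)
      also have "\<dots> = (\<Sum>t\<in>T. \<integral>s. indicator (A t) s * \<phi> t s \<partial>M)"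
      proof (rule Bochner_Integration.integral_sum)
        fix t assume t: "t \<in> T"
        then have "fst t \<in> carrier G" "fst (snd t) \<in> carrier G" "snd (snd t) \<in> carrier G"
          using F(2) by (auto simp: T_def)
        then show "integrable M (\<lambda>s. indicator (A t) s * \<phi> t s)"
          unfolding \<phi>_def using z that f_bound
          by (intro integrable_on_Y[OF A[OF t], of _ 3] measurable_three measurable_ev) auto
      qed
      finally show ?thesis by (simp add: ind_f_def \<phi>_def)
    qed
    have "mean3 I q (\<lambda>i j k. sampled f E l0 l1 l2 (z i) (z j) (z k))
      = (\<Sum>i\<in>I. \<Sum>j\<in>I. \<Sum>k\<in>I. \<Sum>t\<in>T. q i * q j * q k * ?f t i j k)"
      unfolding mean3_def by (intro sum.cong refl) (simp add: split sum_distrib_left)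
    also have "\<dots> = (\<Sum>t\<in>T. \<Sum>i\<in>I. \<Sum>j\<in>I. \<Sum>k\<in>I. q i * q j * q k * ?f t i j k)"
      by (simp only: sum.swap[of _ T])
    also have "\<dots> \<le> (\<Sum>t\<in>T. \<eta> * B t)"
    proof (intro sum_mono)
      fix t assume t: "t \<in> T"
      then have "fst t \<in> F" "fst (snd t) \<in> F" "snd (snd t) \<in> F" by (auto simp: T_def)
      then show "(\<Sum>i\<in>I. \<Sum>j\<in>I. \<Sum>k\<in>I. q i * q j * q k * ?f t i j k) \<le> \<eta> * B t"
        using B'[OF t sp] abs_le_D1 unfolding mean3_def by blast
    qed
    also have "\<dots> = \<eta> * sum B T" by (simp add: sum_distrib_left)
    finally show "mean3 I q (\<lambda>i j k. sampled f E l0 l1 l2 (z i) (z j) (z k)) \<le> \<eta> * sum B T" .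
  qed
qed

end

section \<open>A lower bound for the mean, and the contradiction\<close>

lemma mean3_affine:
  fixes q \<alpha> \<beta> \<gamma> :: "'i \<Rightarrow> real"
  assumes "sum q I = 1"
  shows "mean3 I q (\<lambda>i j k. c - 4 * (\<alpha> i + \<beta> j + \<gamma> k)) =
    c - 4 * ((\<Sum>i\<in>I. q i * \<alpha> i) + (\<Sum>i\<in>I. q i * \<beta> i) + (\<Sum>i\<in>I. q i * \<gamma> i))"
proof -
  have lin: "(\<Sum>k\<in>I. r * q k * (e - 4 * \<gamma> k)) = r * (e - 4 * (\<Sum>k\<in>I. q k * \<gamma> k))" for r e and \<gamma> :: "'i \<Rightarrow> real"
  proof -
    have "(\<Sum>k\<in>I. r * q k * (e - 4 * \<gamma> k)) = r * (e * sum q I - 4 * (\<Sum>k\<in>I. q k * \<gamma> k))"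
      by (simp add: sum_distrib_left sum_subtractf right_diff_distrib algebra_simps)
    then show ?thesis using assms by simp
  qed
  have "mean3 I q (\<lambda>i j k. c - 4 * (\<alpha> i + \<beta> j + \<gamma> k))
      = (\<Sum>i\<in>I. \<Sum>j\<in>I. \<Sum>k\<in>I. q i * q j * q k * ((c - 4 * \<alpha> i - 4 * \<beta> j) - 4 * \<gamma> k))"
    unfolding mean3_def by (simp add: algebra_simps)
  also have "\<dots> = (\<Sum>i\<in>I. \<Sum>j\<in>I. q i * q j * ((c - 4 * \<alpha> i - 4 * (\<Sum>k\<in>I. q k * \<gamma> k)) - 4 * \<beta> j))"
    by (intro sum.cong refl) (simp only: lin, simp add: algebra_simps)
  also have "\<dots> = (\<Sum>i\<in>I. 1 * q i * ((c - 4 * (\<Sum>k\<in>I. q k * \<gamma> k) - 4 * (\<Sum>k\<in>I. q k * \<beta> k)) - 4 * \<alpha> i))"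
    by (intro sum.cong refl) (simp only: lin, simp add: algebra_simps)
  also have "\<dots> = c - 4 * ((\<Sum>i\<in>I. q i * \<alpha> i) + (\<Sum>i\<in>I. q i * \<beta> i) + (\<Sum>i\<in>I. q i * \<gamma> i))"
    by (simp only: lin) (simp add: algebra_simps)
  finally show ?thesis .
qed

context me_coupling
begin

lemma measurable_ev_gm:
  assumes "l \<in> carrier K" "z \<in> carrier G"
  shows "(\<lambda>s. ev (gm l s \<otimes> z) s) \<in> M \<rightarrow>\<^sub>M count_space (carrier K)"
  by (rule measurable_compose_countable'[of "carrier G" "\<lambda>g s. ev (g \<otimes> z) s",
        OF measurable_ev measurable_gm G.countable]) (use assms in auto)

lemma level_subset: "level l z P \<subseteq> Y" by (auto simp: level_def)

lemma fmeasurable_Y: "Y \<in> fmeasurable M"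
  using G.fin by (intro fmeasurableI) auto

text \<open>Disjoint repelling sets have disjoint levels in \<open>Y\<close>. This replaces any
  knowledge of where the samples land.\<close>

lemma sum_measure_level_le:
  fixes bad :: "nat \<Rightarrow> 'k set"
  assumes "disjoint_family_on bad {..<J}" "l \<in> carrier K" "z \<in> carrier G"
  shows "(\<Sum>j<J. \<mu> (level l z (bad j))) \<le> \<mu> Y"
proof -
  have "(\<Sum>j<J. \<mu> (level l z (bad j))) = \<mu> (\<Union>j<J. level l z (bad j))"
  proof (rule measure_finite_Union[symmetric])
    show "disjoint_family_on (\<lambda>j. level l z (bad j)) {..<J}"
      using assms(1) by (fastforce simp: disjoint_family_on_def level_def)
    fix j assume "j \<in> {..<J}"
    have "emeasure M (level l z (bad j)) \<le> emeasure M Y" by (intro emeasure_mono level_subset G.Y)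
    then show "emeasure M (level l z (bad j)) \<noteq> \<infinity>" using G.fin by (auto simp: top_unique)
  qed (use sets_level assms in auto)
  also have "\<dots> \<le> \<mu> Y"
    using sets_level assms by (intro measure_mono_fmeasurable fmeasurable_Y UN_least level_subset) auto
  finally show ?thesis .
qed

text \<open>For finitely many \<open>l j\<close> the return elements are exhausted by the initial
  segments of an enumeration of the group, so continuity of the measure from below leaves only a
  small part of \<open>Y\<close> uncaptured.\<close>

lemma obtain_finite_return_set:
  fixes l :: "nat \<Rightarrow> 'k"
  assumes l: "\<And>j. j < J \<Longrightarrow> l j \<in> carrier K" and \<tau>: "\<tau> > 0"
  obtains F E where "finite F" "F \<noteq> {}" "F \<subseteq> carrier G" "E \<in> sets M" "E \<subseteq> Y" "\<mu> E > \<mu> Y - \<tau>"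
    "\<And>s j. s \<in> E \<Longrightarrow> j < J \<Longrightarrow> gm (l j) s \<in> F"
proof -
  define F where "F n = from_nat_into (carrier G) ` {..n}" for n :: nat
  define E where "E n = {s \<in> Y. \<forall>j<J. gm (l j) s \<in> F n}" for n
  have ne: "carrier G \<noteq> {}" using G.one_closed by blast
  have FG: "F n \<subseteq> carrier G" for n using from_nat_into[OF ne] by (auto simp: F_def)
  have mono: "F m \<subseteq> F n" if "m \<le> n" for m n using that by (auto simp: F_def)
  have E: "E n \<in> sets M" for n
  proof -
    have "{s \<in> space M. gm (l j) s \<in> F n} \<in> sets M" if "j \<in> {..<J}" for j
    proof -
      have "gm (l j) -` (F n) \<inter> space M \<in> sets M"
        using FG l that by (intro measurable_sets[OF measurable_gm]) auto
      then show ?thesis by (simp add: vimage_def Int_def conj_commute)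
    qed
    then have "{s \<in> space M. \<forall>j\<in>{..<J}. gm (l j) s \<in> F n} \<in> sets M"
      by (rule sets.sets_Collect_finite_All) simp_all
    moreover have "E n = Y \<inter> {s \<in> space M. \<forall>j\<in>{..<J}. gm (l j) s \<in> F n}"
      using sets.sets_into_space[OF G.Y] by (auto simp: E_def)
    ultimately show ?thesis using G.Y by simp
  qed
  have inc: "incseq E" using mono by (fastforce simp: incseq_def E_def)
  have "(\<Union>n. E n) = Y"
  proof (intro equalityI subsetI)
    fix s assume s: "s \<in> Y"
    have "\<exists>n. gm (l j) s = from_nat_into (carrier G) n" for j
      using from_nat_into_surj[OF G.countable gm_closed] by metis
    then obtain m where m: "\<And>j. gm (l j) s = from_nat_into (carrier G) (m j)" by metis
    have "m j \<le> (\<Sum>j<J. m j)" if "j < J" for j using that by (intro member_le_sum) auto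
    then have "s \<in> E (\<Sum>j<J. m j)" using s m by (auto simp: E_def F_def)
    then show "s \<in> (\<Union>n. E n)" by blast
  qed (auto simp: E_def)
  moreover have "range E \<subseteq> sets M" using E by auto
  ultimately have "(\<lambda>n. \<mu> (E n)) \<longlonglongrightarrow> \<mu> Y"
    using Lim_measure_incseq[OF _ inc, of M] G.fin by (metis less_irrefl)
  then have "\<forall>\<^sub>F n in sequentially. \<mu> (E n) > \<mu> Y - \<tau>"
    using \<tau> by (intro order_tendstoD(1)) auto
  then obtain n where "\<mu> (E n) > \<mu> Y - \<tau>" by (auto simp: eventually_sequentially)
  moreover have "finite (F n)" "F n \<noteq> {}" by (auto simp: F_def)
  moreover have "E n \<subseteq> Y" "\<And>s j. s \<in> E n \<Longrightarrow> j < J \<Longrightarrow> gm (l j) s \<in> F n" by (auto simp: E_def)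
  ultimately show thesis using that[of "F n" "E n"] E FG by blast
qed

text \<open>On \<open>E\<close> outside the three levels the integrand is 1, and elsewhere it is at
  least -3 on \<open>E\<close>. The drop from 1 to -3 is the factor 4.\<close>

lemma integral_good_ge:
  fixes f :: "'k \<Rightarrow> 'k \<Rightarrow> 'k \<Rightarrow> real"
  assumes E: "E \<in> sets M" "E \<subseteq> Y" and f: "\<And>x y z. \<bar>f x y z\<bar> \<le> 3"
    and l: "l0 \<in> carrier K" "l1 \<in> carrier K" "l2 \<in> carrier K" and z: "z0 \<in> carrier G" "z1 \<in> carrier G" "z2 \<in> carrier G"
    and one: "\<And>x y z. x \<in> carrier K \<Longrightarrow> y \<in> carrier K \<Longrightarrow> z \<in> carrier K \<Longrightarrow> x \<notin> P0 \<Longrightarrow> y \<notin> P1 \<Longrightarrow> z \<notin> P2 \<Longrightarrow>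
        f (l0 \<otimes>\<^bsub>K\<^esub> x) (l1 \<otimes>\<^bsub>K\<^esub> y) (l2 \<otimes>\<^bsub>K\<^esub> z) = 1"
  shows "\<mu> E - 4 * (\<mu> (level l0 z0 P0) + \<mu> (level l1 z1 P1) + \<mu> (level l2 z2 P2)) \<le>
    sampled f E l0 l1 l2 z0 z1 z2"
proof -
  let ?L0 = "level l0 z0 P0" and ?L1 = "level l1 z1 P1" and ?L2 = "level l2 z2 P2"
  have ind: "integrable M (indicator A :: 's \<Rightarrow> real)" "(\<integral>s. indicator A s \<partial>M) = \<mu> A" if "A \<in> sets M" "A \<subseteq> Y" for A
  proof -
    have "emeasure M A \<le> emeasure M Y" using that(2) by (intro emeasure_mono G.Y)
    then have "emeasure M A < \<infinity>" using G.fin by (rule le_less_trans)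
    then show "integrable M (indicator A :: 's \<Rightarrow> real)" using that(1) by simp
    show "(\<integral>s. indicator A s \<partial>M) = \<mu> A" using sets.sets_into_space[OF that(1)] by (simp add: Int_absorb2)
  qed
  note indE = ind[OF E] and indL0 = ind[OF sets_level[OF l(1) z(1), of P0] level_subset]
    and indL1 = ind[OF sets_level[OF l(2) z(2), of P1] level_subset]
    and indL2 = ind[OF sets_level[OF l(3) z(3), of P2] level_subset]
  have "\<mu> E - 4 * (\<mu> ?L0 + \<mu> ?L1 + \<mu> ?L2) =
      (\<integral>s. indicator E s - 4 * (indicator ?L0 s + indicator ?L1 s + indicator ?L2 s) \<partial>M)"
    using indE indL0 indL1 indL2 by simp
  also have "\<dots> \<le> sampled f E l0 l1 l2 z0 z1 z2"
    unfolding sampled_def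
  proof (rule integral_mono_AE)
    show "integrable M (\<lambda>s. indicator E s - 4 * (indicator ?L0 s + indicator ?L1 s + indicator ?L2 s) :: real)"
      using indE indL0 indL1 indL2 by simp
    show "integrable M (\<lambda>s. indicator E s * f (ev (gm l0 s \<otimes> z0) s) (ev (gm l1 s \<otimes> z1) s) (ev (gm l2 s \<otimes> z2) s))"
      using f l z by (intro integrable_on_Y[OF E, of _ 3] measurable_three measurable_ev_gm) auto
    show "AE s in M. indicator E s - 4 * (indicator ?L0 s + indicator ?L1 s + indicator ?L2 s)
       \<le> indicator E s * f (ev (gm l0 s \<otimes> z0) s) (ev (gm l1 s \<otimes> z1) s) (ev (gm l2 s \<otimes> z2) s)"
    proof (rule AE_mp[OF AE_generic], intro AE_I2 impI)
      fix s assume s: "generic s"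
      define v where "v = f (ev (gm l0 s \<otimes> z0) s) (ev (gm l1 s \<otimes> z1) s) (ev (gm l2 s \<otimes> z2) s)"
      have v3: "v \<ge> - 3" using f[of "ev (gm l0 s \<otimes> z0) s"] unfolding v_def by (meson abs_le_D2 minus_le_iff)
      show "indicator E s - 4 * (indicator ?L0 s + indicator ?L1 s + indicator ?L2 s) \<le> indicator E s * v"
      proof (cases "s \<in> E \<and> s \<notin> ?L0 \<and> s \<notin> ?L1 \<and> s \<notin> ?L2")
        case True
        then have "v = 1"
          unfolding v_def ev_gm[OF s l(1) z(1)] ev_gm[OF s l(2) z(2)] ev_gm[OF s l(3) z(3)]
          using E(2) by (intro one) (auto simp: level_def)
        then show ?thesis using True by simp
      next
        case False
        then show ?thesis using v3 by (auto simp: indicator_def)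
      qed
    qed
  qed
  finally show ?thesis .
qed

text \<open>In units of \<open>\<mu> Y\<close>: \<open>E\<close> misses less than 1/8, and the three
  levels cost at most 4 * 3 / 48 = 1/4, so the mean exceeds 5/8, whereas spreading forces it to be
  at most 1/4. Fewer than 48 of the disjoint repelling sets can have mass above 1/48, hence 48 + 3 =
  51 candidates.\<close>

lemma class_C_reg_if_separated_attractors:
  fixes l :: "nat \<Rightarrow> 'k" and bad :: "nat \<Rightarrow> 'k set"
  assumes inf: "infinite (carrier G)" and l: "\<And>j. j < 51 \<Longrightarrow> l j \<in> carrier K"
    and disj: "disjoint_family_on bad {..<51}"
    and att: "\<And>i j k. i < 51 \<Longrightarrow> j < 51 \<Longrightarrow> k < 51 \<Longrightarrow> i \<noteq> j \<Longrightarrow> i \<noteq> k \<Longrightarrow> j \<noteq> k \<Longrightarrow>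
       \<exists>F C. l2_kernel K F C \<and> separates K F (l i, bad i) (l j, bad j) (l k, bad k)"
  shows "class_C_reg G"
proof (rule ccontr)
  assume nC: "\<not> class_C_reg G"
  obtain F E where F: "finite F" "F \<noteq> {}" "F \<subseteq> carrier G" and E: "E \<in> sets M" "E \<subseteq> Y" "\<mu> E > \<mu> Y - \<mu> Y / 8"
    and FE: "\<And>s j. s \<in> E \<Longrightarrow> j < 51 \<Longrightarrow> gm (l j) s \<in> F"
    using obtain_finite_return_set[of 51 l "\<mu> Y / 8"] l \<mu>_Y(2) by auto
  define small where "small i j k f B \<longleftrightarrow> B \<ge> 0 \<and> (\<forall>\<eta> (I :: (nat \<times> 'g list) set) q z. G.spreads F \<eta> I q z \<longrightarrow>
      mean3 I q (\<lambda>i' j' k'. sampled f E (l i) (l j) (l k) (z i') (z j') (z k')) \<le> \<eta> * B)"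
    for i j k and f :: "'k \<Rightarrow> 'k \<Rightarrow> 'k \<Rightarrow> real" and B
  define sep where "sep i j k f \<longleftrightarrow> (\<forall>x y z. \<bar>f x y z\<bar> \<le> 3) \<and>
      (\<forall>x\<in>carrier K. \<forall>y\<in>carrier K. \<forall>z\<in>carrier K. x \<notin> bad i \<and> y \<notin> bad j \<and> z \<notin> bad k \<longrightarrow>
          f (l i \<otimes>\<^bsub>K\<^esub> x) (l j \<otimes>\<^bsub>K\<^esub> y) (l k \<otimes>\<^bsub>K\<^esub> z) = 1)"
    for i j k and f :: "'k \<Rightarrow> 'k \<Rightarrow> 'k \<Rightarrow> real"
  define T where "T = {(i, j, k). i < (51::nat) \<and> j < (51::nat) \<and> k < (51::nat) \<and> i \<noteq> j \<and> i \<noteq> k \<and> j \<noteq> k}"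
  have "T \<subseteq> {..<51} \<times> {..<51} \<times> {..<51}" by (auto simp: T_def)
  then have T: "finite T" using finite_subset by blast
  have "\<exists>p. sep (fst t) (fst (snd t)) (snd (snd t)) (fst p) \<and> small (fst t) (fst (snd t)) (snd (snd t)) (fst p) (snd p)"
    if t: "t \<in> T" for t
  proof -
    obtain i j k where ijk: "t = (i, j, k)" "i < 51" "j < 51" "k < 51" "i \<noteq> j" "i \<noteq> k" "j \<noteq> k"
      using t by (auto simp: T_def)
    obtain \<Phi> C where ker: "l2_kernel K \<Phi> C" and sep_\<Phi>: "separates K \<Phi> (l i, bad i) (l j, bad j) (l k, bad k)"
      using att[OF ijk(2-7)] by blast
    have \<Phi>: "\<Phi> x y = - \<Phi> y x" "\<bar>\<Phi> x y\<bar> \<le> 1" for x y using ker unfolding l2_kernel_def by blast+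
    define f where "f = cyclic_sum \<Phi>"
    interpret coupled_cocycle G K M a b Y D f C
    proof
      show "\<bar>f x y z\<bar> \<le> 3" for x y z
        using \<Phi>(2)[of x y] \<Phi>(2)[of y z] \<Phi>(2)[of z x] unfolding f_def cyclic_sum_def by linarith
      show "f y z w - f x z w + f x y w - f x y z = 0" for x y z w
        using \<Phi>(1)[of w y] \<Phi>(1)[of z x] unfolding f_def cyclic_sum_def by linarith
      show "(\<Sum>g\<in>W. (f (g \<otimes>\<^bsub>K\<^esub> x) (g \<otimes>\<^bsub>K\<^esub> y) (g \<otimes>\<^bsub>K\<^esub> z))\<^sup>2) \<le> C"
        if "x \<in> carrier K" "y \<in> carrier K" "z \<in> carrier K" "finite W" "W \<subseteq> carrier K" for x y z W
        using ker that unfolding l2_kernel_def f_def by blast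
    qed
    obtain B where "small i j k f B"
      using restricted_mean_small[OF E(1,2) nC l[OF ijk(2)] l[OF ijk(3)] l[OF ijk(4)] F(1,3)] FE ijk(2-4)
      unfolding small_def by blast
    moreover have "sep i j k f"
      using f_bound sep_\<Phi> unfolding sep_def f_def separates_def by auto
    ultimately show ?thesis using ijk(1) by (intro exI[of _ "(f, B)"]) simp
  qed
  then have "\<forall>t\<in>T. \<exists>p. sep (fst t) (fst (snd t)) (snd (snd t)) (fst p) \<and>
      small (fst t) (fst (snd t)) (snd (snd t)) (fst p) (snd p)" by blast
  from bchoice[OF this] obtain p where p: "\<And>i j k. (i, j, k) \<in> T \<Longrightarrow>
      sep i j k (fst (p (i, j, k))) \<and> small i j k (fst (p (i, j, k))) (snd (p (i, j, k)))" by force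
  define B where "B t = snd (p t)" for t
  have B0: "B t \<ge> 0" if "t \<in> T" for t using p[of "fst t" "fst (snd t)" "snd (snd t)"] that by (simp add: B_def small_def)
  \<comment> \<open>The sum over all triples dominates the constant of whichever triple is selected
    after the law; the 1 keeps the denominator positive.\<close>
  define \<eta> where "\<eta> = \<mu> Y / (4 * (sum B T + 1))"
  have sB: "sum B T \<ge> 0" by (intro sum_nonneg B0)
  have \<eta>: "\<eta> > 0" using \<mu>_Y(2) sB by (simp add: \<eta>_def)
  obtain I :: "(nat \<times> 'g list) set" and q z where sp: "G.spreads F \<eta> I q z"
    using G.ex_spreads[OF inf F \<eta>] by blast
  have I: "finite I" "\<And>i. i \<in> I \<Longrightarrow> q i \<ge> 0" "sum q I = 1" "\<And>i. i \<in> I \<Longrightarrow> z i \<in> carrier G"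
    using sp by (auto simp: G.spreads_def)
  \<comment> \<open>The probability, scaled by \<open>\<mu> Y\<close>, that a sample read in
    \<open>K\<close> falls into the repelling set of \<open>j\<close>. Invariance under
    \<open>K\<close> makes it legitimate to compute it at \<one> instead of at
    \<open>l j\<close>.\<close>
  define \<nu> where "\<nu> j = (\<Sum>i\<in>I. q i * \<mu> (level \<one>\<^bsub>K\<^esub> (z i) (bad j)))" for j
  have \<nu>0: "\<nu> j \<ge> 0" for j unfolding \<nu>_def using I(2) by (intro sum_nonneg mult_nonneg_nonneg) auto
  have "(\<Sum>j<51. \<nu> j) = (\<Sum>i\<in>I. q i * (\<Sum>j<51. \<mu> (level \<one>\<^bsub>K\<^esub> (z i) (bad j))))"
    unfolding \<nu>_def by (subst sum.swap) (simp add: sum_distrib_left)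
  also have "\<dots> \<le> (\<Sum>i\<in>I. q i * \<mu> Y)"
    using I by (intro sum_mono mult_left_mono sum_measure_level_le disj) auto
  also have "\<dots> = \<mu> Y" using I(3) by (simp flip: sum_distrib_right)
  finally have \<nu>_sum: "(\<Sum>j<51. \<nu> j) \<le> \<mu> Y" .
  define good where "good = {j \<in> {..<51::nat}. \<nu> j \<le> \<mu> Y / 48}"
  have "card good \<ge> 3"
  proof (rule ccontr)
    assume "\<not> card good \<ge> 3"
    moreover have "card ({..<51} - good) = 51 - card good"
      by (subst card_Diff_subset) (auto simp: good_def)
    ultimately have card: "card ({..<51} - good) \<ge> 49" by simp
    have "49 * (\<mu> Y / 48) \<le> real (card ({..<51} - good)) * (\<mu> Y / 48)"
      using card \<mu>_Y(2) by (intro mult_right_mono) auto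
    also have "\<dots> = (\<Sum>j\<in>{..<51} - good. \<mu> Y / 48)" by simp
    also have "\<dots> \<le> (\<Sum>j\<in>{..<51} - good. \<nu> j)" by (intro sum_mono) (auto simp: good_def)
    also have "\<dots> \<le> (\<Sum>j<51. \<nu> j)" using \<nu>0 by (intro sum_mono2) auto
    also have "\<dots> \<le> \<mu> Y" by (rule \<nu>_sum)
    finally show False using \<mu>_Y(2) by simp
  qed
  then obtain S where "S \<subseteq> good" "card S = 3" using obtain_subset_with_card_n by metis
  then obtain i j k where ijk: "i \<in> good" "j \<in> good" "k \<in> good" "i \<noteq> j" "i \<noteq> k" "j \<noteq> k"
    by (auto simp: card_3_iff)
  then have t: "(i, j, k) \<in> T" by (auto simp: T_def good_def)
  have lt: "i < 51" "j < 51" "k < 51" using ijk by (auto simp: good_def)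
  define f where "f = fst (p (i, j, k))"
  have f3: "\<And>x y z. \<bar>f x y z\<bar> \<le> 3" and f1: "\<And>x y z. x \<in> carrier K \<Longrightarrow> y \<in> carrier K \<Longrightarrow> z \<in> carrier K \<Longrightarrow>
      x \<notin> bad i \<Longrightarrow> y \<notin> bad j \<Longrightarrow> z \<notin> bad k \<Longrightarrow> f (l i \<otimes>\<^bsub>K\<^esub> x) (l j \<otimes>\<^bsub>K\<^esub> y) (l k \<otimes>\<^bsub>K\<^esub> z) = 1"
    using p[OF t] by (auto simp: sep_def f_def)
  let ?int = "\<lambda>i' j' k'. sampled f E (l i) (l j) (l k) (z i') (z j') (z k')"
  let ?bad = "\<lambda>i i'. \<mu> (level \<one>\<^bsub>K\<^esub> (z i') (bad i))"
  have "\<mu> E - 4 * (\<nu> i + \<nu> j + \<nu> k) = mean3 I q (\<lambda>i' j' k'. \<mu> E - 4 * (?bad i i' + ?bad j j' + ?bad k k'))"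
    unfolding \<nu>_def by (rule mean3_affine[OF I(3), symmetric])
  also have "\<dots> \<le> mean3 I q ?int"
    unfolding mean3_def
  proof (intro sum_mono mult_left_mono)
    fix i' j' k' assume i': "i' \<in> I" "j' \<in> I" "k' \<in> I"
    show "\<mu> E - 4 * (?bad i i' + ?bad j j' + ?bad k k') \<le> ?int i' j' k'"
      using integral_good_ge[of E f "l i" "l j" "l k" "z i'" "z j'" "z k'" "bad i" "bad j" "bad k",
          OF E(1,2) f3 l[OF lt(1)] l[OF lt(2)] l[OF lt(3)] I(4)[OF i'(1)] I(4)[OF i'(2)] I(4)[OF i'(3)] f1]
        measure_level[OF l[OF lt(1)] I(4)[OF i'(1)]] measure_level[OF l[OF lt(2)] I(4)[OF i'(2)]]
        measure_level[OF l[OF lt(3)] I(4)[OF i'(3)]] by simp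
    show "q i' * q j' * q k' \<ge> 0" using I(2) i' by simp
  qed
  also have "\<dots> \<le> \<eta> * B (i, j, k)" using p[OF t] sp by (auto simp: small_def f_def B_def)
  also have "\<dots> \<le> \<eta> * (sum B T + 1)"
    using member_le_sum[of "(i, j, k)" T B] t T B0 \<eta> by (intro mult_left_mono) auto
  also have "\<dots> = \<mu> Y / 4" using sB by (simp add: \<eta>_def field_simps)
  finally have "\<mu> E - 4 * (\<nu> i + \<nu> j + \<nu> k) \<le> \<mu> Y / 4" .
  moreover have "\<nu> i \<le> \<mu> Y / 48" "\<nu> j \<le> \<mu> Y / 48" "\<nu> k \<le> \<mu> Y / 48" using ijk by (auto simp: good_def)
  ultimately show False using E(3) \<mu>_Y(2) by (simp add: field_simps)
qed

end

theorem corollary5: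
  fixes \<Gamma> :: "('g, 'a) monoid_scheme"
    and H :: "('h, 'b) monoid_scheme"
    and L :: "'h set"
  assumes "group \<Gamma>" and "countable (carrier \<Gamma>)"
    and "hyperbolic_group H"
    and "nonelementary_subgroup L H"
    and "measure_equivalent TYPE('s) \<Gamma> (H\<lparr>carrier := L\<rparr>)"
  shows "class_C_reg \<Gamma>"
proof -
  let ?K = "H\<lparr>carrier := L\<rparr>"
  obtain S where S: "group H" "finite S" "S \<subseteq> carrier H" "generate H S = carrier H"
    "gromov_hyperbolic (carrier H) (word_dist H S)"
    using assms(3) by (auto simp: hyperbolic_group_def)
  then obtain \<delta> where \<delta>: "\<delta> \<ge> 0" "\<forall>w\<in>carrier H. \<forall>x\<in>carrier H. \<forall>y\<in>carrier H. \<forall>z\<in>carrier H.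
      gromov_product (word_dist H S) w x z
        \<ge> min (gromov_product (word_dist H S) w x y) (gromov_product (word_dist H S) w y z) - \<delta>"
    by (auto simp: gromov_hyperbolic_def)
  interpret hyp_group H S \<delta>
    using S \<delta> by (intro hyp_group.intro hyp_group_axioms.intro) blast+
  have L: "subgroup L H" "\<not> virtually_cyclic ?K"
    using assms(4) by (auto simp: nonelementary_subgroup_def)
  obtain M :: "'s measure" and a b where M: "countable L" "group ?K" "measure_equivalence_coupling \<Gamma> ?K M a b"
    using assms(5) by (auto simp: measure_equivalent_def)
  then obtain Y D where YD: "fundamental_domain \<Gamma> M a Y" "emeasure M Y < \<infinity>"
    "fundamental_domain ?K M b D" "emeasure M D < \<infinity>"
    by (auto simp: measure_equivalence_coupling_def)
  interpret me_coupling \<Gamma> ?K M a b Y D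
  proof (intro me_coupling.intro fd_action.intro fd_action_axioms.intro me_coupling_axioms.intro)
    fix g h s assume "g \<in> carrier \<Gamma>" "h \<in> carrier ?K" "s \<in> space M"
    then show "a g (b h s) = b h (a g s)"
      using M(3) unfolding measure_equivalence_coupling_def by blast
  qed (use M YD assms(1,2) in \<open>auto simp: measure_equivalence_coupling_def\<close>)
  \<comment> \<open>A finite \<Gamma> would give the coupling finite total measure, which forces the
    subgroup to be finite and hence elementary.\<close>
  have "infinite (carrier \<Gamma>)"
  proof
    assume "finite (carrier \<Gamma>)"
    then have "finite (carrier ?K)"
      using K.finite_if_finite_total_measure[OF nonzero G.finite_total_measure_if_finite] by blast
    then show False using K.virtually_cyclic_if_finite L(2) by blast
  qed
  obtain l :: "nat \<Rightarrow> 'h" and bad where att: "\<And>j. j < 51 \<Longrightarrow> l j \<in> L" "disjoint_family_on bad {..<51}"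
    "\<And>i j k. i < 51 \<Longrightarrow> j < 51 \<Longrightarrow> k < 51 \<Longrightarrow> i \<noteq> j \<Longrightarrow> i \<noteq> k \<Longrightarrow> j \<noteq> k \<Longrightarrow>
       \<exists>F C. l2_kernel ?K F C \<and> separates ?K F (l i, bad i) (l j, bad j) (l k, bad k)"
    using separated_attractors[OF L, of 51] by blast
  show ?thesis
    by (rule class_C_reg_if_separated_attractors[OF \<open>infinite (carrier \<Gamma>)\<close>, of l bad]) (use att in simp_all)
qed

end
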